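(* Let $N$ be the torus bundle over $S^1$ determined by the gluing matrix $\overline A\in GL(2,\mathbb{Z})$, let $f:N\to N$ be a fiberwise map, let $f|_*$ be the endomorphism of $\mathbb{Z}^2$ (and of $\mathbb{R}^2$) induced by $f$ on the fundamental group of a fiber, and let $W_{+1}\subset\mathbb{R}^2$ be the eigenspace of $f|_*$ for the eigenvalue $+1$. There is a fiberwise homotopy from $f$ to a fixed point free map if and only if $f|_*\equiv\mathrm{id}$ or else $W_{+1}$ has dimension $1$ and one of the following conditions holds (with $q$ and $\overline v=(\overline v_1,\overline v_2)$ as defined in the context): (i) $\overline A|W_{+1}=\mathrm{id}$ and $\overline v_2=0$; (ii) $\overline A|W_{+1}=-\mathrm{id}$ and $\overline v_2$ is odd; (iii) $\overline A|W_{+1}=-\mathrm{id}$, $\overline v=(\overline v_1,0)$, $\det\overline A=1$ and $q\equiv0\not\equiv\overline v_1\ (2)$; (iv) $\overline A|W_{+1}=-\mathrm{id}$, $\overline v=(\overline v_1,0)$, $\det\overline A=-1$ and $q$ is an even multiple of the greatest common divisor $r$ of $q$ and $\overline v_1$.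
   Context: Let $T^2=\mathbb{R}^2/\mathbb{Z}^2$, $q_2:\mathbb{R}^2\to T^2$ the projection, $I=[0,1]$, $S^1=I/0\sim1$. $N=(T^2\times I)/(u,1)\sim(A(u),0)$ with projection $p$ to $S^1$, where $A$ is the automorphism of $T^2$ induced by $\overline A$. A continuous $f:N\to N$ is fiberwise if $p\circ f=p$; fiberwise homotopies go through fiberwise maps. The fiber is identified with $T^2=T^2\times\{1\}$. Data. Put $\overline L:=f|_*-\mathrm{id}$. For $\overline v\in\mathbb{Z}^2$ let $s_{\overline v}([t])=[q_2(t\overline v),t]$, a section of $p$; this induces a bijection from $\mathbb{Z}^2/(\overline A-\mathrm{id})\mathbb{Z}^2$ onto the homotopy classes of sections of $p$. $[\overline v]$ is the class corresponding to $f\circ s_0$, where $s_0([t])=[0,t]$, and $\overline v$ is a representative. If $\dim W_{+1}=1$ (so that $\overline L(\mathbb{R}^2)$ is a line), choose a basis $\overline y_1,\overline y_2$ of $\mathbb{Z}^2$ such that $\overline y_1$ generates $\mathbb{Z}^2\cap\overline L(\mathbb{R}^2)$ and $\overline y_2$ realizes the minimal strictly positive distance of elements of $\mathbb{Z}^2$ from this line. Write $\overline v=(\overline v_1,\overline v_2)$ in these coordinates, i.e. $\overline v=\overline v_1\overline y_1+\overline v_2\overline y_2$. Let $q\ge1$ be the order of $(\mathbb{Z}^2\cap\overline L(\mathbb{R}^2))/\overline L(\mathbb{Z}^2)$. $\overline A$ acts on the line $W_{+1}$ as $\pm\mathrm{id}$. If $\overline A|W_{+1}=-\mathrm{id}$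 and $\overline v_2$ is even, the representative $\overline v$ of $[\overline v]$ can be, and is, chosen such that $\overline v_2=0$. *)

theory Defs
  imports "HOL-Analysis.Analysis"
begin

section \<open>Quotient spaces\<close>

definition quotient_topology :: "'a topology \<Rightarrow> ('a \<Rightarrow> 'b) \<Rightarrow> 'b topology" where
  "quotient_topology X \<pi> =
     topology (\<lambda>U. U \<subseteq> \<pi> ` topspace X \<and> openin X {x \<in> topspace X. \<pi> x \<in> U})"

lemma openin_quotient_topology:
  "openin (quotient_topology X \<pi>) U \<longleftrightarrow>
     U \<subseteq> \<pi> ` topspace X \<and> openin X {x \<in> topspace X. \<pi> x \<in> U}"
proof -
  have "istopology (\<lambda>U. U \<subseteq> \<pi> ` topspace X \<and> openin X {x \<in> topspace X. \<pi> x \<in> U})"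
    unfolding istopology_def
  proof (intro conjI allI impI)
    fix S T
    assume S: "S \<subseteq> \<pi> ` topspace X \<and> openin X {x \<in> topspace X. \<pi> x \<in> S}"
      and T: "T \<subseteq> \<pi> ` topspace X \<and> openin X {x \<in> topspace X. \<pi> x \<in> T}"
    have eq: "{x \<in> topspace X. \<pi> x \<in> S \<inter> T} =
          {x \<in> topspace X. \<pi> x \<in> S} \<inter> {x \<in> topspace X. \<pi> x \<in> T}"
      by blast
    show "openin X {x \<in> topspace X. \<pi> x \<in> S \<inter> T}"
      unfolding eq using S T by (blast intro: openin_Int)
    show "S \<inter> T \<subseteq> \<pi> ` topspace X"
      using S by blast
  next
    fix \<K>
    assume K: "\<forall>K\<in>\<K>. K \<subseteq> \<pi> ` topspace X \<and> openin X {x \<in> topspace X. \<pi> x \<in> K}"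
    have "{x \<in> topspace X. \<pi> x \<in> \<Union>\<K>} = (\<Union>K\<in>\<K>. {x \<in> topspace X. \<pi> x \<in> K})"
      by blast
    moreover have "openin X (\<Union>K\<in>\<K>. {x \<in> topspace X. \<pi> x \<in> K})"
      using K by (intro openin_Union) auto
    ultimately show "openin X {x \<in> topspace X. \<pi> x \<in> \<Union>\<K>}"
      by simp
    show "\<Union>\<K> \<subseteq> \<pi> ` topspace X"
      using K by blast
  qed
  then show ?thesis
    by (simp add: quotient_topology_def topology_inverse')
qed

lemma topspace_quotient_topology: "topspace (quotient_topology X \<pi>) = \<pi> ` topspace X"
proof -
  have "{x \<in> topspace X. \<pi> x \<in> \<pi> ` topspace X} = topspace X"
    by blast
  then have "openin (quotient_topology X \<pi>) (\<pi> ` topspace X)"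
    unfolding openin_quotient_topology by simp
  moreover have "topspace (quotient_topology X \<pi>) \<subseteq> \<pi> ` topspace X"
    using openin_topspace[of "quotient_topology X \<pi>"] unfolding openin_quotient_topology by blast
  ultimately show ?thesis
    using openin_subset by blast
qed

lemma quotient_map_quotient_topology: "quotient_map X (quotient_topology X \<pi>) \<pi>"
  unfolding quotient_map_def openin_quotient_topology topspace_quotient_topology by blast

text \<open>The class of \<^term>\<open>x\<close> for the equivalence relation on \<^term>\<open>S\<close> generated by \<^term>\<open>R\<close>.\<close>

definition glue_class :: "'a set \<Rightarrow> ('a \<times> 'a) set \<Rightarrow> 'a \<Rightarrow> 'a set" where
  "glue_class S R x = {y \<in> S. (x, y) \<in> (R \<union> R\<inverse>)\<^sup>*}"


section \<open>The torus, the circle and the torus bundle\<close>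

definition real_vec :: "int ^ 2 \<Rightarrow> real ^ 2" where
  "real_vec n = (\<chi> i. of_int (n $ i))"

definition real_mat :: "int ^ 2 ^ 2 \<Rightarrow> real ^ 2 ^ 2" where
  "real_mat A = map_matrix of_int A"

type_synonym torus_pt = "(real ^ 2) set"
type_synonym bundle_pt = "(torus_pt \<times> real) set"

definition q2 :: "real ^ 2 \<Rightarrow> torus_pt" where
  "q2 x = {y. \<exists>n. y = x + real_vec n}"

definition torus :: "torus_pt topology" where
  "torus = quotient_topology euclidean q2"

definition torus_map :: "int ^ 2 ^ 2 \<Rightarrow> torus_pt \<Rightarrow> torus_pt" where
  "torus_map A u = (\<Union>x\<in>u. q2 (real_mat A *v x))"

definition circle_class :: "real \<Rightarrow> real set" where
  "circle_class = glue_class {0..1} {(0, 1)}"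

definition circle :: "real set topology" where
  "circle = quotient_topology (top_of_set {0..1}) circle_class"

definition bundle_class :: "int ^ 2 ^ 2 \<Rightarrow> torus_pt \<times> real \<Rightarrow> bundle_pt" where
  "bundle_class A =
     glue_class (topspace torus \<times> {0..1}) {((u, 1), (torus_map A u, 0)) | u. u \<in> topspace torus}"

definition torus_bundle :: "int ^ 2 ^ 2 \<Rightarrow> bundle_pt topology" where
  "torus_bundle A = quotient_topology (prod_topology torus (top_of_set {0..1})) (bundle_class A)"

definition bundle_proj :: "bundle_pt \<Rightarrow> real set" where
  "bundle_proj c = (\<Union>(u, t)\<in>c. circle_class t)"


section \<open>Fiberwise maps and sections\<close>

definition over_circle :: "int ^ 2 ^ 2 \<Rightarrow> (bundle_pt \<Rightarrow> bundle_pt) \<Rightarrow> bool" where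
  "over_circle A f \<longleftrightarrow> (\<forall>c \<in> topspace (torus_bundle A). bundle_proj (f c) = bundle_proj c)"

definition fiberwise_map :: "int ^ 2 ^ 2 \<Rightarrow> (bundle_pt \<Rightarrow> bundle_pt) \<Rightarrow> bool" where
  "fiberwise_map A f \<longleftrightarrow> continuous_map (torus_bundle A) (torus_bundle A) f \<and> over_circle A f"

definition fiberwise_homotopic ::
  "int ^ 2 ^ 2 \<Rightarrow> (bundle_pt \<Rightarrow> bundle_pt) \<Rightarrow> (bundle_pt \<Rightarrow> bundle_pt) \<Rightarrow> bool" where
  "fiberwise_homotopic A = homotopic_with (over_circle A) (torus_bundle A) (torus_bundle A)"

definition fixed_point_free :: "int ^ 2 ^ 2 \<Rightarrow> (bundle_pt \<Rightarrow> bundle_pt) \<Rightarrow> bool" where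
  "fixed_point_free A g \<longleftrightarrow> (\<forall>c \<in> topspace (torus_bundle A). g c \<noteq> c)"

text \<open>The section \<open>[t] \<mapsto> [q2 (t v), t]\<close>; the two representatives of \<open>[0] = [1]\<close> give the same class.\<close>

definition std_section :: "int ^ 2 ^ 2 \<Rightarrow> int ^ 2 \<Rightarrow> real set \<Rightarrow> bundle_pt" where
  "std_section A v c = (\<Union>t\<in>c. bundle_class A (q2 (t *\<^sub>R real_vec v), t))"

definition section_homotopic ::
  "int ^ 2 ^ 2 \<Rightarrow> (real set \<Rightarrow> bundle_pt) \<Rightarrow> (real set \<Rightarrow> bundle_pt) \<Rightarrow> bool" where
  "section_homotopic A =
     homotopic_with (\<lambda>s. \<forall>c \<in> topspace circle. bundle_proj (s c) = c) circle (torus_bundle A)"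


section \<open>The endomorphism of the fundamental group of the fiber\<close>

text \<open>The restriction of a fiberwise map to the fiber over \<open>[1]\<close>, identified with the torus via
  \<open>u \<mapsto> [u, 1]\<close>.\<close>

definition fiber_map :: "int ^ 2 ^ 2 \<Rightarrow> (bundle_pt \<Rightarrow> bundle_pt) \<Rightarrow> torus_pt \<Rightarrow> torus_pt" where
  "fiber_map A f u = (THE w. w \<in> topspace torus \<and> f (bundle_class A (u, 1)) = bundle_class A (w, 1))"

definition path_class :: "'a topology \<Rightarrow> (real \<Rightarrow> 'a) \<Rightarrow> (real \<Rightarrow> 'a) set" where
  "path_class X \<gamma> =
     {\<delta>. homotopic_with (\<lambda>h. h 0 = \<gamma> 0 \<and> h 1 = \<gamma> 1) (top_of_set {0..1}) X \<gamma> \<delta>}"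

definition pi1_map :: "'b topology \<Rightarrow> ('a \<Rightarrow> 'b) \<Rightarrow> (real \<Rightarrow> 'a) set \<Rightarrow> (real \<Rightarrow> 'b) set" where
  "pi1_map Y g C = (\<Union>\<gamma>\<in>C. path_class Y (g \<circ> \<gamma>))"

text \<open>For fixed \<^term>\<open>x\<close>, the map \<open>n \<mapsto> torus_pi1 x n\<close> is the usual isomorphism from the integer lattice
  onto the fundamental group of the torus at the base point \<^term>\<open>q2 x\<close>.\<close>

definition torus_pi1 :: "real ^ 2 \<Rightarrow> int ^ 2 \<Rightarrow> (real \<Rightarrow> torus_pt) set" where
  "torus_pi1 x n = path_class torus (\<lambda>t. q2 (x + t *\<^sub>R real_vec n))"

text \<open>The integer matrix \<^term>\<open>F\<close> is the endomorphism that \<^term>\<open>f\<close> induces on the fundamental group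
  of the fiber, with base point \<^term>\<open>q2 0\<close> in the source and its image in the target.\<close>

definition induces_on_fiber ::
  "int ^ 2 ^ 2 \<Rightarrow> (bundle_pt \<Rightarrow> bundle_pt) \<Rightarrow> int ^ 2 ^ 2 \<Rightarrow> bool" where
  "induces_on_fiber A f F \<longleftrightarrow>
     (\<forall>y. q2 y = fiber_map A f (q2 0) \<longrightarrow>
        (\<forall>n. pi1_map torus (fiber_map A f) (torus_pi1 0 n) = torus_pi1 y (F *v n)))"


section \<open>Linear data\<close>

text \<open>\<^term>\<open>W1 F\<close> is the eigenspace of \<^term>\<open>F\<close> for the eigenvalue 1; \<^term>\<open>L_index F\<close> is the order of the lattice of
  integer points in the image of \<^term>\<open>F - mat 1\<close> modulo the image of the integer lattice.\<close>

definition W1 :: "int ^ 2 ^ 2 \<Rightarrow> (real ^ 2) set" where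
  "W1 F = {w. real_mat F *v w = w}"

definition L_mat :: "int ^ 2 ^ 2 \<Rightarrow> int ^ 2 ^ 2" where
  "L_mat F = F - mat 1"

definition L_image :: "int ^ 2 ^ 2 \<Rightarrow> (real ^ 2) set" where
  "L_image F = range (\<lambda>x. real_mat (L_mat F) *v x)"

definition lattice_in_L_image :: "int ^ 2 ^ 2 \<Rightarrow> (int ^ 2) set" where
  "lattice_in_L_image F = {n. real_vec n \<in> L_image F}"

definition L_index :: "int ^ 2 ^ 2 \<Rightarrow> nat" where
  "L_index F =
     card (lattice_in_L_image F //
       {(m, n). m \<in> lattice_in_L_image F \<and> n \<in> lattice_in_L_image F \<and>
                n - m \<in> range (\<lambda>k. L_mat F *v k)})"

definition adapted_basis :: "int ^ 2 ^ 2 \<Rightarrow> int ^ 2 \<Rightarrow> int ^ 2 \<Rightarrow> bool" where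
  "adapted_basis F y1 y2 \<longleftrightarrow>
     (\<forall>n. \<exists>!(a, b). n = a *s y1 + b *s y2) \<and>
     lattice_in_L_image F = range (\<lambda>k. k *s y1) \<and>
     infdist (real_vec y2) (L_image F) > 0 \<and>
     (\<forall>n. infdist (real_vec n) (L_image F) > 0 \<longrightarrow>
          infdist (real_vec y2) (L_image F) \<le> infdist (real_vec n) (L_image F))"

end

theory Submission
  imports Defs
begin

text \<open>A fiberwise map lifts to \<open>K\<close> on \<open>\<real>\<^sup>2 \<times> [0,1]\<close>, and its homotopies amount to deformations of the
  displacement \<open>h (x, t) = K (x, t) - x\<close>. The displacement satisfies \<open>h (x + n, t) = h (x, t) + L n\<close> and
  \<open>h (A x, 0) = A (h (x, 1) - v)\<close>, all maps with these two properties are homotopic by straight lines,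
  and \<open>f\<close> can be made fixed point free iff one of them avoids the integer lattice. If \<open>L\<close> is invertible,
  \<open>h\<close> is a bounded perturbation of a linear isomorphism, hence onto; if \<open>L = 0\<close>, a path in the
  complement of the lattice does.

  If \<open>L\<close> has rank 1, then in the adapted basis \<open>A\<close> is upper triangular with diagonal \<open>(\<alpha>, \<delta>)\<close>, where
  \<open>\<delta>\<close> is the eigenvalue of \<open>A\<close> on \<open>W\<^sub>+\<^sub>1\<close>, and \<open>h\<close> induces a map of the torus to the cylinder
  \<open>\<real>\<^sup>2 / (q\<int> \<times> 0)\<close> punctured at the lattice points. Let \<open>\<nu> p\<close> be the winding number about the puncture
  \<open>p\<close> of the loop that goes once around the cylinder. It is 0 or 1 for punctures far away on either
  side of the loop, and the gluing condition gives \<open>\<nu> (A (p - v)) = \<nu> p\<close> if \<open>\<delta> = 1\<close> and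
  \<open>\<nu> (A (p - v)) = 1 - \<nu> p\<close> if \<open>\<delta> = -1\<close>. In the first case \<open>v\<^sub>2 \<noteq> 0\<close> would push a puncture from one
  end to the other; in the second case \<open>p \<mapsto> A (p - v)\<close> has no orbit of odd length on the punctures of
  the cylinder. Conversely, horizontal lines and, at height 0, curves that pass above half of the
  punctures and below the other half realise all remaining cases.\<close>

section \<open>The gluing of the bundle\<close>

lemma real_vec_simps [simp]:
  "real_vec (m + n) = real_vec m + real_vec n"
  "real_vec (m - n) = real_vec m - real_vec n"
  "real_vec (- n) = - real_vec n"
  "real_vec 0 = 0"
  by (simp_all add: real_vec_def vec_eq_iff)

lemma real_vec_nth [simp]: "real_vec n $ i = of_int (n $ i)"
  by (simp add: real_vec_def)

lemma real_vec_eq_iff [simp]: "real_vec m = real_vec n \<longleftrightarrow> m = n"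
  by (simp add: vec_eq_iff)

lemma real_mat_nth [simp]: "real_mat A $ i $ j = of_int (A $ i $ j)"
  by (simp add: real_mat_def map_matrix_def)

lemma real_mat_real_vec [simp]: "real_mat A *v real_vec n = real_vec (A *v n)"
  by (simp add: vec_eq_iff matrix_vector_mult_def)

lemma real_mat_mult: "real_mat (A ** B) = real_mat A ** real_mat B"
  by (simp add: vec_eq_iff matrix_matrix_mult_def)

lemma real_mat_diff: "real_mat (A - B) = real_mat A - real_mat B"
  by (simp add: vec_eq_iff)

lemma real_mat_one [simp]: "real_mat (mat 1) = mat 1"
  by (simp add: vec_eq_iff mat_def)

lemma continuous_on_matrix_vector_mult [continuous_intros]:
  fixes M :: "real ^ 'n ^ 'm"
  assumes "continuous_on S f"
  shows "continuous_on S (\<lambda>x. M *v f x)"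
  using bounded_linear.continuous_on[OF matrix_vector_mul_bounded_linear assms] .

lemma range_real_vec_iff: "x \<in> range real_vec \<longleftrightarrow> (\<forall>i. x $ i \<in> \<int>)"
proof
  assume "\<forall>i. x $ i \<in> \<int>"
  then have "x = real_vec (\<chi> i. \<lfloor>x $ i\<rfloor>)"
    by (simp add: vec_eq_iff)
  then show "x \<in> range real_vec" by blast
qed auto

text \<open>Distinct integers are at distance at least 1, so the range is discrete.\<close>

lemma continuous_Ints_constant:
  fixes f :: "'a::topological_space \<Rightarrow> real"
  assumes "connected S" "continuous_on S f" "\<And>x. x \<in> S \<Longrightarrow> f x \<in> \<int>"
  shows "f constant_on S"
proof (rule continuous_discrete_range_constant[OF assms(1,2)])
  fix x assume "x \<in> S"
  have "1 \<le> norm (f y - f x)" if "y \<in> S" "f y \<noteq> f x" for y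
    using that assms(3)[OF \<open>x \<in> S\<close>] assms(3)[OF \<open>y \<in> S\<close>]
    by (auto elim!: Ints_cases simp flip: of_int_diff of_int_abs)
  then show "\<exists>e>0. \<forall>y. y \<in> S \<and> f y \<noteq> f x \<longrightarrow> e \<le> norm (f y - f x)"
    by (intro exI[of _ 1]) auto
qed

text \<open>Source of the constants attached to lifts: two lifts of one map differ by a
  lattice-valued function, which on a connected parameter space is a single lattice vector.\<close>

lemma continuous_lattice_constant:
  assumes "connected S" "continuous_on S f" "\<And>x. x \<in> S \<Longrightarrow> f x \<in> range real_vec"
  shows "\<exists>n. \<forall>x\<in>S. f x = real_vec n"
proof (cases "S = {}")
  case False
  then obtain a where a: "a \<in> S" by blast
  then obtain n where n: "f a = real_vec n" using assms(3) by blast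
  have "f x = real_vec n" if "x \<in> S" for x
  proof -
    have "f x $ i = f a $ i" for i
    proof -
      have "(\<lambda>x. f x $ i) constant_on S"
        using assms by (intro continuous_Ints_constant continuous_intros)
          (auto simp: range_real_vec_iff)
      then show ?thesis using that a unfolding constant_on_def by metis
    qed
    then show ?thesis using n by (simp add: vec_eq_iff)
  qed
  then show ?thesis by blast
qed auto

section \<open>The torus as a quotient of the plane\<close>

lemma q2_eq_iff: "q2 x = q2 y \<longleftrightarrow> y - x \<in> range real_vec"
proof
  assume "q2 x = q2 y"
  moreover have "y \<in> q2 y" unfolding q2_def using real_vec_simps(4) by (metis (mono_tags, lifting) add_0_right mem_Collect_eq)
  ultimately have "y \<in> q2 x" by simp
  then obtain n where "y = x + real_vec n" unfolding q2_def by blast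
  then show "y - x \<in> range real_vec" by auto
next
  assume "y - x \<in> range real_vec"
  then obtain n where n: "y = x + real_vec n" by (metis add_diff_cancel_left' diff_add_cancel add.commute imageE)
  show "q2 x = q2 y"
  proof (intro set_eqI iffI)
    fix z assume "z \<in> q2 x"
    then obtain m where "z = x + real_vec m" unfolding q2_def by auto
    then have "z = y + real_vec (m - n)" using n by simp
    then show "z \<in> q2 y" unfolding q2_def by blast
  next
    fix z assume "z \<in> q2 y"
    then obtain m where "z = y + real_vec m" unfolding q2_def by auto
    then have "z = x + real_vec (n + m)" using n by simp
    then show "z \<in> q2 x" unfolding q2_def by blast
  qed
qed

lemma q2_add_real_vec [simp]: "q2 (x + real_vec n) = q2 x"
  using q2_eq_iff[of x "x + real_vec n"] by simp

lemma topspace_torus: "topspace torus = range q2"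
  by (simp add: torus_def topspace_quotient_topology)

lemma quotient_map_q2: "quotient_map euclidean torus q2"
  unfolding torus_def by (rule quotient_map_quotient_topology)

lemma torus_map_q2 [simp]: "torus_map A (q2 x) = q2 (real_mat A *v x)"
proof -
  have *: "q2 (real_mat A *v y) = q2 (real_mat A *v x)" if "y \<in> q2 x" for y
    using that by (auto simp: q2_def[of x] matrix_vector_right_distrib)
  have "x \<in> q2 x" unfolding q2_def using real_vec_simps(4) by (metis (mono_tags, lifting) add_0_right mem_Collect_eq)
  with * show ?thesis unfolding torus_map_def by blast
qed

section \<open>Classes of a gluing relation\<close>

lemma glue_class_eq_iff_rtrancl:
  assumes "x \<in> S" "y \<in> S"
  shows "glue_class S R x = glue_class S R y \<longleftrightarrow> (x, y) \<in> (R \<union> R\<inverse>)\<^sup>*"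
proof
  assume eq: "glue_class S R x = glue_class S R y"
  have "y \<in> glue_class S R y" unfolding glue_class_def using assms by auto
  then have "y \<in> glue_class S R x" using eq by simp
  then show "(x, y) \<in> (R \<union> R\<inverse>)\<^sup>*" unfolding glue_class_def by simp
next
  assume xy: "(x, y) \<in> (R \<union> R\<inverse>)\<^sup>*"
  then have "(y, x) \<in> (R \<union> R\<inverse>)\<^sup>*"
    by (metis converse_Un converse_converse rtrancl_converseI sup_commute)
  then show "glue_class S R x = glue_class S R y"
    unfolding glue_class_def using xy by (auto intro: rtrancl_trans)
qed

lemma glue_class_mem:
  assumes "x \<in> S" "y \<in> glue_class S R x"
  shows "y \<in> S" "glue_class S R y = glue_class S R x"
  using assms glue_class_eq_iff_rtrancl[of x S y R] by (auto simp: glue_class_def)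

lemma glue_class_self: "x \<in> S \<Longrightarrow> x \<in> glue_class S R x"
  by (simp add: glue_class_def)

text \<open>Gluing steps along an injective relation with disjoint domain and range never compose.\<close>

lemma glue_class_eq_iff:
  assumes "single_valued R" "single_valued (R\<inverse>)" "Domain R \<inter> Range R = {}"
    and "x \<in> S" "y \<in> S"
  shows "glue_class S R x = glue_class S R y \<longleftrightarrow> x = y \<or> (x, y) \<in> R \<or> (y, x) \<in> R"
proof -
  have "(x, y) \<in> (R \<union> R\<inverse>)\<^sup>* \<longleftrightarrow> x = y \<or> (x, y) \<in> R \<or> (y, x) \<in> R"
  proof
    assume "(x, y) \<in> (R \<union> R\<inverse>)\<^sup>*"
    then show "x = y \<or> (x, y) \<in> R \<or> (y, x) \<in> R"
    proof induction
      case (step y z)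
      then show ?case
        using assms(1-3) unfolding single_valued_def by blast
    qed simp
  qed auto
  then show ?thesis using glue_class_eq_iff_rtrancl assms(4,5) by metis
qed

lemma circle_class_eq_iff:
  assumes "s \<in> {0..1}" "t \<in> {0..1}"
  shows "circle_class s = circle_class t \<longleftrightarrow> s = t \<or> (s = 0 \<and> t = 1) \<or> (s = 1 \<and> t = 0)"
  unfolding circle_class_def using assms
  by (subst glue_class_eq_iff) (auto simp: single_valued_def)

lemma matrix_vector_cancel_left:
  assumes "A' ** A = (mat 1 :: 'a::comm_ring_1 ^ 'n ^ 'n)"
  shows "A' *v (A *v x) = x"
  using assms by (simp add: matrix_vector_mul_assoc)

text \<open>Composite of \<open>q2\<close> on the first factor with the gluing; it presents N as a
  single quotient of the slab \<open>UNIV \<times> {0..1}\<close>, where all computations take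
  place.\<close>

definition bundle_pr :: "int ^ 2 ^ 2 \<Rightarrow> (real ^ 2) \<times> real \<Rightarrow> bundle_pt" where
  "bundle_pr A z = bundle_class A (q2 (fst z), snd z)"

text \<open>The inverse is a parameter so that it is available as an integer matrix. The locale
  serves for the gluing matrix and, later, for changes of basis of the lattice.\<close>

locale gluing =
  fixes A A' :: "int ^ 2 ^ 2"
  assumes AA': "A ** A' = mat 1" and A'A: "A' ** A = mat 1"
begin

lemma real_AA' [simp]: "real_mat A *v (real_mat A' *v x) = x"
  by (rule matrix_vector_cancel_left) (metis AA' real_mat_mult real_mat_one)

lemma real_A'A [simp]: "real_mat A' *v (real_mat A *v x) = x"
  by (rule matrix_vector_cancel_left) (metis A'A real_mat_mult real_mat_one)

lemma A_range_iff: "real_mat A *v x \<in> range real_vec \<longleftrightarrow> x \<in> range real_vec"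
proof
  assume "real_mat A *v x \<in> range real_vec"
  then obtain n where "real_mat A *v x = real_vec n" by blast
  then have "x = real_vec (A' *v n)"
    by (metis real_A'A real_mat_real_vec)
  then show "x \<in> range real_vec" by blast
qed auto

lemma q2_A_eq_iff: "q2 (real_mat A *v x) = q2 (real_mat A *v y) \<longleftrightarrow> q2 x = q2 y"
  by (simp add: q2_eq_iff A_range_iff flip: matrix_vector_mult_diff_distrib)

lemma bundle_class_eq_iff:
  assumes "s \<in> {0..1}" "t \<in> {0..1}"
  shows "bundle_class A (q2 x, s) = bundle_class A (q2 y, t) \<longleftrightarrow>
    (q2 x = q2 y \<and> s = t) \<or> (s = 1 \<and> t = 0 \<and> q2 y = q2 (real_mat A *v x)) \<or>
    (s = 0 \<and> t = 1 \<and> q2 x = q2 (real_mat A *v y))"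
proof -
  let ?R = "{((u, 1), (torus_map A u, 0)) | u. u \<in> topspace torus} :: ((torus_pt \<times> real) \<times> _) set"
  have "single_valued ?R"
    by (auto simp: single_valued_def)
  moreover have "single_valued (?R\<inverse>)"
    unfolding single_valued_def topspace_torus using q2_A_eq_iff by fastforce
  moreover have "Domain ?R \<inter> Range ?R = {}"
    by fastforce
  moreover have "((q2 x, s), (q2 y, t)) \<in> ?R \<longleftrightarrow> s = 1 \<and> t = 0 \<and> q2 y = q2 (real_mat A *v x)"
    for x y s t
    by (simp add: topspace_torus) blast
  ultimately show ?thesis
    unfolding bundle_class_def using assms
    by (subst glue_class_eq_iff) (simp_all add: topspace_torus, blast)
qed

lemma bundle_pr_eq_iff:
  assumes "s \<in> {0..1}" "t \<in> {0..1}"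
  shows "bundle_pr A (x, s) = bundle_pr A (y, t) \<longleftrightarrow>
    (q2 x = q2 y \<and> s = t) \<or> (s = 1 \<and> t = 0 \<and> q2 y = q2 (real_mat A *v x)) \<or>
    (s = 0 \<and> t = 1 \<and> q2 x = q2 (real_mat A *v y))"
  using bundle_class_eq_iff[OF assms] by (simp add: bundle_pr_def)

lemma bundle_pr_glue: "bundle_pr A (real_mat A *v x, 0) = bundle_pr A (x, 1)"
  by (subst bundle_pr_eq_iff) auto

lemma bundle_pr_shift [simp]: "bundle_pr A (x + real_vec n, t) = bundle_pr A (x, t)"
  by (simp add: bundle_pr_def)

text \<open>The unit interval is locally compact Hausdorff, so the product of \<open>q2\<close> with
  its identity is still a quotient map; the gluing is composed with it.\<close>

lemma quotient_map_bundle_pr: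
  "quotient_map (top_of_set (UNIV \<times> {0..1})) (torus_bundle A) (bundle_pr A)"
proof -
  have I: "locally_compact_space (top_of_set {0..1::real})" "Hausdorff_space (top_of_set {0..1::real})"
    by (simp_all add: compact_imp_locally_compact_space compact_space_subtopology
        Hausdorff_space_subtopology)
  have "quotient_map (prod_topology euclidean (top_of_set {0..1::real}))
      (prod_topology torus (top_of_set {0..1})) (\<lambda>(x, y). (q2 x, y))"
    using I by (intro quotient_map_prod_left quotient_map_q2) auto
  then have "quotient_map (prod_topology euclidean (top_of_set {0..1::real}))
      (torus_bundle A) (bundle_class A \<circ> (\<lambda>(x, y). (q2 x, y)))"
    unfolding torus_bundle_def
    by (rule quotient_map_compose) (rule quotient_map_quotient_topology)
  moreover have "prod_topology euclidean (top_of_set {0..1::real}) =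
      top_of_set ((UNIV :: (real^2) set) \<times> {0..1})"
    by (simp add: prod_topology_subtopology)
  moreover have "bundle_class A \<circ> (\<lambda>(x, y). (q2 x, y)) = bundle_pr A"
    by (auto simp: bundle_pr_def)
  ultimately show ?thesis by simp
qed

lemma topspace_torus_bundle: "topspace (torus_bundle A) = bundle_pr A ` (UNIV \<times> {0..1})"
  using quotient_map_bundle_pr unfolding quotient_map_def by simp

lemma bundle_proj_pr:
  assumes "t \<in> {0..1}"
  shows "bundle_proj (bundle_pr A (x, t)) = circle_class t"
proof -
  have xt: "(q2 x, t) \<in> topspace torus \<times> {0..1}"
    using assms by (simp add: topspace_torus)
  have "circle_class r = circle_class t" if "(u, r) \<in> bundle_class A (q2 x, t)" for u r
  proof -
    have ur: "(u, r) \<in> topspace torus \<times> {0..1}" "bundle_class A (u, r) = bundle_class A (q2 x, t)"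
      using glue_class_mem[OF xt] that unfolding bundle_class_def by auto
    then obtain y where "u = q2 y" "r \<in> {0..1}" by (auto simp: topspace_torus)
    then show ?thesis
      using ur(2) bundle_class_eq_iff[of r t y x] assms by (auto simp: circle_class_eq_iff)
  qed
  then have "bundle_proj (bundle_pr A (x, t)) \<subseteq> circle_class t"
    unfolding bundle_pr_def bundle_proj_def by fastforce
  moreover have "(q2 x, t) \<in> bundle_pr A (x, t)"
    using glue_class_self[OF xt] by (simp add: bundle_pr_def bundle_class_def)
  then have "circle_class t \<subseteq> bundle_proj (bundle_pr A (x, t))"
    unfolding bundle_proj_def by (auto intro: bexI[of _ "(q2 x, t)"])
  ultimately show ?thesis by blast
qed

lemma std_section_circle_class:
  assumes "t \<in> {0..1}"
  shows "std_section A v (circle_class t) = bundle_pr A (t *\<^sub>R real_vec v, t)"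
proof -
  have "bundle_class A (q2 (s *\<^sub>R real_vec v), s) = bundle_pr A (t *\<^sub>R real_vec v, t)"
    if "s \<in> circle_class t" for s
  proof -
    have s: "s \<in> {0..1}" "circle_class s = circle_class t"
      using glue_class_mem[OF assms] that unfolding circle_class_def by auto
    \<comment> \<open>Only the class of 0 and 1 has two elements. At level 1 the section passes
      through the lattice vector \<open>v\<close>, which is carried to another lattice vector at
      level 0, hence to the class of the origin.\<close>
    have "bundle_pr A (0, 0) = bundle_pr A (real_vec v, 1)"
      using bundle_pr_glue[of "real_vec v"] bundle_pr_shift[of 0 "A *v v" 0] by simp
    moreover have "s = t \<or> s = 0 \<and> t = 1 \<or> s = 1 \<and> t = 0"
      using circle_class_eq_iff[OF s(1) assms] s(2) by simp
    ultimately show ?thesis unfolding bundle_pr_def by auto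
  qed
  moreover have "t \<in> circle_class t"
    unfolding circle_class_def by (rule glue_class_self) (fact assms)
  ultimately show ?thesis unfolding std_section_def by blast
qed

end


section \<open>Lifting maps into the torus and the bundle\<close>

lemma cis_eq_iff_Ints: "cis (2 * pi * a) = cis (2 * pi * b) \<longleftrightarrow> a - b \<in> \<int>"
proof -
  have "cis (2 * pi * a) = cis (2 * pi * b) \<longleftrightarrow> (\<exists>n::int. 2 * pi * a = 2 * pi * b + 2 * pi * n)"
    using sin_cos_eq_iff[of "2 * pi * a" "2 * pi * b"] by (auto simp: complex_eq_iff)
  also have "\<dots> \<longleftrightarrow> (\<exists>n::int. a - b = n)"
  proof -
    have "2 * pi * a = 2 * pi * b + 2 * pi * n \<longleftrightarrow> a - b = n" for n
    proof -
      have "2 * pi * a = 2 * pi * b + 2 * pi * n \<longleftrightarrow> 2 * pi * a = 2 * pi * (b + n)"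
        by (simp add: algebra_simps)
      then show ?thesis by auto
    qed
    then show ?thesis by simp
  qed
  finally show ?thesis unfolding Ints_def by auto
qed

text \<open>A convex set is contractible, so a nowhere vanishing function on it has a continuous
  logarithm; the real part of the logarithm vanishes on the unit circle.\<close>

lemma convex_angle_lift:
  fixes f :: "'a::real_normed_vector \<Rightarrow> complex"
  assumes "convex S" "continuous_on S f" "\<And>x. x \<in> S \<Longrightarrow> norm (f x) = 1"
  obtains \<theta> where "continuous_on S \<theta>" "\<And>x. x \<in> S \<Longrightarrow> f x = cis (2 * pi * \<theta> x)"
proof -
  have nz: "f x \<noteq> 0" if "x \<in> S" for x
    using assms(3)[OF that] by auto
  obtain g where g: "continuous_on S g" "\<And>x. x \<in> S \<Longrightarrow> f x = exp (g x)"
    using continuous_logarithm_on_contractible[OF assms(2) convex_imp_contractible[OF assms(1)] nz]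
    by blast
  have "f x = cis (2 * pi * (Im (g x) / (2 * pi)))" if "x \<in> S" for x
  proof -
    have "exp (Re (g x)) = 1"
      using assms(3)[OF that] g(2)[OF that] by simp
    then show ?thesis
      using g(2)[OF that] by (simp add: exp_eq_polar)
  qed
  moreover have "continuous_on S (\<lambda>x. Im (g x) / (2 * pi))"
    using g(1) by (intro continuous_intros) auto
  ultimately show thesis using that[of "\<lambda>x. Im (g x) / (2 * pi)"] by blast
qed

text \<open>The choice \<open>x\<close> may jump by lattice vectors. Its coordinates modulo 1 vary
  continuously, and angle lifts of them form a continuous choice.\<close>

lemma convex_q2_lift:
  fixes S :: "'a::real_normed_vector set" and x :: "'a \<Rightarrow> real ^ 2"
  assumes "convex S" "\<And>i. continuous_on S (\<lambda>s. cis (2 * pi * x s $ i))"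
  obtains g where "continuous_on S g" "\<And>s. s \<in> S \<Longrightarrow> q2 (g s) = q2 (x s)"
proof -
  have "\<exists>\<theta>. continuous_on S \<theta> \<and> (\<forall>s\<in>S. cis (2 * pi * x s $ i) = cis (2 * pi * \<theta> s))" for i
    by (rule convex_angle_lift[OF assms(1) assms(2)[of i]]) auto
  then obtain \<theta> where \<theta>: "\<And>i. continuous_on S (\<theta> i)"
    "\<And>i s. s \<in> S \<Longrightarrow> cis (2 * pi * x s $ i) = cis (2 * pi * \<theta> i s)"
    by metis
  show thesis
  proof
    show "continuous_on S (\<lambda>s. \<chi> i. \<theta> i s)"
      using \<theta>(1) by (intro continuous_on_vec_lambda)
    show "q2 (\<chi> i. \<theta> i s) = q2 (x s)" if "s \<in> S" for s
      using \<theta>(2)[OF that] by (simp add: q2_eq_iff range_real_vec_iff cis_eq_iff_Ints)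
  qed
qed

text \<open>The characters cis (2 pi x_i) are lattice periodic and descend to the torus. Composed
  with \<open>G\<close> they show that an arbitrary choice of preimages is continuous modulo the
  lattice.\<close>

lemma torus_lift:
  fixes S :: "'a::real_normed_vector set"
  assumes "convex S" "continuous_map (top_of_set S) torus G"
  obtains g where "continuous_on S g" "\<And>s. s \<in> S \<Longrightarrow> G s = q2 (g s)"
proof -
  have "\<exists>x. G s = q2 x" if "s \<in> S" for s
    using continuous_map_image_subset_topspace[OF assms(2)] that by (auto simp: topspace_torus)
  then obtain x where x: "\<And>s. s \<in> S \<Longrightarrow> G s = q2 (x s)" by metis
  have "continuous_on S (\<lambda>s. cis (2 * pi * x s $ i))" for i
  proof -
    obtain \<Phi> where \<Phi>: "continuous_map torus euclidean \<Phi>" "\<And>x. \<Phi> (q2 x) = cis (2 * pi * x $ i)"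
    proof (rule quotient_map_lift_exists[OF quotient_map_q2])
      show "continuous_map euclidean euclidean (\<lambda>x::real^2. cis (2 * pi * x $ i))"
        by (simp, intro continuous_intros)
      show "cis (2 * pi * x $ i) = cis (2 * pi * y $ i)" if "q2 x = q2 y" for x y
        using that by (metis cis_eq_iff_Ints q2_eq_iff range_real_vec_iff vector_minus_component)
    qed auto
    have "continuous_map (top_of_set S) euclidean (\<Phi> \<circ> G)"
      using assms(2) \<Phi>(1) by (rule continuous_map_compose)
    then have "continuous_on S (\<Phi> \<circ> G)" by simp
    then show ?thesis
      by (rule continuous_on_eq) (simp add: x \<Phi>)
  qed
  then obtain g where "continuous_on S g" "\<And>s. s \<in> S \<Longrightarrow> q2 (g s) = q2 (x s)"
    using convex_q2_lift[OF assms(1)] by metis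
  then show thesis using that x by metis
qed

section \<open>Lifting maps into the bundle\<close>

context gluing
begin

text \<open>Universal property of N as a quotient of the slab: lattice periodicity and the gluing
  rule generate all identifications.\<close>

lemma bundle_function:
  fixes \<phi> :: "(real ^ 2) \<times> real \<Rightarrow> 'a::topological_space"
  assumes "continuous_on (UNIV \<times> {0..1}) \<phi>"
    and "\<And>x n t. t \<in> {0..1} \<Longrightarrow> \<phi> (x + real_vec n, t) = \<phi> (x, t)"
    and "\<And>x. \<phi> (real_mat A *v x, 0) = \<phi> (x, 1)"
  obtains \<Phi> where "continuous_map (torus_bundle A) euclidean \<Phi>"
    "\<And>x t. t \<in> {0..1} \<Longrightarrow> \<Phi> (bundle_pr A (x, t)) = \<phi> (x, t)"
proof -
  have q: "\<phi> (x, t) = \<phi> (y, t)" if "t \<in> {0..1}" and xy: "q2 x = q2 y" for x y t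
  proof -
    obtain n where "y - x = real_vec n" using xy unfolding q2_eq_iff by blast
    then have "y = x + real_vec n" by (simp add: algebra_simps)
    then show ?thesis using assms(2) that by simp
  qed
  have resp0: "\<phi> (x, s) = \<phi> (y, t)"
    if "s \<in> {0..1}" "t \<in> {0..1}" "bundle_pr A (x, s) = bundle_pr A (y, t)" for x y s t
    using that(3) unfolding bundle_pr_eq_iff[OF that(1,2)]
  proof (elim disjE conjE)
    assume "s = 1" "t = 0" "q2 y = q2 (real_mat A *v x)"
    then show ?thesis using q[of 0 y "real_mat A *v x"] assms(3)[of x] by simp
  next
    assume "s = 0" "t = 1" "q2 x = q2 (real_mat A *v y)"
    then show ?thesis using q[of 0 x "real_mat A *v y"] assms(3)[of y] by simp
  next
    assume "s = t" "q2 x = q2 y"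
    then show ?thesis using q[of t x y] that(2) by blast
  qed
  have resp: "\<phi> z = \<phi> w" if "z \<in> topspace (top_of_set (UNIV \<times> {0..1}))"
    "w \<in> topspace (top_of_set (UNIV \<times> {0..1}))" "bundle_pr A z = bundle_pr A w" for z w
  proof -
    have "snd z \<in> {0..1}" "snd w \<in> {0..1}" using that(1,2) by (auto simp: mem_Times_iff)
    from resp0[OF this, of "fst z" "fst w"] that(3) show ?thesis by simp
  qed
  have cont: "continuous_map (top_of_set (UNIV \<times> {0..1})) euclidean \<phi>"
    using assms(1) by simp
  show thesis
  proof (rule quotient_map_lift_exists[OF quotient_map_bundle_pr cont])
    fix \<Phi> assume "continuous_map (torus_bundle A) euclidean \<Phi>"
      and "\<And>z. z \<in> topspace (top_of_set (UNIV \<times> {0..1})) \<Longrightarrow> \<Phi> (bundle_pr A z) = \<phi> z"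
    then show thesis by (intro that[of \<Phi>]) auto
  qed (fact resp)
qed

text \<open>Prescribing the level \<open>\<tau>\<close> keeps the two ends of the slab apart
  although N identifies them, so that only the torus coordinate has to be lifted.\<close>

lemma bundle_lift:
  fixes S :: "'a::real_normed_vector set"
  assumes "convex S" and G: "continuous_map (top_of_set S) (torus_bundle A) G"
    and \<tau>: "continuous_on S \<tau>" "\<And>s. s \<in> S \<Longrightarrow> \<tau> s \<in> {0..1}"
    and proj: "\<And>s. s \<in> S \<Longrightarrow> bundle_proj (G s) = circle_class (\<tau> s)"
  obtains g where "continuous_on S g" "\<And>s. s \<in> S \<Longrightarrow> G s = bundle_pr A (g s, \<tau> s)"
proof -
  have "\<exists>x. G s = bundle_pr A (x, \<tau> s)" if s: "s \<in> S" for s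
  proof -
    have "G s \<in> topspace (torus_bundle A)"
      using continuous_map_image_subset_topspace[OF G] that by auto
    then obtain x t where xt: "G s = bundle_pr A (x, t)" "t \<in> {0..1}"
      by (auto simp: topspace_torus_bundle)
    then have "circle_class t = circle_class (\<tau> s)"
      using proj[OF that] bundle_proj_pr by metis
    \<comment> \<open>The projection fixes the level up to 0 ~ 1. A representative at the wrong end
      is moved to the other one by the gluing.\<close>
    then consider "t = \<tau> s" | "t = 0" "\<tau> s = 1" | "t = 1" "\<tau> s = 0"
      using circle_class_eq_iff[OF xt(2), of "\<tau> s"] \<tau>(2)[OF s] by blast
    then show ?thesis
    proof cases
      case 2
      then show ?thesis
        using xt bundle_pr_glue[of "real_mat A' *v x"] by auto
    next
      case 3
      then show ?thesis
        using xt bundle_pr_glue[of x] by metis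
    qed (use xt in blast)
  qed
  then obtain x where x: "\<And>s. s \<in> S \<Longrightarrow> G s = bundle_pr A (x s, \<tau> s)" by metis
  have "continuous_on S (\<lambda>s. cis (2 * pi * x s $ i))" for i
  proof -
    \<comment> \<open>\<open>\<psi> (x s)\<close> is recovered from three functions on the bundle, with weights supported near
      \<open>t = 0\<close>, near \<open>t = 1\<close> and on \<open>0 < t < 1\<close>, so that \<open>a\<close> and \<open>b\<close> have product 0\<close>
    define \<psi> where "\<psi> = (\<lambda>x::real^2. cis (2 * pi * x $ i))"
    define a b where "a = (\<lambda>t::real. max 0 (1 - 2 * t))" and "b = (\<lambda>t::real. max 0 (2 * t - 1))"
    have \<psi>_shift: "\<psi> (x + real_vec n) = \<psi> x" for x n
      by (simp add: \<psi>_def cis_eq_iff_Ints)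
    have \<psi>_cont [continuous_intros]: "continuous_on T (\<lambda>x. \<psi> (h x))"
      if "continuous_on T h" for T and h :: "'b::topological_space \<Rightarrow> real^2"
      unfolding \<psi>_def using that by (intro continuous_intros)
    have a_cont [continuous_intros]: "continuous_on T (\<lambda>x. a (h x))" "continuous_on T (\<lambda>x. b (h x))"
      if "continuous_on T h" for T and h :: "'b::topological_space \<Rightarrow> real"
      unfolding a_def b_def using that by (auto intro!: continuous_intros)
    \<comment> \<open>The gluing rule holds because the value at (x, 1) and at (A x, 0) is \<psi> (A
      x); for \<open>\<Phi>1\<close> it is \<psi> x, and for \<open>\<Phi>2\<close> it is 0.\<close>
    obtain \<Phi>0 where \<Phi>0: "continuous_map (torus_bundle A) euclidean \<Phi>0"
      "\<And>x t. t \<in> {0..1} \<Longrightarrow> \<Phi>0 (bundle_pr A (x, t)) = \<psi> x * a t + \<psi> (real_mat A *v x) * b t"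
      by (rule bundle_function[of "\<lambda>(x, t). \<psi> x * a t + \<psi> (real_mat A *v x) * b t"])
        (auto simp: \<psi>_shift matrix_vector_right_distrib case_prod_unfold a_def b_def intro!: continuous_intros)
    obtain \<Phi>1 where \<Phi>1: "continuous_map (torus_bundle A) euclidean \<Phi>1"
      "\<And>x t. t \<in> {0..1} \<Longrightarrow> \<Phi>1 (bundle_pr A (x, t)) = \<psi> (real_mat A' *v x) * a t + \<psi> x * b t"
      by (rule bundle_function[of "\<lambda>(x, t). \<psi> (real_mat A' *v x) * a t + \<psi> x * b t"])
        (auto simp: \<psi>_shift matrix_vector_right_distrib case_prod_unfold a_def b_def
            intro!: continuous_intros)
    obtain \<Phi>2 where \<Phi>2: "continuous_map (torus_bundle A) euclidean \<Phi>2"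
      "\<And>x t. t \<in> {0..1} \<Longrightarrow> \<Phi>2 (bundle_pr A (x, t)) = \<psi> x * of_real (t * (1 - t))"
      by (rule bundle_function[of "\<lambda>(x, t). \<psi> x * of_real (t * (1 - t))"])
        (auto simp: \<psi>_shift case_prod_unfold intro!: continuous_intros)
    have comp: "continuous_on S (\<lambda>s. \<Phi> (G s))" if "continuous_map (torus_bundle A) euclidean \<Phi>"
      for \<Phi> :: "bundle_pt \<Rightarrow> complex"
      using continuous_map_compose[OF G that] by (simp add: o_def)
    \<comment> \<open>The total weight of \<psi> (x s) in the combination below. It is positive on
      the unit interval since \<open>a 0 = 1\<close>, \<open>b 1 = 1\<close> and t (1 - t) > 0 in
      between.\<close>
    define w where "w = (\<lambda>t. (a t)\<^sup>2 + (b t)\<^sup>2 + t * (1 - t))"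
    have w: "w t > 0" if "t \<in> {0..1}" for t
    proof (cases "t = 0 \<or> t = 1")
      case False
      then have "t * (1 - t) > 0" using that by auto
      then show ?thesis unfolding w_def by (simp add: add_nonneg_pos)
    qed (auto simp: w_def a_def b_def)
    have ab: "a t * b t = 0" for t unfolding a_def b_def by (auto simp: max_def)
    have "continuous_on S (\<lambda>s. (\<Phi>0 (G s) * of_real (a (\<tau> s)) + \<Phi>1 (G s) * of_real (b (\<tau> s)) + \<Phi>2 (G s)) /
        of_real (w (\<tau> s)))"
    proof (intro continuous_intros comp \<Phi>0 \<Phi>1 \<Phi>2 \<tau>(1) ballI)
      show "continuous_on S (\<lambda>s. w (\<tau> s))"
        unfolding w_def by (intro continuous_intros \<tau>(1))
      show "complex_of_real (w (\<tau> s)) \<noteq> 0" if "s \<in> S" for s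
        using w[OF \<tau>(2)[OF that]] by simp
    qed
    then show ?thesis
    proof (rule continuous_on_eq)
      fix s assume s: "s \<in> S"
      define t where "t = \<tau> s"
      have t: "t \<in> {0..1}" using \<tau>(2) s t_def by simp
      have "\<Phi>0 (G s) * of_real (a t) + \<Phi>1 (G s) * of_real (b t) + \<Phi>2 (G s) =
         \<psi> (x s) * of_real (w t) + (\<psi> (real_mat A *v x s) + \<psi> (real_mat A' *v x s)) * of_real (a t * b t)"
        unfolding x[OF s] t_def[symmetric] \<Phi>0(2)[OF t] \<Phi>1(2)[OF t] \<Phi>2(2)[OF t] w_def
        by (simp add: algebra_simps power2_eq_square)
      then have "\<Phi>0 (G s) * of_real (a t) + \<Phi>1 (G s) * of_real (b t) + \<Phi>2 (G s) = \<psi> (x s) * of_real (w t)"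
        by (simp add: ab)
      then show "(\<Phi>0 (G s) * of_real (a (\<tau> s)) + \<Phi>1 (G s) * of_real (b (\<tau> s)) + \<Phi>2 (G s)) /
          of_real (w (\<tau> s)) = cis (2 * pi * x s $ i)"
        using w[OF t] unfolding t_def[symmetric] \<psi>_def by simp
    qed
  qed
  then obtain g where g: "continuous_on S g" "\<And>s. s \<in> S \<Longrightarrow> q2 (g s) = q2 (x s)"
    using convex_q2_lift[OF assms(1)] by metis
  then show thesis using that x by (metis bundle_pr_def fst_conv snd_conv)
qed

end


section \<open>Lifting fiberwise homotopies\<close>

text \<open>The homotopy lifts to the square. On each of its four sides the lift differs from a
  known path by a constant lattice vector, and comparing the corners gives the displacement.\<close>

lemma torus_path_displacement:
  assumes cont: "continuous_on {0..1} \<gamma>"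
    and cls: "(\<lambda>t. q2 (\<gamma> t)) \<in> torus_pi1 (\<gamma> 0) n"
  shows "\<gamma> 1 = \<gamma> 0 + real_vec n"
proof -
  let ?S = "{0..1::real} \<times> {0..1::real}"
  obtain h where h: "continuous_map (prod_topology (top_of_set {0..1::real}) (top_of_set {0..1})) torus h"
    "\<forall>t. h (0, t) = q2 (\<gamma> 0 + t *\<^sub>R real_vec n)" "\<forall>t. h (1, t) = q2 (\<gamma> t)"
    "\<forall>s\<in>{0..1}. h (s, 0) = q2 (\<gamma> 0) \<and> h (s, 1) = q2 (\<gamma> 0)"
    using cls unfolding torus_pi1_def path_class_def homotopic_with_def by auto
  have S: "convex ?S" by (intro convex_Times) auto
  obtain K where K: "continuous_on ?S K" "\<And>p. p \<in> ?S \<Longrightarrow> h p = q2 (K p)"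
    using torus_lift[OF S] h(1) by auto
  have contK: "continuous_on {0..1} (\<lambda>t. K (a t, b t))"
    if "continuous_on {0..1} a" "continuous_on {0..1} b" "\<And>t. t \<in> {0..1} \<Longrightarrow> a t \<in> {0..1} \<and> b t \<in> {0..1}"
    for a b :: "real \<Rightarrow> real"
  proof (rule continuous_on_compose2[OF K(1)])
    show "continuous_on {0..1} (\<lambda>t. (a t, b t))"
      using that(1,2) by (rule continuous_on_Pair)
    show "(\<lambda>t. (a t, b t)) ` {0..1} \<subseteq> ?S"
      using that(3) by blast
  qed
  have const: "g 0 = g 1"
    if "continuous_on {0..1} g" "\<And>t. t \<in> {0..1} \<Longrightarrow> g t \<in> range real_vec" for g :: "real \<Rightarrow> real^2"
    using continuous_lattice_constant[of "{0..1::real}" g] that by auto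
  have "K (0, 0) - (\<gamma> 0 + 0 *\<^sub>R real_vec n) = K (0, 1) - (\<gamma> 0 + 1 *\<^sub>R real_vec n)"
  proof (rule const)
    show "continuous_on {0..1} (\<lambda>t. K (0, t) - (\<gamma> 0 + t *\<^sub>R real_vec n))"
      by (intro continuous_intros contK) auto
    show "K (0, t) - (\<gamma> 0 + t *\<^sub>R real_vec n) \<in> range real_vec" if "t \<in> {0..1}" for t
      using K(2)[of "(0, t)"] h(2) that q2_eq_iff by simp
  qed
  moreover have "K (1, 0) - \<gamma> 0 = K (1, 1) - \<gamma> 1"
  proof (rule const)
    show "continuous_on {0..1} (\<lambda>t. K (1, t) - \<gamma> t)"
      by (intro continuous_intros contK cont) auto
    show "K (1, t) - \<gamma> t \<in> range real_vec" if "t \<in> {0..1}" for t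
      using K(2)[of "(1, t)"] h(3) that q2_eq_iff by simp
  qed
  moreover have "K (0, r) - \<gamma> 0 = K (1, r) - \<gamma> 0" if "r = 0 \<or> r = 1" for r
  proof (rule const)
    show "continuous_on {0..1} (\<lambda>s. K (s, r) - \<gamma> 0)"
      using that by (intro continuous_intros contK) auto
    show "K (s, r) - \<gamma> 0 \<in> range real_vec" if "s \<in> {0..1}" for s
    proof -
      have "(s, r) \<in> ?S" using that \<open>r = 0 \<or> r = 1\<close> by auto
      moreover have "h (s, r) = q2 (\<gamma> 0)" using h(4) that \<open>r = 0 \<or> r = 1\<close> by auto
      ultimately show ?thesis using K(2) q2_eq_iff by metis
    qed
  qed
  ultimately show ?thesis by (simp add: algebra_simps)
qed

context gluing
begin

lemma fiber_map_eq:
  assumes "f (bundle_pr A (x, 1)) = bundle_pr A (y, 1)"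
  shows "fiber_map A f (q2 x) = q2 y"
  unfolding fiber_map_def
proof (rule the_equality)
  show "q2 y \<in> topspace torus \<and> f (bundle_class A (q2 x, 1)) = bundle_class A (q2 y, 1)"
    using assms by (auto simp: bundle_pr_def topspace_torus)
next
  fix w assume w: "w \<in> topspace torus \<and> f (bundle_class A (q2 x, 1)) = bundle_class A (w, 1)"
  then obtain z where "w = q2 z" by (auto simp: topspace_torus)
  moreover have "bundle_class A (q2 y, 1) = bundle_class A (w, 1)"
    using w assms unfolding bundle_pr_def fst_conv snd_conv by metis
  ultimately have "bundle_pr A (y, 1) = bundle_pr A (z, 1)"
    unfolding bundle_pr_def by auto
  then have "q2 y = q2 z"
    unfolding bundle_pr_eq_iff[of 1 1 y z, simplified] by auto
  then show "w = q2 y"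
    using \<open>w = q2 z\<close> by simp
qed

lemma bundle_pr_same_level:
  assumes "bundle_pr A (x, t) = bundle_pr A (y, t)" "t \<in> {0..1}"
  shows "y - x \<in> range real_vec"
  using assms bundle_pr_eq_iff[OF assms(2,2)] by (auto simp: q2_eq_iff)

lemma glue_displacement:
  assumes "bundle_pr A (x, 0) = bundle_pr A (y, 1)"
  shows "x - real_mat A *v y \<in> range real_vec"
proof -
  have "q2 (real_mat A *v y) = q2 x"
    using assms bundle_pr_eq_iff[of 0 1 x y] by auto
  then show ?thesis by (simp add: q2_eq_iff)
qed

lemma homotopy_lift:
  fixes k :: "real \<times> bundle_pt \<Rightarrow> bundle_pt"
  assumes k: "continuous_map (prod_topology (top_of_set {0..1}) (torus_bundle A)) (torus_bundle A) k"
    and over: "\<And>s. s \<in> {0..1} \<Longrightarrow> over_circle A (\<lambda>c. k (s, c))"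
  obtains K where "continuous_on ({0..1} \<times> (UNIV \<times> {0..1})) K"
    "\<And>s x t. s \<in> {0..1} \<Longrightarrow> t \<in> {0..1} \<Longrightarrow> k (s, bundle_pr A (x, t)) = bundle_pr A (K (s, x, t), t)"
proof -
  let ?S = "{0..1::real} \<times> ((UNIV :: (real^2) set) \<times> {0..1::real})"
  let ?G = "k \<circ> (\<lambda>(s, z). (s, bundle_pr A z))"
  have "continuous_map (prod_topology (top_of_set {0..1::real}) (top_of_set (UNIV \<times> {0..1})))
      (prod_topology (top_of_set {0..1::real}) (torus_bundle A)) (\<lambda>(s, z). (id s, bundle_pr A z))"
    unfolding continuous_map_prod_top
    using quotient_imp_continuous_map[OF quotient_map_bundle_pr] by simp
  then have "continuous_map (top_of_set ?S)
      (prod_topology (top_of_set {0..1::real}) (torus_bundle A)) (\<lambda>(s, z). (s, bundle_pr A z))"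
    by simp
  then have G: "continuous_map (top_of_set ?S) (torus_bundle A) ?G"
    using k by (rule continuous_map_compose)
  have S: "convex ?S" by (intro convex_Times) auto
  have proj: "bundle_proj (?G p) = circle_class (snd (snd p))" if "p \<in> ?S" for p
  proof -
    obtain s x t where p: "p = (s, x, t)" by (cases p) auto
    then have "s \<in> {0..1}" "t \<in> {0..1}" using that by auto
    then show ?thesis
      using over[of s] p bundle_proj_pr unfolding over_circle_def topspace_torus_bundle by auto
  qed
  obtain K where K: "continuous_on ?S K" "\<And>p. p \<in> ?S \<Longrightarrow> ?G p = bundle_pr A (K p, snd (snd p))"
    by (rule bundle_lift[OF S G _ _ proj]) (auto intro!: continuous_intros)
  show thesis
    by (rule that[OF K(1)]) (use K(2) in auto)
qed

text \<open>For a lift \<sigma> of a section, \<sigma> 0 - A (\<sigma> 1) is a lattice vector. It is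
  constant along a homotopy, and replacing the lift by a translate changes it by an element of (id -
  A) Z^2; this is the classification of sections by Z^2 / (A - id) Z^2.\<close>

lemma section_displacement:
  assumes "section_homotopic A s0 s1"
    and sec: "continuous_on {0..1} \<sigma>0" "continuous_on {0..1} \<sigma>1"
      "\<And>t. t \<in> {0..1} \<Longrightarrow> s0 (circle_class t) = bundle_pr A (\<sigma>0 t, t)"
      "\<And>t. t \<in> {0..1} \<Longrightarrow> s1 (circle_class t) = bundle_pr A (\<sigma>1 t, t)"
  obtains j where "\<sigma>0 0 - real_mat A *v \<sigma>0 1 = \<sigma>1 0 - real_mat A *v \<sigma>1 1 + real_vec (j - A *v j)"
proof -
  obtain h where h: "continuous_map (prod_topology (top_of_set {0..1::real}) circle) (torus_bundle A) h"
    "\<And>c. h (0, c) = s0 c" "\<And>c. h (1, c) = s1 c"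
    "\<And>s. s \<in> {0..1} \<Longrightarrow> \<forall>c \<in> topspace circle. bundle_proj (h (s, c)) = c"
    using assms(1) unfolding section_homotopic_def homotopic_with_def by auto
  let ?S = "{0..1::real} \<times> {0..1::real}"
  let ?G = "h \<circ> (\<lambda>(s, z). (s, circle_class z))"
  have qc: "quotient_map (top_of_set {0..1}) circle circle_class"
    unfolding circle_def by (rule quotient_map_quotient_topology)
  then have "continuous_map (prod_topology (top_of_set {0..1::real}) (top_of_set {0..1}))
      (prod_topology (top_of_set {0..1::real}) circle) (\<lambda>(s, z). (id s, circle_class z))"
    unfolding continuous_map_prod_top using quotient_imp_continuous_map by auto
  then have "continuous_map (top_of_set ?S)
      (prod_topology (top_of_set {0..1::real}) circle) (\<lambda>(s, z). (s, circle_class z))"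
    by simp
  then have G: "continuous_map (top_of_set ?S) (torus_bundle A) ?G"
    using h(1) by (rule continuous_map_compose)
  have S: "convex ?S" by (intro convex_Times) auto
  have "topspace circle = circle_class ` {0..1}"
    using qc unfolding quotient_map_def by simp
  then have proj: "bundle_proj (?G p) = circle_class (snd p)" if "p \<in> ?S" for p
    using h(4) that by auto
  obtain K where K: "continuous_on ?S K" "\<And>p. p \<in> ?S \<Longrightarrow> ?G p = bundle_pr A (K p, snd p)"
    by (rule bundle_lift[OF S G _ _ proj]) (auto intro!: continuous_intros)
  have K': "h (s, circle_class t) = bundle_pr A (K (s, t), t)" if "s \<in> {0..1}" "t \<in> {0..1}" for s t
    using K(2)[of "(s, t)"] that by simp
  have contK: "continuous_on {0..1} (\<lambda>t. K (a t, b t))"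
    if "continuous_on {0..1} a" "continuous_on {0..1} b" "\<And>t. t \<in> {0..1} \<Longrightarrow> a t \<in> {0..1} \<and> b t \<in> {0..1}"
    for a b :: "real \<Rightarrow> real"
  proof (rule continuous_on_compose2[OF K(1)])
    show "continuous_on {0..1} (\<lambda>t. (a t, b t))"
      using that(1,2) by (rule continuous_on_Pair)
    show "(\<lambda>t. (a t, b t)) ` {0..1} \<subseteq> ?S"
      using that(3) by blast
  qed
  have I: "connected {0..1::real}" by simp
  have c01: "circle_class 0 = circle_class 1" by (simp add: circle_class_eq_iff)
  have "\<exists>m. \<forall>t\<in>{0..1}. K (0, t) - \<sigma>0 t = real_vec m"
  proof (rule continuous_lattice_constant[OF I])
    show "continuous_on {0..1} (\<lambda>t. K (0, t) - \<sigma>0 t)"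
      by (intro continuous_intros contK sec) auto
    show "K (0, t) - \<sigma>0 t \<in> range real_vec" if "t \<in> {0..1}" for t
      by (rule bundle_pr_same_level[OF _ that]) (use K'[of 0 t] h(2) sec that in auto)
  qed
  then obtain m where m: "\<And>t. t \<in> {0..1} \<Longrightarrow> K (0, t) - \<sigma>0 t = real_vec m" by blast
  have "\<exists>n. \<forall>t\<in>{0..1}. K (1, t) - \<sigma>1 t = real_vec n"
  proof (rule continuous_lattice_constant[OF I])
    show "continuous_on {0..1} (\<lambda>t. K (1, t) - \<sigma>1 t)"
      by (intro continuous_intros contK sec) auto
    show "K (1, t) - \<sigma>1 t \<in> range real_vec" if "t \<in> {0..1}" for t
      by (rule bundle_pr_same_level[OF _ that]) (use K'[of 1 t] h(3) sec that in auto)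
  qed
  then obtain n where n: "\<And>t. t \<in> {0..1} \<Longrightarrow> K (1, t) - \<sigma>1 t = real_vec n" by blast
  have "\<exists>c. \<forall>s\<in>{0..1}. K (s, 0) - real_mat A *v K (s, 1) = real_vec c"
  proof (rule continuous_lattice_constant[OF I])
    show "continuous_on {0..1} (\<lambda>s. K (s, 0) - real_mat A *v K (s, 1))"
      by (intro continuous_intros contK) auto
    show "K (s, 0) - real_mat A *v K (s, 1) \<in> range real_vec" if "s \<in> {0..1}" for s
      by (rule glue_displacement) (use K'[of s 0] K'[of s 1] that c01 in auto)
  qed
  then obtain c where c: "\<And>s. s \<in> {0..1} \<Longrightarrow> K (s, 0) - real_mat A *v K (s, 1) = real_vec c" by blast
  have K\<sigma>: "K (0, 0) = \<sigma>0 0 + real_vec m" "K (0, 1) = \<sigma>0 1 + real_vec m"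
    "K (1, 0) = \<sigma>1 0 + real_vec n" "K (1, 1) = \<sigma>1 1 + real_vec n"
    using m[of 0] m[of 1] n[of 0] n[of 1] by (simp_all add: algebra_simps)
  have "K (0, 0) - real_mat A *v K (0, 1) = K (1, 0) - real_mat A *v K (1, 1)"
    using c[of 0] c[of 1] by simp
  then have "\<sigma>0 0 - real_mat A *v \<sigma>0 1 + real_vec (m - A *v m) =
      \<sigma>1 0 - real_mat A *v \<sigma>1 1 + real_vec (n - A *v n)"
    unfolding K\<sigma> by (simp add: matrix_vector_right_distrib algebra_simps)
  then have "\<sigma>0 0 - real_mat A *v \<sigma>0 1 =
      \<sigma>1 0 - real_mat A *v \<sigma>1 1 + real_vec ((n - m) - A *v (n - m))"
    by (simp add: matrix_vector_mult_diff_distrib algebra_simps)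
  then show thesis by (rule that)
qed

text \<open>Shifting the argument by n, or passing through the gluing, changes a lift by a constant
  lattice vector. The first constant is read off from the fundamental group of the fiber, the second
  from the class of the section \<open>f \<circ> std_section A 0\<close>.\<close>

lemma fiberwise_homotopy_lift:
  fixes k :: "real \<times> bundle_pt \<Rightarrow> bundle_pt"
  assumes k: "continuous_map (prod_topology (top_of_set {0..1}) (torus_bundle A)) (torus_bundle A) k"
    and over: "\<And>s. s \<in> {0..1} \<Longrightarrow> over_circle A (\<lambda>c. k (s, c))"
    and f: "\<And>c. k (0, c) = f c"
    and F: "induces_on_fiber A f F"
    and v: "section_homotopic A (f \<circ> std_section A 0) (std_section A v)"
  obtains K where "continuous_on ({0..1} \<times> (UNIV \<times> {0..1})) K"
    "\<And>s x t. s \<in> {0..1} \<Longrightarrow> t \<in> {0..1} \<Longrightarrow> k (s, bundle_pr A (x, t)) = bundle_pr A (K (s, x, t), t)"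
    "\<And>s x t n. s \<in> {0..1} \<Longrightarrow> t \<in> {0..1} \<Longrightarrow> K (s, x + real_vec n, t) = K (s, x, t) + real_vec (F *v n)"
    "\<And>s x. s \<in> {0..1} \<Longrightarrow> K (s, real_mat A *v x, 0) = real_mat A *v (K (s, x, 1) - real_vec v)"
proof -
  let ?S = "{0..1::real} \<times> ((UNIV :: (real^2) set) \<times> {0..1::real})"
  obtain K where K: "continuous_on ?S K"
    and lift: "\<And>s x t. s \<in> {0..1} \<Longrightarrow> t \<in> {0..1} \<Longrightarrow> k (s, bundle_pr A (x, t)) = bundle_pr A (K (s, x, t), t)"
    using homotopy_lift[OF k over] by metis
  have contK: "continuous_on T (\<lambda>p. K (a p, b p, c p))"
    if "continuous_on T a" "continuous_on T b" "continuous_on T c"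
      "\<And>p. p \<in> T \<Longrightarrow> a p \<in> {0..1}" "\<And>p. p \<in> T \<Longrightarrow> c p \<in> {0..1}"
    for T :: "'t::topological_space set" and a b c
  proof (rule continuous_on_compose2[OF K])
    show "continuous_on T (\<lambda>p. (a p, b p, c p))"
      using that(1-3) by (intro continuous_on_Pair)
    show "(\<lambda>p. (a p, b p, c p)) ` T \<subseteq> ?S"
      using that(4,5) by blast
  qed
  have "connected ?S" by (intro convex_connected convex_Times) auto
  have fiber: "fiber_map A f (q2 x) = q2 (K (0, x, 1))" for x
    by (rule fiber_map_eq) (use lift[of 0 1 x] f in simp)
  have shift: "K (s, x + real_vec n, t) = K (s, x, t) + real_vec (F *v n)"
    if st: "s \<in> {0..1}" "t \<in> {0..1}" for s x t n
  proof -
    have "\<exists>m. \<forall>p\<in>?S. K (fst p, fst (snd p) + real_vec n, snd (snd p)) -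
        K (fst p, fst (snd p), snd (snd p)) = real_vec m"
    proof (rule continuous_lattice_constant[OF \<open>connected ?S\<close>])
      show "continuous_on ?S (\<lambda>p. K (fst p, fst (snd p) + real_vec n, snd (snd p)) -
          K (fst p, fst (snd p), snd (snd p)))"
        by (intro continuous_on_diff contK) (auto intro!: continuous_intros)
      fix p assume "p \<in> ?S"
      then have p: "fst p \<in> {0..1}" "snd (snd p) \<in> {0..1}" by auto
      show "K (fst p, fst (snd p) + real_vec n, snd (snd p)) -
          K (fst p, fst (snd p), snd (snd p)) \<in> range real_vec"
        by (rule bundle_pr_same_level[OF _ p(2)])
          (use lift[OF p, of "fst (snd p)"] lift[OF p, of "fst (snd p) + real_vec n"] in simp)
    qed
    then obtain m where m: "\<And>s x t. s \<in> {0..1} \<Longrightarrow> t \<in> {0..1} \<Longrightarrow>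
        K (s, x + real_vec n, t) - K (s, x, t) = real_vec m" by fastforce
    \<comment> \<open>The segment from 0 to n at level 1 projects to the loop n in the fiber where
      \<open>F\<close> is defined; the displacement of its image is F n and identifies
      \<open>m\<close>.\<close>
    let ?\<gamma> = "\<lambda>t. K (0, t *\<^sub>R real_vec n, 1)"
    have cont: "continuous_on {0..1} ?\<gamma>"
      by (intro contK) (auto intro!: continuous_intros)
    have q2_path: "continuous_map (top_of_set {0..1}) torus (\<lambda>t. q2 (g t))"
      if "continuous_on {0..1::real} g" for g
      using continuous_map_compose[of "top_of_set {0..1}" euclidean g torus q2] that
        quotient_imp_continuous_map[OF quotient_map_q2] by (simp add: o_def)
    let ?\<rho> = "\<lambda>t. q2 (0 + t *\<^sub>R real_vec n)"
    have self: "\<delta> \<in> path_class torus \<delta>" if "continuous_map (top_of_set {0..1}) torus \<delta>" for \<delta>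
      using that by (simp add: path_class_def)
    have "?\<rho> \<in> torus_pi1 0 n"
      unfolding torus_pi1_def by (intro self q2_path continuous_intros)
    moreover have "(\<lambda>t. q2 (?\<gamma> t)) \<in> path_class torus (fiber_map A f \<circ> ?\<rho>)"
      using self[OF q2_path[OF cont]] by (simp add: o_def fiber)
    ultimately have "(\<lambda>t. q2 (?\<gamma> t)) \<in> pi1_map torus (fiber_map A f) (torus_pi1 0 n)"
      unfolding pi1_map_def by blast
    then have "(\<lambda>t. q2 (?\<gamma> t)) \<in> torus_pi1 (K (0, 0, 1)) (F *v n)"
      using F fiber[of 0] unfolding induces_on_fiber_def by metis
    then have "?\<gamma> 1 = ?\<gamma> 0 + real_vec (F *v n)"
      using torus_path_displacement[OF cont, of "F *v n"] by simp
    then have "real_vec m = real_vec (F *v n)"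
      using m[of 0 1 0] by simp
    then show ?thesis using m[OF st, of x] by (simp add: algebra_simps)
  qed
  let ?T = "{0..1::real} \<times> (UNIV :: (real^2) set)"
  have "connected ?T" by (intro convex_connected convex_Times) auto
  have "\<exists>c. \<forall>p\<in>?T. K (fst p, real_mat A *v snd p, 0) - real_mat A *v K (fst p, snd p, 1) = real_vec c"
  proof (rule continuous_lattice_constant[OF \<open>connected ?T\<close>])
    show "continuous_on ?T (\<lambda>p. K (fst p, real_mat A *v snd p, 0) - real_mat A *v K (fst p, snd p, 1))"
      by (intro continuous_on_diff continuous_on_matrix_vector_mult contK)
        (auto intro!: continuous_intros)
    fix p assume "p \<in> ?T"
    then have p: "fst p \<in> {0..1}" by auto
    show "K (fst p, real_mat A *v snd p, 0) - real_mat A *v K (fst p, snd p, 1) \<in> range real_vec"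
      by (rule glue_displacement)
        (use lift[OF p, of 0 "real_mat A *v snd p"] lift[OF p, of 1 "snd p"] bundle_pr_glue in simp)
  qed
  then obtain c where c: "\<And>s x. s \<in> {0..1} \<Longrightarrow>
      K (s, real_mat A *v x, 0) = real_mat A *v K (s, x, 1) + real_vec c"
    by (fastforce simp: algebra_simps)
  \<comment> \<open>The restriction of the lift to x = 0 lifts the image of the zero section; the
    comparison with the section of \<open>v\<close> determines \<open>c\<close> up to (id - A)
    Z^2.\<close>
  obtain j where "K (0, 0, 0) - real_mat A *v K (0, 0, 1) =
      0 *\<^sub>R real_vec v - real_mat A *v (1 *\<^sub>R real_vec v) + real_vec (j - A *v j)"
  proof (rule section_displacement[OF v])
    show "continuous_on {0..1} (\<lambda>t. K (0, 0, t))"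
      by (intro contK) (auto intro!: continuous_intros)
    show "continuous_on {0..1} (\<lambda>t. t *\<^sub>R real_vec v)"
      by (intro continuous_intros)
    show "(f \<circ> std_section A 0) (circle_class t) = bundle_pr A (K (0, 0, t), t)" if "t \<in> {0..1}" for t
      using lift[of 0 t 0] that f by (simp add: std_section_circle_class)
    show "std_section A v (circle_class t) = bundle_pr A (t *\<^sub>R real_vec v, t)" if "t \<in> {0..1}" for t
      using that by (rule std_section_circle_class)
  qed
  then have j: "real_vec c = real_vec (j - A *v j) - real_vec (A *v v)"
    using c[of 0 0] by (simp add: algebra_simps)
  \<comment> \<open>Translating the lift by -j removes the ambiguity: the gluing constant becomes
    exactly -A v.\<close>
  show thesis
  proof (rule that[of "\<lambda>p. K p - real_vec j"])
    show "continuous_on ?S (\<lambda>p. K p - real_vec j)"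
      by (intro continuous_intros K)
    show "k (s, bundle_pr A (x, t)) = bundle_pr A (K (s, x, t) - real_vec j, t)"
      if "s \<in> {0..1}" "t \<in> {0..1}" for s x t
      using lift[OF that, of x] bundle_pr_shift[of "K (s, x, t) - real_vec j" j t] by simp
    show "K (s, x + real_vec n, t) - real_vec j = K (s, x, t) - real_vec j + real_vec (F *v n)"
      if "s \<in> {0..1}" "t \<in> {0..1}" for s x t n
      using shift[OF that] by simp
    show "K (s, real_mat A *v x, 0) - real_vec j = real_mat A *v (K (s, x, 1) - real_vec j - real_vec v)"
      if "s \<in> {0..1}" for s x
      using c[OF that, of x] j by (simp add: matrix_vector_mult_diff_distrib)
  qed
qed

end


section \<open>Reduction to displacements of the plane\<close>

text \<open>These are the maps \<open>h (x, t) = K (x, t) - x\<close> for lifts \<open>K\<close> of fixed point free fiberwise maps.\<close>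

definition free_displacement ::
  "int ^ 2 ^ 2 \<Rightarrow> int ^ 2 ^ 2 \<Rightarrow> int ^ 2 \<Rightarrow> ((real ^ 2) \<times> real \<Rightarrow> real ^ 2) \<Rightarrow> bool" where
  "free_displacement A L v h \<longleftrightarrow>
     continuous_on (UNIV \<times> {0..1}) h \<and>
     (\<forall>x n t. t \<in> {0..1} \<longrightarrow> h (x + real_vec n, t) = h (x, t) + real_vec (L *v n)) \<and>
     (\<forall>x. h (real_mat A *v x, 0) = real_mat A *v (h (x, 1) - real_vec v)) \<and>
     (\<forall>x t. t \<in> {0..1} \<longrightarrow> h (x, t) \<notin> range real_vec)"

lemma L_mat_vec: "L_mat F *v n = F *v n - n"
  by (simp add: L_mat_def matrix_vector_mult_diff_rdistrib)

lemma real_L_mat_vec: "real_mat (L_mat F) *v x = real_mat F *v x - x"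
  by (simp add: L_mat_def real_mat_diff matrix_vector_mult_diff_rdistrib)

context gluing
begin

context
  fixes f F v
  assumes fib: "fiberwise_map A f"
    and F: "induces_on_fiber A f F"
    and v: "section_homotopic A (f \<circ> std_section A 0) (std_section A v)"
begin

lemma fiberwise_map_lift:
  obtains K where "continuous_on (UNIV \<times> {0..1}) K"
    "\<And>x t. t \<in> {0..1} \<Longrightarrow> f (bundle_pr A (x, t)) = bundle_pr A (K (x, t), t)"
    "\<And>x t n. t \<in> {0..1} \<Longrightarrow> K (x + real_vec n, t) = K (x, t) + real_vec (F *v n)"
    "\<And>x. K (real_mat A *v x, 0) = real_mat A *v (K (x, 1) - real_vec v)"
proof -
  have "continuous_map (prod_topology (top_of_set {0..1::real}) (torus_bundle A)) (torus_bundle A) (f \<circ> snd)"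
    using fib unfolding fiberwise_map_def by (auto intro: continuous_map_compose continuous_map_snd)
  then obtain K where K: "continuous_on ({0..1} \<times> (UNIV \<times> {0..1})) K"
    "\<And>s x t. s \<in> {0..1} \<Longrightarrow> t \<in> {0..1} \<Longrightarrow> (f \<circ> snd) (s :: real, bundle_pr A (x, t)) = bundle_pr A (K (s, x, t), t)"
    "\<And>s x t n. s \<in> {0..1} \<Longrightarrow> t \<in> {0..1} \<Longrightarrow> K (s, x + real_vec n, t) = K (s, x, t) + real_vec (F *v n)"
    "\<And>s x. s \<in> {0..1} \<Longrightarrow> K (s, real_mat A *v x, 0) = real_mat A *v (K (s, x, 1) - real_vec v)"
    by (rule fiberwise_homotopy_lift[OF _ _ _ F v]) (use fib in \<open>simp_all add: fiberwise_map_def\<close>)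
  show thesis
  proof (rule that[of "\<lambda>z. K (0, z)"])
    show "continuous_on (UNIV \<times> {0..1}) (\<lambda>z. K (0, z))"
      by (rule continuous_on_compose2[OF K(1)]) (auto intro!: continuous_intros)
    show "f (bundle_pr A (x, t)) = bundle_pr A (K (0, x, t), t)" if "t \<in> {0..1}" for x t
      using K(2)[of 0 t x] that by simp
    show "K (0, x + real_vec n, t) = K (0, x, t) + real_vec (F *v n)" if "t \<in> {0..1}" for x t n
      using K(3)[of 0 t] that by simp
    show "K (0, real_mat A *v x, 0) = real_mat A *v (K (0, x, 1) - real_vec v)" for x
      using K(4)[of 0] by simp
  qed
qed

text \<open>The lift at A n, level 0, is computed in two ways: by the shift rule at level 0, and by
  gluing after the shift rule at level 1.\<close>

lemma fiber_endomorphism_commutes: "F ** A = A ** F"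
proof -
  obtain K where "continuous_on (UNIV \<times> {0..1}) K"
    "\<And>x t. t \<in> {0..1} \<Longrightarrow> f (bundle_pr A (x, t)) = bundle_pr A (K (x, t), t)"
    and K: "\<And>x t n. t \<in> {0..1} \<Longrightarrow> K (x + real_vec n, t) = K (x, t) + real_vec (F *v n)"
    "\<And>x. K (real_mat A *v x, 0) = real_mat A *v (K (x, 1) - real_vec v)"
    by (rule fiberwise_map_lift) (rule that)
  have "(F ** A) *v n = (A ** F) *v n" for n
  proof -
    have "K (0, 0) + real_vec (F *v (A *v n)) = K (0 + real_vec (A *v n), 0)"
      using K(1)[of 0 0 "A *v n"] by simp
    also have "\<dots> = real_mat A *v (K (0 + real_vec n, 1) - real_vec v)"
      using K(2)[of "real_vec n"] by simp
    also have "\<dots> = real_mat A *v (K (0, 1) - real_vec v) + real_vec (A *v (F *v n))"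
      using K(1)[of 1 0 n] by (simp add: matrix_vector_right_distrib matrix_vector_mult_diff_distrib)
    also have "real_mat A *v (K (0, 1) - real_vec v) = K (0, 0)"
      using K(2)[of 0] by simp
    finally have "real_vec (F *v (A *v n)) = real_vec (A *v (F *v n))" by simp
    then show ?thesis by (simp add: matrix_vector_mul_assoc)
  qed
  then show ?thesis by (simp add: matrix_eq)
qed

text \<open>A point of the slab projects to a fixed point exactly when the displacement of the lift
  there is a lattice vector.\<close>

theorem fixed_point_free_iff:
  "(\<exists>g. fiberwise_homotopic A f g \<and> fixed_point_free A g) \<longleftrightarrow>
   (\<exists>h. free_displacement A (L_mat F) v h)"
proof
  assume "\<exists>g. fiberwise_homotopic A f g \<and> fixed_point_free A g"
  then obtain g k where g: "fixed_point_free A g"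
    and k: "continuous_map (prod_topology (top_of_set {0..1::real}) (torus_bundle A)) (torus_bundle A) k"
      "\<And>c. k (0, c) = f c" "\<And>c. k (1, c) = g c"
      "\<And>s. s \<in> {0..1} \<Longrightarrow> over_circle A (\<lambda>c. k (s, c))"
    unfolding fiberwise_homotopic_def homotopic_with_def by blast
  obtain K where K: "continuous_on ({0..1} \<times> (UNIV \<times> {0..1})) K"
    "\<And>s x t. s \<in> {0..1} \<Longrightarrow> t \<in> {0..1} \<Longrightarrow> k (s, bundle_pr A (x, t)) = bundle_pr A (K (s, x, t), t)"
    "\<And>s x t n. s \<in> {0..1} \<Longrightarrow> t \<in> {0..1} \<Longrightarrow> K (s, x + real_vec n, t) = K (s, x, t) + real_vec (F *v n)"
    "\<And>s x. s \<in> {0..1} \<Longrightarrow> K (s, real_mat A *v x, 0) = real_mat A *v (K (s, x, 1) - real_vec v)"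
    by (rule fiberwise_homotopy_lift[OF k(1) _ k(2) F v]) (erule k(4), rule that)
  have "free_displacement A (L_mat F) v (\<lambda>z. K (1, z) - fst z)"
    unfolding free_displacement_def
  proof (intro conjI allI impI)
    show "continuous_on (UNIV \<times> {0..1}) (\<lambda>z. K (1, z) - fst z)"
      by (intro continuous_on_diff continuous_on_compose2[OF K(1)])
        (auto intro!: continuous_intros)
    show "K (1, x + real_vec n, t) - fst (x + real_vec n, t) =
        K (1, x, t) - fst (x, t) + real_vec (L_mat F *v n)" if "t \<in> {0..1}" for x n t
      using K(3)[of 1 t x n] that by (simp add: L_mat_vec)
    show "K (1, real_mat A *v x, 0) - fst (real_mat A *v x, 0 :: real) =
        real_mat A *v (K (1, x, 1) - fst (x, 1 :: real) - real_vec v)" for x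
      using K(4)[of 1 x] by (simp add: matrix_vector_mult_diff_distrib)
    show "K (1, x, t) - fst (x, t) \<notin> range real_vec" if "t \<in> {0..1}" for x t
    proof
      assume "K (1, x, t) - fst (x, t) \<in> range real_vec"
      then have "q2 x = q2 (K (1, x, t))" by (simp add: q2_eq_iff)
      then have "g (bundle_pr A (x, t)) = bundle_pr A (x, t)"
        using K(2)[of 1 t x] k(3) that by (simp add: bundle_pr_def)
      then show False
        using g that unfolding fixed_point_free_def topspace_torus_bundle by blast
    qed
  qed
  then show "\<exists>h. free_displacement A (L_mat F) v h" by blast
next
  assume "\<exists>h. free_displacement A (L_mat F) v h"
  then obtain h :: "(real ^ 2) \<times> real \<Rightarrow> real ^ 2" where h: "continuous_on (UNIV \<times> {0..1}) h"
    "\<And>x n t. t \<in> {0..1} \<Longrightarrow> h (x + real_vec n, t) = h (x, t) + real_vec (L_mat F *v n)"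
    "\<And>x. h (real_mat A *v x, 0) = real_mat A *v (h (x, 1) - real_vec v)"
    "\<And>x t. t \<in> {0..1} \<Longrightarrow> h (x, t) \<notin> range real_vec"
    unfolding free_displacement_def by blast
  obtain K where K: "continuous_on (UNIV \<times> {0..1}) K"
    "\<And>x t. t \<in> {0..1} \<Longrightarrow> f (bundle_pr A (x, t)) = bundle_pr A (K (x, t), t)"
    "\<And>x t n. t \<in> {0..1} \<Longrightarrow> K (x + real_vec n, t) = K (x, t) + real_vec (F *v n)"
    "\<And>x. K (real_mat A *v x, 0) = real_mat A *v (K (x, 1) - real_vec v)"
    by (rule fiberwise_map_lift) (rule that)
  \<comment> \<open>The straight line from the lift of \<open>f\<close> to id + h. The shift and
    gluing rules are affine and hold at both ends, so they hold along the line and the homotopy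
    descends to N.\<close>
  define M where "M = (\<lambda>(s, z). (1 - s) *\<^sub>R K z + s *\<^sub>R (fst z + h z))"
  let ?S = "{0..1::real} \<times> ((UNIV :: (real^2) set) \<times> {0..1::real})"
  have M_shift: "M (s, x + real_vec n, t) = M (s, x, t) + real_vec (F *v n)" if "t \<in> {0..1}" for s x t n
    unfolding M_def prod.case K(3)[OF that] h(2)[OF that] by (simp add: L_mat_vec algebra_simps)
  have M_glue: "M (s, real_mat A *v x, 0) = real_mat A *v (M (s, x, 1) - real_vec v)" for s x
    unfolding M_def prod.case K(4) h(3)
    by (simp add: algebra_simps matrix_vector_mult_diff_distrib
        matrix_vector_right_distrib matrix_vector_mult_scaleR)
  have contM: "continuous_on ?S M"
    unfolding M_def case_prod_unfold
    by (intro continuous_intros continuous_on_compose2[OF K(1)] continuous_on_compose2[OF h(1)]) auto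
  have M_q2: "bundle_pr A (M (s, x, t), t) = bundle_pr A (M (s, y, t), t)"
    if t: "t \<in> {0..1}" and xy: "q2 x = q2 y" for s x y t
  proof -
    obtain n where "y - x = real_vec n" using xy unfolding q2_eq_iff by blast
    then have "y = x + real_vec n" by (simp add: algebra_simps)
    then show ?thesis using M_shift[OF t] by simp
  qed
  have M_pr: "bundle_pr A (M (s, real_mat A *v x, 0), 0) = bundle_pr A (M (s, x, 1), 1)" for s x
    using bundle_pr_shift[of "M (s, x, 1) - real_vec v" v 1]
    by (simp add: M_glue bundle_pr_glue)
  define r where "r = (\<lambda>p. bundle_pr A (M p, snd (snd p)))"
  let ?\<rho> = "\<lambda>(s :: real, z). (s, bundle_pr A z)"
  have quot: "quotient_map (top_of_set ?S) (prod_topology (top_of_set {0..1::real}) (torus_bundle A)) ?\<rho>"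
  proof -
    have "locally_compact_space (top_of_set {0..1::real})" "Hausdorff_space (top_of_set {0..1::real})"
      by (simp_all add: compact_imp_locally_compact_space compact_space_subtopology
          Hausdorff_space_subtopology)
    then have "quotient_map (prod_topology (top_of_set {0..1::real}) (top_of_set (UNIV \<times> {0..1})))
       (prod_topology (top_of_set {0..1::real}) (torus_bundle A)) ?\<rho>"
      by (intro quotient_map_prod_right quotient_map_bundle_pr) auto
    then show ?thesis by simp
  qed
  have contr: "continuous_map (top_of_set ?S) (torus_bundle A) r"
  proof -
    have "continuous_on ?S (\<lambda>p. (M p, snd (snd p)))"
      using contM by (intro continuous_intros)
    then have "continuous_map (top_of_set ?S) (top_of_set (UNIV \<times> {0..1})) (\<lambda>p. (M p, snd (snd p)))"
      by (auto simp: continuous_map_in_subtopology)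
    from continuous_map_compose[OF this quotient_imp_continuous_map[OF quotient_map_bundle_pr]]
    show ?thesis unfolding r_def o_def .
  qed
  have resp: "r p = r p'" if "p \<in> topspace (top_of_set ?S)" "p' \<in> topspace (top_of_set ?S)" "?\<rho> p = ?\<rho> p'" for p p'
  proof -
    obtain s x t s' y u where p: "p = (s, x, t)" "p' = (s', y, u)"
      by (metis surj_pair)
    have tu: "t \<in> {0..1}" "u \<in> {0..1}" "s = s'" "bundle_pr A (x, t) = bundle_pr A (y, u)"
      using that p by auto
    from tu(4)[unfolded bundle_pr_eq_iff[OF tu(1,2)]]
    have "bundle_pr A (M (s, x, t), t) = bundle_pr A (M (s, y, u), u)"
    proof (elim disjE conjE)
      assume "t = 1" "u = 0" "q2 y = q2 (real_mat A *v x)"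
      then show ?thesis using M_q2[of 0 y "real_mat A *v x" s] M_pr[of s x] by simp
    next
      assume "t = 0" "u = 1" "q2 x = q2 (real_mat A *v y)"
      then show ?thesis using M_q2[of 0 x "real_mat A *v y" s] M_pr[of s y] by simp
    next
      assume "t = u" "q2 x = q2 y"
      then show ?thesis using M_q2[OF tu(1)] by blast
    qed
    then show ?thesis using p tu(3) by (simp add: r_def)
  qed
  obtain k where k: "continuous_map (prod_topology (top_of_set {0..1::real}) (torus_bundle A)) (torus_bundle A) k"
    "\<And>p. p \<in> ?S \<Longrightarrow> k (?\<rho> p) = r p"
  proof (rule quotient_map_lift_exists[OF quot contr])
    fix k assume "continuous_map (prod_topology (top_of_set {0..1::real}) (torus_bundle A)) (torus_bundle A) k"
      "\<And>p. p \<in> topspace (top_of_set ?S) \<Longrightarrow> k (?\<rho> p) = r p"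
    then show thesis by (intro that[of k]) auto
  qed (rule resp)
  have kr: "k (s, bundle_pr A (x, t)) = bundle_pr A (M (s, x, t), t)" if "s \<in> {0..1}" "t \<in> {0..1}" for s x t
    using k(2)[of "(s, x, t)"] that by (simp add: r_def)
  have "fiberwise_homotopic A f (\<lambda>c. k (1, c))"
    unfolding fiberwise_homotopic_def
  proof (subst homotopic_with)
    show "\<exists>k'. continuous_map (prod_topology (top_of_set {0..1::real}) (torus_bundle A)) (torus_bundle A) k' \<and>
        (\<forall>c\<in>topspace (torus_bundle A). k' (0, c) = f c) \<and>
        (\<forall>c\<in>topspace (torus_bundle A). k' (1, c) = k (1, c)) \<and>
        (\<forall>s\<in>{0..1}. over_circle A (\<lambda>c. k' (s, c)))"
    proof (intro exI[of _ k] conjI ballI)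
      show "k (0, c) = f c" if "c \<in> topspace (torus_bundle A)" for c
        using that K(2) kr[of 0] by (auto simp: topspace_torus_bundle M_def)
      show "over_circle A (\<lambda>c. k (s, c))" if "s \<in> {0..1}" for s
        unfolding over_circle_def
        using kr[OF that] by (auto simp: topspace_torus_bundle bundle_proj_pr)
    qed (use k in auto)
  qed (auto simp: over_circle_def)
  moreover have "fixed_point_free A (\<lambda>c. k (1, c))"
    unfolding fixed_point_free_def topspace_torus_bundle
  proof safe
    fix x :: "real^2" and t :: real
    assume t: "t \<in> {0..1}" and "k (1, bundle_pr A (x, t)) = bundle_pr A (x, t)"
    then have "bundle_pr A (x, t) = bundle_pr A (x + h (x, t), t)"
      using kr[of 1 t x] by (simp add: M_def)
    from bundle_pr_same_level[OF this t] show False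
      using h(4)[OF t, of x] by simp
  qed
  ultimately show "\<exists>g. fiberwise_homotopic A f g \<and> fixed_point_free A g" by blast
qed

end

end


section \<open>Winding numbers of periodic functions\<close>

text \<open>A preimage of y is a fixed point of x \<mapsto> M^-1 (y - (G x - M x)). This map is
  bounded, so Brouwer's theorem applies on a large ball.\<close>

lemma surj_linear_perturbation:
  fixes G M :: "'a::euclidean_space \<Rightarrow> 'a"
  assumes M: "linear M" "inj M" and G: "continuous_on UNIV G"
    and B: "\<And>x. norm (G x - M x) \<le> B"
  shows "surj G"
proof -
  obtain M' where M': "linear M'" "\<And>x. M' (M x) = x" "\<And>x. M (M' x) = x"
    using linear_injective_isomorphism[OF M] by metis
  obtain C where C: "\<And>x. norm (M' x) \<le> norm x * C"
    using linear_conv_bounded_linear M'(1) bounded_linear.bounded by metis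
  have "\<exists>x. G x = y" for y
  proof -
    let ?\<phi> = "\<lambda>x. M' (y - (G x - M x))"
    \<comment> \<open>A bound for \<open>?\<phi>\<close> on the whole space; the summand 1 makes the
      radius positive.\<close>
    define R where "R = (norm y + \<bar>B\<bar>) * \<bar>C\<bar> + 1"
    have R: "R > 0" unfolding R_def by (intro add_nonneg_pos mult_nonneg_nonneg) auto
    have "continuous_on (cball 0 R) ?\<phi>"
      by (intro linear_continuous_on_compose[OF _ M'(1)] continuous_intros
          continuous_on_subset[OF G] linear_continuous_on_compose[OF _ M(1)]) auto
    moreover have "norm (?\<phi> x) \<le> R" for x
    proof -
      have "norm (?\<phi> x) \<le> norm (y - (G x - M x)) * C" by (rule C)
      also have "\<dots> \<le> norm (y - (G x - M x)) * \<bar>C\<bar>" by (intro mult_left_mono) auto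
      also have "\<dots> \<le> (norm y + \<bar>B\<bar>) * \<bar>C\<bar>"
        using norm_triangle_ineq4[of y "G x - M x"] B[of x] by (intro mult_right_mono) auto
      finally show ?thesis unfolding R_def by simp
    qed
    ultimately obtain x where "?\<phi> x = x"
      using brouwer_ball[OF R, of 0 ?\<phi>] by (auto simp: Pi_iff)
    then have "M x = y - (G x - M x)" using M'(3) by metis
    then show ?thesis by (intro exI[of _ x]) (simp add: algebra_simps)
  qed
  then show ?thesis by (metis surjI)
qed

lemma periodic_bounded:
  fixes g :: "real ^ 2 \<Rightarrow> 'b::real_normed_vector"
  assumes "continuous_on UNIV g" "\<And>x n. g (x + real_vec n) = g x"
  obtains B where "\<And>x. norm (g x) \<le> B"
proof -
  have "compact (g ` cbox 0 1)"
    by (intro compact_continuous_image continuous_on_subset[OF assms(1)]) auto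
  then obtain B where B: "\<And>x. x \<in> cbox 0 1 \<Longrightarrow> norm (g x) \<le> B"
    using compact_imp_bounded bounded_iff by (metis imageI)
  have "norm (g x) \<le> B" for x
  proof -
    define n where "n = (\<chi> i. - \<lfloor>x $ i\<rfloor>)"
    have "x + real_vec n \<in> cbox 0 1"
      by (auto simp: mem_box_cart n_def) linarith
    then show ?thesis using B assms(2) by metis
  qed
  then show thesis by (rule that)
qed

text \<open>\<open>G\<close> minus the linear map is lattice periodic, hence bounded by its values
  on a unit cube.\<close>

lemma surj_of_linear_increments:
  fixes G :: "real ^ 2 \<Rightarrow> real ^ 2" and M :: "real ^ 2 ^ 2"
  assumes "continuous_on UNIV G" "\<And>x n. G (x + real_vec n) = G x + M *v real_vec n"
    and "det M \<noteq> 0"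
  shows "surj G"
proof -
  have "continuous_on UNIV (\<lambda>x. G x - M *v x)"
    by (intro continuous_intros assms)
  then obtain B where "\<And>x. norm (G x - M *v x) \<le> B"
    using periodic_bounded[of "\<lambda>x. G x - M *v x"] assms(2) by (metis (no_types, lifting)
        add_diff_cancel_right matrix_vector_right_distrib)
  moreover have "inj ((*v) M)"
    using assms(3) by (simp add: inj_matrix_vector_mult invertible_det_nz)
  ultimately show ?thesis
    using surj_linear_perturbation[OF matrix_vector_mul_linear _ assms(1)] by blast
qed

text \<open>The function \<open>\<beta>\<close> gives the winding numbers about 0 of the images of the loops \<open>t \<mapsto> q2 (t n)\<close>
  under the map of the torus to the punctured plane that \<open>E\<close> induces.\<close>

definition has_winding :: "(real ^ 2 \<Rightarrow> complex) \<Rightarrow> (int ^ 2 \<Rightarrow> int) \<Rightarrow> bool" where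
  "has_winding E \<beta> \<longleftrightarrow> (\<exists>g. continuous_on UNIV g \<and> (\<forall>x. E x = exp (g x)) \<and>
     (\<forall>x n. g (x + real_vec n) = g x + of_real (2 * pi * of_int (\<beta> n)) * \<i>))"

lemma exp_eq_increment:
  assumes "exp z = exp (w :: complex)"
  obtains k :: int where "z = w + of_real (2 * pi * of_int k) * \<i>"
  using assms unfolding exp_eq by (metis mult.commute mult.left_commute of_int_mult of_int_numeral
      of_real_mult of_real_of_int_eq)

lemma increment_Ints:
  assumes "z = w + of_real (2 * pi * of_int k) * \<i>"
  shows "(Im z - Im w) / (2 * pi) = of_int k"
  using assms by simp

text \<open>Two continuous logarithms of \<open>E\<close> differ by a constant multiple of 2 pi i,
  so they have the same increments.\<close>

lemma has_winding_unique:
  assumes "has_winding E \<beta>" "has_winding E \<beta>'"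
  shows "\<beta> = \<beta>'"
proof
  fix n
  obtain g g' where g: "continuous_on UNIV g" "\<And>x. E x = exp (g x)"
      "\<And>x n. g (x + real_vec n) = g x + of_real (2 * pi * of_int (\<beta> n)) * \<i>"
    and g': "continuous_on UNIV g'" "\<And>x. E x = exp (g' x)"
      "\<And>x n. g' (x + real_vec n) = g' x + of_real (2 * pi * of_int (\<beta>' n)) * \<i>"
    using assms unfolding has_winding_def by metis
  define d where "d = (\<lambda>x. (Im (g x) - Im (g' x)) / (2 * pi))"
  have "d constant_on UNIV"
  proof (rule continuous_Ints_constant)
    show "continuous_on UNIV d"
      unfolding d_def by (intro continuous_intros g g') auto
    fix x
    have "exp (g x) = exp (g' x)" using g(2) g'(2) by metis
    then obtain k :: int where "g x = g' x + of_real (2 * pi * of_int k) * \<i>"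
      by (rule exp_eq_increment)
    then show "d x \<in> \<int>" unfolding d_def using increment_Ints Ints_of_int by metis
  qed (rule connected_UNIV)
  then have "d (0 + real_vec n) = d 0" unfolding constant_on_def by (metis UNIV_I)
  moreover have "d (0 + real_vec n) = d 0 + of_int (\<beta> n) - of_int (\<beta>' n)"
    unfolding d_def g(3) g'(3) by (simp add: field_simps)
  ultimately show "\<beta> n = \<beta>' n" by simp
qed

text \<open>Homotopy invariance of winding numbers: one logarithm is chosen on the whole slab, and
  its increments are integral and continuous, hence independent of the point and of the
  level.\<close>

lemma has_winding_family:
  fixes E :: "(real ^ 2) \<times> real \<Rightarrow> complex"
  assumes E: "continuous_on (UNIV \<times> {0..1}) E"
    and nz: "\<And>x t. t \<in> {0..1} \<Longrightarrow> E (x, t) \<noteq> 0"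
    and per: "\<And>x n t. t \<in> {0..1} \<Longrightarrow> E (x + real_vec n, t) = E (x, t)"
  obtains \<beta> where "\<And>t. t \<in> {0..1} \<Longrightarrow> has_winding (\<lambda>x. E (x, t)) \<beta>"
proof -
  let ?S = "(UNIV :: (real^2) set) \<times> {0..1::real}"
  have cvx: "convex ?S" by (intro convex_Times) auto
  have nz': "E z \<noteq> 0" if "z \<in> ?S" for z using nz that by (cases z) auto
  obtain g where g: "continuous_on ?S g" "\<And>z. z \<in> ?S \<Longrightarrow> E z = exp (g z)"
    using continuous_logarithm_on_contractible[OF E convex_imp_contractible[OF cvx] nz'] by metis
  have contg: "continuous_on T (\<lambda>p. g (a p, b p))"
    if "continuous_on T a" "continuous_on T b" "\<And>p. p \<in> T \<Longrightarrow> b p \<in> {0..1}"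
    for T :: "'t::topological_space set" and a b
  proof (rule continuous_on_compose2[OF g(1)])
    show "continuous_on T (\<lambda>p. (a p, b p))" using that(1,2) by (rule continuous_on_Pair)
    show "(\<lambda>p. (a p, b p)) ` T \<subseteq> ?S" using that(3) by blast
  qed
  have incr: "\<exists>k::int. g (x + real_vec n, t) = g (x, t) + of_real (2 * pi * of_int k) * \<i>"
    if "t \<in> {0..1}" for x n t
  proof -
    have "exp (g (x + real_vec n, t)) = exp (g (x, t))"
      using per[OF that, of x n] g(2)[of "(x + real_vec n, t)"] g(2)[of "(x, t)"] that by simp
    then show ?thesis by (rule exp_eq_increment) blast
  qed
  have "\<exists>k::int. \<forall>x. \<forall>t\<in>{0..1}. g (x + real_vec n, t) = g (x, t) + of_real (2 * pi * of_int k) * \<i>" for n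
  proof -
    define d where "d = (\<lambda>z. (Im (g (fst z + real_vec n, snd z)) - Im (g (fst z, snd z))) / (2 * pi))"
    have "d constant_on ?S"
    proof (rule continuous_Ints_constant)
      show "connected ?S" using cvx by (rule convex_connected)
      show "continuous_on ?S d"
        unfolding d_def by (intro continuous_intros contg) auto
      fix z assume "z \<in> ?S"
      then have "snd z \<in> {0..1}" by auto
      from incr[OF this, of "fst z" n] show "d z \<in> \<int>"
        unfolding d_def using increment_Ints Ints_of_int by metis
    qed
    then obtain c where c: "\<And>z. z \<in> ?S \<Longrightarrow> d z = c" unfolding constant_on_def by blast
    obtain k :: int where k: "g (0 + real_vec n, 0) = g (0, 0) + of_real (2 * pi * of_int k) * \<i>"
      using incr[of 0 0 n] by auto
    have ck: "c = of_int k" using increment_Ints[OF k] c[of "(0, 0)"] by (simp add: d_def)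
    have "g (x + real_vec n, t) = g (x, t) + of_real (2 * pi * of_int k) * \<i>" if t: "t \<in> {0..1}" for x t
    proof -
      obtain k' :: int where k': "g (x + real_vec n, t) = g (x, t) + of_real (2 * pi * of_int k') * \<i>"
        using incr[OF t] by blast
      have "of_int k' = c"
        using increment_Ints[OF k'] c[of "(x, t)"] t by (simp add: d_def)
      then have "k' = k" using ck by simp
      then show ?thesis using k' by simp
    qed
    then show ?thesis by blast
  qed
  then obtain \<beta> where \<beta>: "\<And>n x t. t \<in> {0..1} \<Longrightarrow>
      g (x + real_vec n, t) = g (x, t) + of_real (2 * pi * of_int (\<beta> n)) * \<i>"
    by metis
  have "has_winding (\<lambda>x. E (x, t)) \<beta>" if "t \<in> {0..1}" for t
    unfolding has_winding_def
  proof (intro exI[of _ "\<lambda>x. g (x, t)"] conjI allI)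
    show "continuous_on UNIV (\<lambda>x. g (x, t))"
      using that by (intro contg continuous_intros)
    show "E (x, t) = exp (g (x, t))" for x using g(2) that by simp
  qed (use \<beta> that in blast)
  then show thesis by (rule that)
qed

section \<open>Calculus of winding numbers\<close>

lemma has_winding_add:
  assumes "has_winding E \<beta>"
  shows "\<beta> (m + n) = \<beta> m + \<beta> n"
proof -
  obtain g where g: "\<And>x n. g (x + real_vec n) = g x + of_real (2 * pi * of_int (\<beta> n)) * \<i>"
    using assms unfolding has_winding_def by metis
  have "Im (g (0 + real_vec (m + n))) = Im (g (0 + real_vec m + real_vec n))" by simp
  then have "2 * pi * of_int (\<beta> (m + n)) = 2 * pi * (of_int (\<beta> m) + of_int (\<beta> n) :: real)"
    unfolding g by (simp add: algebra_simps)
  then show ?thesis by (simp flip: of_int_add)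
qed

lemma additive_int_scale:
  assumes "\<And>m n. \<beta> (m + n) = \<beta> m + \<beta> n"
  shows "\<beta> (k *s n) = k * (\<beta> n :: int)"
proof (induction k rule: int_induct[where k = 0])
  case base
  show ?case using assms[of 0 0] by simp
next
  case (step1 i)
  then show ?case using assms[of "i *s n" n] by (simp add: vector_sadd_rdistrib distrib_right)
next
  case (step2 i)
  have "(i - 1) *s n + n = i *s n" by (simp add: vec_eq_iff algebra_simps)
  then show ?case using step2 assms[of "(i - 1) *s n" n] by (simp add: algebra_simps)
qed

lemma has_winding_linear:
  assumes "has_winding E \<beta>"
  shows "\<beta> n = \<beta> (axis 1 1) * n $ 1 + \<beta> (axis 2 1) * n $ 2"
proof -
  have "n = n $ 1 *s axis 1 1 + n $ 2 *s axis 2 1"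
    by (simp add: vec_eq_iff forall_2 axis_def)
  then have "\<beta> n = \<beta> (n $ 1 *s axis 1 1 + n $ 2 *s axis 2 1)" by simp
  then show ?thesis
    using additive_int_scale[OF has_winding_add[OF assms]] has_winding_add[OF assms]
    by (simp add: mult.commute)
qed

lemma has_winding_cnj:
  assumes "has_winding E \<beta>"
  shows "has_winding (\<lambda>x. cnj (E x)) (\<lambda>n. - \<beta> n)"
proof -
  obtain g where g: "continuous_on UNIV g" "\<And>x. E x = exp (g x)"
      "\<And>x n. g (x + real_vec n) = g x + of_real (2 * pi * of_int (\<beta> n)) * \<i>"
    using assms unfolding has_winding_def by metis
  show ?thesis unfolding has_winding_def
    by (rule exI[of _ "\<lambda>x. cnj (g x)"]) (auto simp: g exp_cnj intro!: continuous_intros g)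
qed

lemma has_winding_linear_comp:
  assumes "has_winding E \<beta>"
  shows "has_winding (\<lambda>x. E (real_mat A *v x)) (\<lambda>n. \<beta> (A *v n))"
proof -
  obtain g where g: "continuous_on UNIV g" "\<And>x. E x = exp (g x)"
      "\<And>x n. g (x + real_vec n) = g x + of_real (2 * pi * of_int (\<beta> n)) * \<i>"
    using assms unfolding has_winding_def by metis
  show ?thesis unfolding has_winding_def
  proof (intro exI[of _ "\<lambda>x. g (real_mat A *v x)"] conjI allI)
    show "continuous_on UNIV (\<lambda>x. g (real_mat A *v x))"
      by (rule continuous_on_compose2[OF g(1)]) (auto intro!: continuous_intros)
  qed (simp_all add: g matrix_vector_right_distrib)
qed

lemma has_winding_mult_exp:
  assumes "has_winding E \<beta>" "continuous_on UNIV \<psi>"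
    "\<And>x n. \<psi> (x + real_vec n) = \<psi> x + of_real (2 * pi * of_int (c n)) * \<i>"
  shows "has_winding (\<lambda>x. E x * exp (\<psi> x)) (\<lambda>n. \<beta> n + c n)"
proof -
  obtain g where g: "continuous_on UNIV g" "\<And>x. E x = exp (g x)"
      "\<And>x n. g (x + real_vec n) = g x + of_real (2 * pi * of_int (\<beta> n)) * \<i>"
    using assms unfolding has_winding_def by metis
  show ?thesis unfolding has_winding_def
    by (rule exI[of _ "\<lambda>x. g x + \<psi> x"])
      (auto simp: g assms(3) exp_add algebra_simps intro!: continuous_intros g assms(2))
qed

text \<open>-E stays in the right half plane, where the principal logarithm is continuous and
  inherits the periodicity of \<open>E\<close>. This treats punctures far from the loop.\<close>

lemma has_winding_near_minus_one:
  assumes "continuous_on UNIV E" "\<And>x n. E (x + real_vec n) = E x" "\<And>x. norm (E x + 1) < 1"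
  shows "has_winding E (\<lambda>_. 0)"
  unfolding has_winding_def
proof (intro exI[of _ "\<lambda>x. Ln (- E x) + of_real pi * \<i>"] conjI allI)
  have *: "- E x \<notin> \<real>\<^sub>\<le>\<^sub>0" for x
  proof
    assume "- E x \<in> \<real>\<^sub>\<le>\<^sub>0"
    then have "Re (E x) \<ge> 0" by (auto simp: complex_nonpos_Reals_iff)
    moreover have "\<bar>Re (E x + 1)\<bar> < 1" using abs_Re_le_cmod[of "E x + 1"] assms(3)[of x] by linarith
    ultimately show False by simp
  qed
  then show "continuous_on UNIV (\<lambda>x. Ln (- E x) + of_real pi * \<i>)"
    by (intro continuous_intros assms(1)) auto
  show "E x = exp (Ln (- E x) + of_real pi * \<i>)" for x
  proof -
    have "- E x \<noteq> 0" using *[of x] by force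
    then show ?thesis by (simp add: exp_add exp_Ln)
  qed
qed (simp add: assms(2))


section \<open>Winding around the punctures of the cylinder\<close>

text \<open>This map identifies the cylinder \<open>\<real>\<^sup>2 / (q\<int> \<times> 0)\<close> with the plane without 0; the upper end of the
  cylinder goes to 0.\<close>

definition cyl :: "real \<Rightarrow> real ^ 2 \<Rightarrow> complex" where
  "cyl q u = exp (Complex (- 2 * pi * u $ 2 / q) (2 * pi * u $ 1 / q))"

text \<open>The puncture sits at 1: \<open>cyl q (u - p) - 1\<close> vanishes exactly when u hits p
  + (qZ, 0).\<close>

lemma cyl_eq_1_iff:
  assumes "q > 0"
  shows "cyl q u = 1 \<longleftrightarrow> u $ 2 = 0 \<and> (\<exists>k::int. u $ 1 = of_int k * q)"
proof -
  have "2 * pi * u $ 1 / q = of_int (2 * k) * pi \<longleftrightarrow> u $ 1 = of_int k * q" for k :: int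
    using assms by (simp add: field_simps)
  then show ?thesis
    using assms unfolding cyl_def exp_eq_1 by simp
qed

text \<open>Turning the cylinder upside down is inversion of the punctured plane; needed for
  \<delta> = -1.\<close>

lemma cyl_minus: "cyl q (- u) = inverse (cyl q u)"
proof -
  have "Complex (- 2 * pi * (- u) $ 2 / q) (2 * pi * (- u) $ 1 / q) =
      - Complex (- 2 * pi * u $ 2 / q) (2 * pi * u $ 1 / q)"
    by (simp add: complex_eq_iff)
  then show ?thesis by (simp only: cyl_def exp_minus)
qed

text \<open>A mirror reflection of the cylinder; with \<open>cyl_minus\<close> it covers all sign
  patterns of (\<alpha>, \<delta>).\<close>

lemma cnj_cyl: "cnj (cyl q u) = cyl q (vector [- u $ 1, u $ 2])"
proof -
  have "Complex (- 2 * pi * (vector [- u $ 1, u $ 2] :: real ^ 2) $ 2 / q)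
        (2 * pi * (vector [- u $ 1, u $ 2] :: real ^ 2) $ 1 / q) =
      cnj (Complex (- 2 * pi * u $ 2 / q) (2 * pi * u $ 1 / q))"
    by (simp add: complex_eq_iff)
  then show ?thesis by (simp only: cyl_def exp_cnj)
qed

lemma norm_cyl: "norm (cyl q u) = exp (- 2 * pi * u $ 2 / q)"
  by (simp add: cyl_def)

lemma cyl_shift:
  assumes "q \<noteq> 0" "w $ 1 = u $ 1 + of_int k * q" "w $ 2 = u $ 2"
  shows "cyl q w = cyl q u"
proof -
  have "Complex (- 2 * pi * w $ 2 / q) (2 * pi * w $ 1 / q) =
      Complex (- 2 * pi * u $ 2 / q) (2 * pi * u $ 1 / q) + of_int (2 * k) * pi * \<i>"
    using assms by (simp add: complex_eq_iff field_simps)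
  then show ?thesis unfolding cyl_def using exp_eq by metis
qed

lemma continuous_on_cyl [continuous_intros]:
  "continuous_on S u \<Longrightarrow> continuous_on S (\<lambda>x. cyl q (u x))"
  unfolding cyl_def Complex_eq by (cases "q = 0") (auto intro!: continuous_intros)

lemma continuous_on_vector_2 [continuous_intros]:
  fixes a b :: "'a::topological_space \<Rightarrow> real"
  assumes "continuous_on S a" "continuous_on S b"
  shows "continuous_on S (\<lambda>x. vector [a x, b x] :: real ^ 2)"
proof -
  have "continuous_on S (\<lambda>x. (\<chi> i. if i = 1 then a x else b x) :: real ^ 2)"
  proof (rule continuous_on_vec_lambda)
    show "continuous_on S (\<lambda>x. if i = 1 then a x else b x)" for i :: 2
      using assms by (cases "i = 1") auto
  qed
  moreover have "(\<chi> i. if i = 1 then a x else b x) = (vector [a x, b x] :: real ^ 2)" for x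
    by (simp add: vec_eq_iff forall_2)
  ultimately show ?thesis by simp
qed

text \<open>A map of the torus to the cylinder minus a point has proportional winding numbers about the
  end and about the point: otherwise every pair of arguments of \<open>z\<close> and \<open>z - 1\<close> would be attained,
  but \<open>z - 1\<close> is not positive for \<open>z\<close> on the positive imaginary axis.\<close>

lemma puncture_winding_parallel:
  assumes H: "continuous_on UNIV H"
    and per: "\<And>x n. H (x + real_vec n) = H x + vector [real_of_int (l1 * n $ 1 + l2 * n $ 2), 0]"
    and q: "q > 0" and l: "real_of_int l1 = m1 * q" "real_of_int l2 = m2 * q"
    and w: "has_winding (\<lambda>x. cyl q (H x) - 1) \<beta>"
  shows "m1 * \<beta> (axis 2 1) = m2 * \<beta> (axis 1 1)"
proof (rule ccontr)
  assume ne: "m1 * \<beta> (axis 2 1) \<noteq> m2 * \<beta> (axis 1 1)"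
  obtain g where g: "continuous_on UNIV g" "\<And>x. cyl q (H x) - 1 = exp (g x)"
      "\<And>x n. g (x + real_vec n) = g x + of_real (2 * pi * of_int (\<beta> n)) * \<i>"
    using w unfolding has_winding_def by metis
  \<comment> \<open>Its rows are the increments, in full turns, of the arguments of z and of z - 1;
    the assumption for contradiction says that they are independent.\<close>
  define M :: "real^2^2" where
    "M = vector [vector [m1, m2], vector [\<beta> (axis 1 1), \<beta> (axis 2 1)]]"
  let ?G = "\<lambda>x. vector [H x $ 1 / q, Im (g x) / (2 * pi)] :: real^2"
  have "surj ?G"
  proof (rule surj_of_linear_increments[where M = M])
    show "continuous_on UNIV ?G"
      using q by (intro continuous_intros H g) auto
    show "?G (x + real_vec n) = ?G x + M *v real_vec n" for x n
    proof -
      have "real_of_int (l1 * n $ 1 + l2 * n $ 2) = (m1 * n $ 1 + m2 * n $ 2) * q"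
        using l by (simp add: algebra_simps)
      then have "?G (x + real_vec n) $ 1 = (?G x + M *v real_vec n) $ 1"
        using q unfolding per
        by (simp add: M_def matrix_vector_mult_def sum_2 add_divide_distrib del: of_int_add of_int_mult)
      moreover have "?G (x + real_vec n) $ 2 = (?G x + M *v real_vec n) $ 2"
        unfolding g(3) has_winding_linear[OF w, of n]
        by (simp add: M_def matrix_vector_mult_def sum_2 add_divide_distrib)
      ultimately show ?thesis by (simp only: vec_eq_iff forall_2)
    qed
    show "det M \<noteq> 0"
      using ne unfolding M_def det_2 by (simp add: mult.commute)
  qed
  from surjD[OF this, of "vector [1 / 4, 0]"] obtain x where x: "?G x = vector [1 / 4, 0]"
    by auto
  have "H x $ 1 / q = 1 / 4" "Im (g x) / (2 * pi) = 0"
    using arg_cong[OF x, of "\<lambda>y. y $ 1"] arg_cong[OF x, of "\<lambda>y. y $ 2"] by simp_all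
  then have "Im (g x) = 0" "2 * pi * H x $ 1 / q = pi / 2" by auto
  then have "Re (exp (g x)) > 0" "Re (cyl q (H x)) = 0"
    unfolding cyl_def Re_exp complex.sel by (simp, simp only: cos_pi_half mult_zero_right)
  then show False
    unfolding g(2)[symmetric] by simp
qed

text \<open>Here \<open>z\<close> is a loop of the torus whose image goes once around the cylinder,
  and \<nu> p is the winding number of that image about p. Winding numbers of all other loops are
  multiples of it, which makes \<nu> comparable before and after the gluing.\<close>

lemma free_displacement_puncture_winding:
  fixes A L :: "int ^ 2 ^ 2" and z :: "int ^ 2"
  assumes h: "free_displacement A L v h"
    and A: "A = vector [vector [\<alpha>, b], vector [0, \<delta>]]" "\<alpha>\<^sup>2 = 1" "\<delta>\<^sup>2 = 1"
    and L: "L = vector [vector [l1, l2], vector [0, 0]]"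
    and comm: "\<alpha> * l2 = l1 * b + l2 * \<delta>"
    and q: "(q :: int) > 0" "q dvd l1" "q dvd l2" "l1 * z $ 1 + l2 * z $ 2 = q"
  obtains \<nu> :: "int ^ 2 \<Rightarrow> int" where
    "\<And>p k. \<nu> (p + vector [q * k, 0]) = \<nu> p"
    "\<And>p. \<nu> (A *v (p - v)) = (if \<delta> = 1 then \<nu> p else 1 - \<nu> p)"
    "\<exists>N. \<forall>p. (p $ 2 > N \<longrightarrow> \<nu> p = 1) \<and> (p $ 2 < - N \<longrightarrow> \<nu> p = 0)"
proof -
  obtain m1 m2 where m: "l1 = m1 * q" "l2 = m2 * q"
    using q(2,3) by (metis dvdE mult.commute)
  have ms: "m1 * z $ 1 + m2 * z $ 2 = 1"
  proof -
    have "q * (m1 * z $ 1 + m2 * z $ 2) = q * 1" using q(4) m by (simp add: algebra_simps)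
    then show ?thesis using q(1) by (metis mult_left_cancel less_irrefl)
  qed
  \<comment> \<open>The number of turns that the image of the loop n makes around the
    cylinder.\<close>
  define \<mu> where "\<mu> = (\<lambda>n::int^2. m1 * n $ 1 + m2 * n $ 2)"
  have \<alpha>\<delta>: "\<alpha> = 1 \<or> \<alpha> = -1" "\<delta> = 1 \<or> \<delta> = -1"
    using A(2,3) by (simp_all add: power2_eq_1_iff)
  have mcomm: "\<alpha> * m2 = m1 * b + m2 * \<delta>"
  proof -
    have "q * (\<alpha> * m2) = q * (m1 * b + m2 * \<delta>)" using comm m by (simp add: algebra_simps)
    then show ?thesis using q(1) by (metis mult_left_cancel less_irrefl)
  qed
  have \<mu>A: "\<mu> (A *v n) = \<alpha> * \<mu> n" for n
  proof -
    have "\<mu> (A *v n) = \<alpha> * m1 * n $ 1 + (m1 * b + m2 * \<delta>) * n $ 2"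
      by (simp add: \<mu>_def A(1) matrix_vector_mult_def sum_2 algebra_simps)
    then show ?thesis unfolding mcomm[symmetric] by (simp add: \<mu>_def algebra_simps)
  qed
  have cont: "continuous_on (UNIV \<times> {0..1}) h"
    and h_shift: "\<And>x n t. t \<in> {0..1} \<Longrightarrow> h (x + real_vec n, t) = h (x, t) + real_vec (L *v n)"
    and h_glue: "\<And>x. h (real_mat A *v x, 0) = real_mat A *v (h (x, 1) - real_vec v)"
    and h_avoid: "\<And>x t. t \<in> {0..1} \<Longrightarrow> h (x, t) \<notin> range real_vec"
    using h unfolding free_displacement_def by blast+
  have Lv: "L *v n = vector [q * \<mu> n, 0]" for n
    by (simp add: vec_eq_iff forall_2 L m \<mu>_def matrix_vector_mult_def sum_2 algebra_simps)
  have conth: "continuous_on T (\<lambda>p. h (a p, c p))"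
    if "continuous_on T a" "continuous_on T c" "\<And>p. p \<in> T \<Longrightarrow> c p \<in> {0..1}"
    for T :: "'t::topological_space set" and a c
  proof (rule continuous_on_compose2[OF cont])
    show "continuous_on T (\<lambda>p. (a p, c p))" using that(1,2) by (rule continuous_on_Pair)
    show "(\<lambda>p. (a p, c p)) ` T \<subseteq> UNIV \<times> {0..1}" using that(3) by blast
  qed
  \<comment> \<open>Zero exactly when the displacement hits the puncture p on the cylinder.\<close>
  define E where "E = (\<lambda>p z. cyl q (h z - real_vec p) - 1)"
  have h_shift1: "h (x + real_vec n, t) $ 1 = h (x, t) $ 1 + of_int (\<mu> n) * of_int q"
    and h_shift2: "h (x + real_vec n, t) $ 2 = h (x, t) $ 2" if "t \<in> {0..1}" for x n t
    using h_shift[OF that, of x n] by (simp_all add: Lv mult.commute)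
  have avoid: "\<not> (h (x, t) $ 2 - of_int (p $ 2) = 0 \<and> (\<exists>k::int. h (x, t) $ 1 - of_int (p $ 1) = of_int k * of_int q))"
    if "t \<in> {0..1}" for x t p
  proof
    assume "h (x, t) $ 2 - of_int (p $ 2) = 0 \<and> (\<exists>k::int. h (x, t) $ 1 - of_int (p $ 1) = of_int k * of_int q)"
    then obtain k :: int where "h (x, t) $ 2 = of_int (p $ 2)" "h (x, t) $ 1 = of_int (p $ 1 + k * q)"
      by (auto simp: algebra_simps)
    then have "\<forall>i. h (x, t) $ i \<in> \<int>" unfolding forall_2 by simp
    then show False using h_avoid[OF that] range_real_vec_iff by blast
  qed
  have "\<exists>\<beta>. \<forall>t\<in>{0..1}. has_winding (\<lambda>x. E p (x, t)) \<beta>" for p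
  proof -
    obtain \<beta> where "\<And>t. t \<in> {0..1} \<Longrightarrow> has_winding (\<lambda>x. E p (x, t)) \<beta>"
    proof (rule has_winding_family[of "E p"])
      show "continuous_on (UNIV \<times> {0..1}) (E p)"
        unfolding E_def by (intro continuous_intros cont)
      show "E p (x, t) \<noteq> 0" if "t \<in> {0..1}" for x t
        using avoid[OF that, of x p] q(1) by (simp add: E_def cyl_eq_1_iff)
      show "E p (x + real_vec n, t) = E p (x, t)" if "t \<in> {0..1}" for x n t
        unfolding E_def using h_shift1[OF that, of x n] h_shift2[OF that, of x n] q(1)
        by (subst cyl_shift[of _ _ "h (x, t) - real_vec p" "\<mu> n"]) auto
    qed blast
    then show ?thesis by blast
  qed
  then obtain \<beta> where \<beta>: "\<And>p t. t \<in> {0..1} \<Longrightarrow> has_winding (\<lambda>x. E p (x, t)) (\<beta> p)"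
    by metis
  define \<nu> where "\<nu> = (\<lambda>p. \<beta> p z)"
  have par: "\<beta> p n = \<nu> p * \<mu> n" for p n
  proof -
    have w: "has_winding (\<lambda>x. cyl q (h (x, 0) - real_vec p) - 1) (\<beta> p)"
      using \<beta>[of 0 p] by (simp add: E_def)
    have "real_of_int m1 * \<beta> p (axis 2 1) = real_of_int m2 * \<beta> p (axis 1 1)"
    proof (rule puncture_winding_parallel[OF _ _ _ _ _ w])
      show "continuous_on UNIV (\<lambda>x. h (x, 0) - real_vec p)"
        by (intro continuous_intros conth) auto
      show "h (x + real_vec n, 0) - real_vec p = h (x, 0) - real_vec p +
          vector [real_of_int (l1 * n $ 1 + l2 * n $ 2), 0]" for x n
        using h_shift1[of 0 x n] h_shift2[of 0 x n]
        by (simp add: vec_eq_iff forall_2 m \<mu>_def algebra_simps)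
    qed (use q m in auto)
    then have eq: "m1 * \<beta> p (axis 2 1) = m2 * \<beta> p (axis 1 1)"
      by (simp flip: of_int_mult)
    let ?b1 = "\<beta> p (axis 1 1)" and ?b2 = "\<beta> p (axis 2 1)"
    have \<nu>: "\<nu> p = ?b1 * z $ 1 + ?b2 * z $ 2"
      unfolding \<nu>_def by (rule has_winding_linear[OF w])
    \<comment> \<open>A pair proportional to (m1, m2) is an integer multiple of it by the Bezout
      relation \<open>ms\<close>, and evaluation at \<open>z\<close> shows that the factor is \<nu>
      p.\<close>
    have "?b1 = m1 * \<nu> p" "?b2 = m2 * \<nu> p"
      using eq ms unfolding \<nu> by algebra+
    then have "?b1 * n $ 1 + ?b2 * n $ 2 = \<nu> p * \<mu> n"
      by (simp add: \<mu>_def algebra_simps)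
    then show ?thesis using has_winding_linear[OF w, of n] by simp
  qed
  \<comment> \<open>\<open>1/w - 1 = - (w - 1) / w\<close> with \<open>w = cyl q (h - p)\<close>, which winds \<open>\<mu>\<close> times around 0\<close>
  have neg: "has_winding (\<lambda>x. cyl q (- (h (x, t) - real_vec p)) - 1) (\<lambda>n. (\<nu> p - 1) * \<mu> n)"
    if t: "t \<in> {0..1}" for p t
  proof -
    let ?\<psi> = "\<lambda>x. Complex (2 * pi * (h (x, t) $ 2 - p $ 2) / q) (pi - 2 * pi * (h (x, t) $ 1 - p $ 1) / q)"
    have "has_winding (\<lambda>x. E p (x, t) * exp (?\<psi> x)) (\<lambda>n. \<beta> p n + - \<mu> n)"
    proof (rule has_winding_mult_exp[OF \<beta>[OF t]])
      show "continuous_on UNIV ?\<psi>"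
        unfolding Complex_eq using q(1) t by (intro continuous_intros conth) auto
      show "?\<psi> (x + real_vec n) = ?\<psi> x + of_real (2 * pi * of_int (- \<mu> n)) * \<i>" for x n
        unfolding h_shift1[OF t] h_shift2[OF t] using q(1) by (simp add: complex_eq_iff field_simps)
    qed
    moreover have "E p (x, t) * exp (?\<psi> x) = cyl q (- (h (x, t) - real_vec p)) - 1" for x
    proof -
      let ?c = "Complex (- 2 * pi * (h (x, t) - real_vec p) $ 2 / q) (2 * pi * (h (x, t) - real_vec p) $ 1 / q)"
      have "?\<psi> x = - ?c + of_real pi * \<i>"
        by (simp add: complex_eq_iff diff_divide_distrib right_diff_distrib)
      then have "exp (?\<psi> x) = - inverse (cyl q (h (x, t) - real_vec p))"
        unfolding cyl_def by (simp only: exp_add exp_minus exp_pi_i) simp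
      moreover have "cyl q (h (x, t) - real_vec p) \<noteq> 0" by (simp add: cyl_def)
      ultimately show ?thesis unfolding E_def cyl_minus by (simp add: left_diff_distrib)
    qed
    moreover have "(\<lambda>n. \<beta> p n + - \<mu> n) = (\<lambda>n. (\<nu> p - 1) * \<mu> n)"
      by (simp add: par algebra_simps)
    ultimately show ?thesis by simp
  qed
  show thesis
  proof (rule that[of \<nu>])
    show "\<nu> (p + vector [q * k, 0]) = \<nu> p" for p k
    proof -
      have "E (p + vector [q * k, 0]) (x, 0) = E p (x, 0)" for x
        unfolding E_def using q(1)
        by (subst cyl_shift[of _ _ "h (x, 0) - real_vec p" "- k"]) auto
      then have "\<beta> (p + vector [q * k, 0]) = \<beta> p"
        using has_winding_unique[OF \<beta>[of 0 "p + vector [q * k, 0]"], of "\<beta> p"] \<beta>[of 0 p] by simp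
      then show ?thesis by (simp add: \<nu>_def)
    qed
  next
    \<comment> \<open>The second row of \<open>L\<close> is zero, so the height of the displacement
      is periodic and the loop stays in a strip of half-width \<open>B\<close>.\<close>
    have "continuous_on UNIV (\<lambda>x. h (x, 0) $ 2)"
      by (intro continuous_intros conth) auto
    then obtain B where B: "\<And>x. norm (h (x, 0) $ 2) \<le> B"
      using periodic_bounded[of "\<lambda>x. h (x, 0) $ 2"] h_shift2[of 0] by auto
    have zero: "k = 0" if "has_winding E' (\<lambda>n. k * \<mu> n)" "has_winding E' (\<lambda>_. 0)" for E' k
    proof -
      have "(\<lambda>n. k * \<mu> n) = (\<lambda>_. 0)" using that by (rule has_winding_unique)
      then have "k * \<mu> z = 0" by metis
      then show ?thesis using ms by (simp add: \<mu>_def)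
    qed
    have "\<nu> p = 1" if p: "p $ 2 > \<lceil>B\<rceil>" for p
    proof -
      \<comment> \<open>For a puncture above the strip the inverted coordinate stays inside the unit
        disc, so its difference from 1 does not wind; by \<open>neg\<close> this means \<nu> p - 1 =
        0.\<close>
      have "has_winding (\<lambda>x. cyl q (- (h (x, 0) - real_vec p)) - 1) (\<lambda>_. 0)"
      proof (rule has_winding_near_minus_one)
        show "continuous_on UNIV (\<lambda>x. cyl q (- (h (x, 0) - real_vec p)) - 1)"
          by (intro continuous_intros conth) auto
        show "cyl q (- (h (x + real_vec n, 0) - real_vec p)) - 1 = cyl q (- (h (x, 0) - real_vec p)) - 1" for x n
          using h_shift1[of 0 x n] h_shift2[of 0 x n] q(1)
          by (subst cyl_shift[of _ _ "- (h (x, 0) - real_vec p)" "- \<mu> n"]) auto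
        show "norm (cyl q (- (h (x, 0) - real_vec p)) - 1 + 1) < 1" for x
        proof -
          have "h (x, 0) $ 2 < p $ 2" using B[of x] p by (simp add: abs_le_iff) linarith
          then show ?thesis using q(1) by (simp add: norm_cyl)
        qed
      qed
      from zero[OF neg[of 0 p] this] show ?thesis by simp
    qed
    moreover have "\<nu> p = 0" if p: "p $ 2 < - \<lceil>B\<rceil>" for p
    proof -
      \<comment> \<open>For a puncture below the strip the coordinate itself stays inside the unit
        disc.\<close>
      have "has_winding (\<lambda>x. E p (x, 0)) (\<lambda>_. 0)"
      proof (rule has_winding_near_minus_one)
        show "continuous_on UNIV (\<lambda>x. E p (x, 0))"
          unfolding E_def by (intro continuous_intros conth) auto
        show "E p (x + real_vec n, 0) = E p (x, 0)" for x n
          using h_shift1[of 0 x n] h_shift2[of 0 x n] q(1) unfolding E_def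
          by (subst cyl_shift[of _ _ "h (x, 0) - real_vec p" "\<mu> n"]) auto
        show "norm (E p (x, 0) + 1) < 1" for x
        proof -
          have "h (x, 0) $ 2 > p $ 2" using B[of x] p by (simp add: abs_le_iff) linarith
          then show ?thesis using q(1) by (simp add: norm_cyl E_def)
        qed
      qed
      moreover have "has_winding (\<lambda>x. E p (x, 0)) (\<lambda>n. \<nu> p * \<mu> n)"
        using \<beta>[of 0 p] by (simp flip: par)
      ultimately show ?thesis using zero by blast
    qed
    ultimately show "\<exists>N. \<forall>p. (p $ 2 > N \<longrightarrow> \<nu> p = 1) \<and> (p $ 2 < - N \<longrightarrow> \<nu> p = 0)"
      by blast
  next
    fix p
    \<comment> \<open>The gluing rule says that the displacement from \<open>T\<close> at level 0 is
      A applied to the displacement from p at level 1, and winding numbers agree at both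
      levels.\<close>
    define T where "T = A *v (p - v)"
    define u where "u = (\<lambda>x. h (x, 1) - real_vec p)"
    \<comment> \<open>the shear coefficient \<open>b\<close> of \<open>A\<close> is deformed to 0; this fixes the line \<open>u\<^sub>2 = 0\<close>, so 0 is avoided\<close>
    let ?W = "\<lambda>z :: (real^2) \<times> real. vector [\<alpha> * u (fst z) $ 1 + snd z * b * u (fst z) $ 2, \<delta> * u (fst z) $ 2] :: real^2"
    obtain \<gamma> where \<gamma>: "\<And>s. s \<in> {0..1} \<Longrightarrow> has_winding (\<lambda>x. cyl q (?W (x, s)) - 1) \<gamma>"
    proof (rule has_winding_family[of "\<lambda>z. cyl q (?W z) - 1"])
      show "continuous_on (UNIV \<times> {0..1}) (\<lambda>z. cyl q (?W z) - 1)"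
        unfolding u_def by (intro continuous_intros conth) auto
      show "cyl q (?W (x, s)) - 1 \<noteq> 0" for x s
      proof
        assume "cyl q (?W (x, s)) - 1 = 0"
        then obtain k :: int where "\<delta> * u x $ 2 = 0" "\<alpha> * u x $ 1 + s * b * u x $ 2 = k * q"
          using cyl_eq_1_iff[of q "?W (x, s)"] q(1) by auto
        then have "u x $ 2 = 0" "u x $ 1 = of_int (\<alpha> * k) * q" using \<alpha>\<delta> by auto
        then have "u x $ 2 = 0" "\<exists>k::int. u x $ 1 = of_int k * q" by blast+
        then show False using avoid[of 1 x p] unfolding u_def by simp
      qed
      show "cyl q (?W (x + real_vec n, s)) - 1 = cyl q (?W (x, s)) - 1" for x n s
        using q(1) h_shift1[of 1 x n] h_shift2[of 1 x n]
        by (subst cyl_shift[of _ _ "?W (x, s)" "\<alpha> * \<mu> n"]) (auto simp: u_def algebra_simps)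
    qed blast
    have "has_winding (\<lambda>x. E T (real_mat A *v x, 0)) (\<lambda>n. \<beta> T (A *v n))"
      by (rule has_winding_linear_comp[of "\<lambda>x. E T (x, 0)"]) (rule \<beta>, simp)
    moreover have "E T (real_mat A *v x, 0) = cyl q (?W (x, 1)) - 1" for x
    proof -
      have "h (real_mat A *v x, 0) - real_vec T = real_mat A *v u x"
        unfolding h_glue T_def u_def
        by (simp add: matrix_vector_mult_diff_distrib flip: real_mat_real_vec)
      also have "\<dots> = ?W (x, 1)"
        by (simp add: vec_eq_iff forall_2 matrix_vector_mult_def sum_2 A(1))
      finally show ?thesis by (simp add: E_def)
    qed
    ultimately have \<gamma>1: "(\<lambda>n. \<beta> T (A *v n)) = \<gamma>"
      using \<gamma>[of 1] by (intro has_winding_unique[of "\<lambda>x. cyl q (?W (x, 1)) - 1"]) auto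
    have pos: "has_winding (\<lambda>x. cyl q (u x) - 1) (\<lambda>n. \<nu> p * \<mu> n)"
      using \<beta>[of 1 p] by (simp add: E_def u_def flip: par)
    have neg': "has_winding (\<lambda>x. cyl q (- u x) - 1) (\<lambda>n. (\<nu> p - 1) * \<mu> n)"
      using neg[of 1 p] by (simp add: u_def)
    \<comment> \<open>After the shear is removed, A acts by signs: \<delta> = -1 inverts the
      cylinder coordinate and replaces \<nu> by \<nu> - 1, and a conjugation, when one is required,
      changes the sign.\<close>
    have "has_winding (\<lambda>x. cyl q (?W (x, 0)) - 1)
        (\<lambda>n. if \<delta> = 1 then \<alpha> * (\<nu> p * \<mu> n) else - \<alpha> * ((\<nu> p - 1) * \<mu> n))"
    proof -
      consider "\<delta> = 1" "\<alpha> = 1" | "\<delta> = 1" "\<alpha> = -1" | "\<delta> = -1" "\<alpha> = -1" | "\<delta> = -1" "\<alpha> = 1"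
        using \<alpha>\<delta> by blast
      then show ?thesis
      proof cases
        case 1
        have "?W (x, 0) = u x" for x by (simp add: 1 vec_eq_iff forall_2)
        then show ?thesis using pos 1 by simp
      next
        case 2
        have "cyl q (?W (x, 0)) - 1 = cnj (cyl q (u x) - 1)" for x by (simp add: 2 cnj_cyl)
        then show ?thesis using has_winding_cnj[OF pos] 2 by simp
      next
        case 3
        have "?W (x, 0) = - u x" for x by (simp add: 3 vec_eq_iff forall_2)
        then show ?thesis using neg' 3 by simp
      next
        case 4
        have "cyl q (?W (x, 0)) - 1 = cnj (cyl q (- u x) - 1)" for x by (simp add: 4 cnj_cyl)
        then show ?thesis using has_winding_cnj[OF neg'] 4 by simp
      qed
    qed
    then have "(\<lambda>n. if \<delta> = 1 then \<alpha> * (\<nu> p * \<mu> n) else - \<alpha> * ((\<nu> p - 1) * \<mu> n)) = \<gamma>"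
      by (rule has_winding_unique) (rule \<gamma>, simp)
    from fun_cong[OF this, of z]
    have "\<beta> T (A *v z) = (if \<delta> = 1 then \<alpha> * (\<nu> p * \<mu> z) else - \<alpha> * ((\<nu> p - 1) * \<mu> z))"
      unfolding \<gamma>1[symmetric] by simp
    moreover have "\<mu> z = 1" using ms by (simp add: \<mu>_def)
    \<comment> \<open>The loop A z goes \<alpha> times around the cylinder, so the factor \<alpha>
      cancels.\<close>
    ultimately have "\<nu> T * \<alpha> = (if \<delta> = 1 then \<alpha> * \<nu> p else - \<alpha> * (\<nu> p - 1))"
      unfolding par \<mu>A by simp
    then show "\<nu> (A *v (p - v)) = (if \<delta> = 1 then \<nu> p else 1 - \<nu> p)"
      using \<alpha>\<delta>(1) unfolding T_def by (auto split: if_splits)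
  qed
qed


section \<open>Obstructions and constructions in upper triangular form\<close>

lemma upper_triangular_mult_vec:
  "(vector [vector [a, b], vector [c, d]] :: 'a::comm_ring_1 ^ 2 ^ 2) *v x =
    vector [a * x $ 1 + b * x $ 2, c * x $ 1 + d * x $ 2]"
  by (simp add: vec_eq_iff forall_2 matrix_vector_mult_def sum_2)

lemma real_mat_vector_2:
  "real_mat (vector [vector [a, b], vector [c, d]]) =
    vector [vector [of_int a, of_int b], vector [of_int c, of_int d]]"
  by (simp add: vec_eq_iff forall_2)

text \<open>If \<delta> = 1, iterating p \<mapsto> A (p - v) keeps \<nu> and changes the height by
  -v_2 each time. If \<delta> = -1 and v_2 = 0, this map preserves the axis, acts there by a
  \<mapsto> \<alpha> (a - v_1) modulo q and exchanges \<nu> with 1 - \<nu>, so a fixed point or an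
  odd cycle is impossible.\<close>

lemma free_displacement_obstruction:
  fixes A L :: "int ^ 2 ^ 2"
  assumes h: "free_displacement A L v h"
    and A: "A = vector [vector [\<alpha>, b], vector [0, \<delta>]]" "\<alpha>\<^sup>2 = 1" "\<delta>\<^sup>2 = 1"
    and L: "L = vector [vector [l1, l2], vector [0, 0]]" "l1 \<noteq> 0 \<or> l2 \<noteq> 0"
    and comm: "\<alpha> * l2 = l1 * b + l2 * \<delta>"
    and q: "q = gcd l1 l2"
  shows "\<delta> = 1 \<Longrightarrow> v $ 2 = 0"
    and "\<delta> = -1 \<Longrightarrow> v $ 2 = 0 \<Longrightarrow> \<alpha> = -1 \<Longrightarrow> even q \<and> odd (v $ 1)"
    and "\<delta> = -1 \<Longrightarrow> v $ 2 = 0 \<Longrightarrow> \<alpha> = 1 \<Longrightarrow> \<exists>k. even k \<and> q = k * gcd q (v $ 1)"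
proof -
  have qpos: "q > 0" using L(2) q by (metis gcd_eq_0_iff gcd_ge_0_int order_le_less)
  obtain z1 z2 where "z1 * l1 + z2 * l2 = q"
    using bezout_int[of l1 l2] q by blast
  then have z: "l1 * (vector [z1, z2] :: int^2) $ 1 + l2 * (vector [z1, z2] :: int^2) $ 2 = q"
    by (simp add: mult.commute)
  obtain \<nu> :: "int ^ 2 \<Rightarrow> int" where \<nu>: "\<And>p k. \<nu> (p + vector [q * k, 0]) = \<nu> p"
    "\<And>p. \<nu> (A *v (p - v)) = (if \<delta> = 1 then \<nu> p else 1 - \<nu> p)"
    "\<exists>N. \<forall>p. (p $ 2 > N \<longrightarrow> \<nu> p = 1) \<and> (p $ 2 < - N \<longrightarrow> \<nu> p = 0)"
    by (rule free_displacement_puncture_winding[OF h A L(1) comm qpos _ _ z])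
      (use q in simp, use q in simp, rule that)
  obtain N where N: "\<And>p. p $ 2 > N \<Longrightarrow> \<nu> p = 1" "\<And>p. p $ 2 < - N \<Longrightarrow> \<nu> p = 0"
    using \<nu>(3) by blast
  have Av: "A *v (p - v) = vector [\<alpha> * (p $ 1 - v $ 1) + b * (p $ 2 - v $ 2), \<delta> * (p $ 2 - v $ 2)]" for p
    by (simp add: A(1) upper_triangular_mult_vec)
  show "v $ 2 = 0" if \<delta>: "\<delta> = 1"
  proof (rule ccontr)
    assume v2: "v $ 2 \<noteq> 0"
    have orbit: "\<exists>p'. \<nu> p' = \<nu> p \<and> p' $ 2 = p $ 2 - int k * v $ 2" for p k
    proof (induction k)
      case (Suc k)
      then obtain p' where p': "\<nu> p' = \<nu> p" "p' $ 2 = p $ 2 - int k * v $ 2" by blast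
      have "\<nu> (A *v (p' - v)) = \<nu> p" using \<nu>(2)[of p'] \<delta> p'(1) by simp
      moreover have "(A *v (p' - v)) $ 2 = p $ 2 - int (Suc k) * v $ 2"
        unfolding Av using p'(2) \<delta> by (simp add: algebra_simps)
      ultimately show ?case by blast
    qed auto
    \<comment> \<open>Enough steps of size at least 1 to get from height |N| + 1 to -|N| - 1, or
      back.\<close>
    define K where "K = nat (2 * \<bar>N\<bar> + 2)"
    have K: "int K = 2 * \<bar>N\<bar> + 2" by (simp add: K_def)
    show False
    proof (cases "v $ 2 > 0")
      case True
      then have "int K * 1 \<le> int K * v $ 2" by (intro mult_left_mono) auto
      moreover obtain p' where "\<nu> p' = \<nu> (vector [0, \<bar>N\<bar> + 1])"
        "p' $ 2 = (vector [0, \<bar>N\<bar> + 1] :: int^2) $ 2 - int K * v $ 2"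
        using orbit by blast
      moreover have "\<nu> (vector [0, \<bar>N\<bar> + 1]) = 1" by (rule N) simp
      ultimately show False using N(2)[of p'] K by simp
    next
      case False
      then have "int K * 1 \<le> int K * (- v $ 2)" using v2 by (intro mult_left_mono) auto
      moreover obtain p' where "\<nu> p' = \<nu> (vector [0, - \<bar>N\<bar> - 1])"
        "p' $ 2 = (vector [0, - \<bar>N\<bar> - 1] :: int^2) $ 2 - int K * v $ 2"
        using orbit by blast
      moreover have "\<nu> (vector [0, - \<bar>N\<bar> - 1]) = 0" by (rule N) simp
      ultimately show False using N(1)[of p'] K by simp
    qed
  qed
  have flip: "\<nu> (vector [\<alpha> * (a - v $ 1), 0]) = 1 - \<nu> (vector [a, 0])" if "\<delta> = -1" "v $ 2 = 0" for a
    using \<nu>(2)[of "vector [a, 0]"] that unfolding Av by simp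
  have per: "\<nu> (vector [a + q * k, 0]) = \<nu> (vector [a, 0])" for a k
  proof -
    have "(vector [a + q * k, 0] :: int^2) = vector [a, 0] + vector [q * k, 0]"
      by (simp add: vec_eq_iff forall_2)
    then show ?thesis using \<nu>(1) by simp
  qed
  show "even q \<and> odd (v $ 1)" if \<delta>: "\<delta> = -1" "v $ 2 = 0" and \<alpha>: "\<alpha> = -1"
  proof (rule ccontr)
    assume "\<not> (even q \<and> odd (v $ 1))"
    \<comment> \<open>A fixed point of the reflection a \<mapsto> v_1 - a modulo q needs v_1 - q k
      even: k = 0 serves if v_1 is even, k = v_1 if q is odd.\<close>
    then have "even (v $ 1) \<or> even (v $ 1 - q * v $ 1)" by auto
    then obtain k where "even (v $ 1 - q * k)" by (metis diff_zero mult_zero_right)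
    then obtain a where a: "v $ 1 - q * k = 2 * a" by blast
    then have "\<alpha> * (a - v $ 1) = a + q * k" using \<alpha> by simp
    then have "\<nu> (vector [a + q * k, 0]) = 1 - \<nu> (vector [a, 0])"
      using flip[OF \<delta>, of a] by simp
    then have "2 * \<nu> (vector [a, 0]) = 1" using per by simp
    then show False by presburger
  qed
  show "\<exists>k. even k \<and> q = k * gcd q (v $ 1)" if \<delta>: "\<delta> = -1" "v $ 2 = 0" and \<alpha>: "\<alpha> = 1"
  proof -
    let ?g = "gcd q (v $ 1)"
    obtain m where m: "q = m * ?g" by (metis gcd_dvd1 dvdE mult.commute)
    obtain w where w: "v $ 1 = w * ?g" by (metis gcd_dvd2 dvdE mult.commute)
    have "even m"
    proof (rule ccontr)
      assume odd: "odd m"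
      have "m > 0" using m qpos by (metis gcd_ge_0_int linorder_not_less zero_less_mult_pos2
            mult_nonpos_nonneg order_le_less_trans)
      have iter: "\<nu> (vector [a - int k * v $ 1, 0]) = (if even k then \<nu> (vector [a, 0]) else 1 - \<nu> (vector [a, 0]))"
        for a k
      proof (induction k)
        case (Suc k)
        have "\<alpha> * (a - int k * v $ 1 - v $ 1) = a - int (Suc k) * v $ 1"
          using \<alpha> by (simp add: algebra_simps)
        then show ?case using flip[OF \<delta>, of "a - int k * v $ 1"] Suc by simp
      qed simp
      \<comment> \<open>The translation by -v_1 has order m = q / gcd (q, v_1) modulo q, so m steps
        return to the start; for odd m they would exchange \<nu> with 1 - \<nu>.\<close>
      have "0 - int (nat m) * v $ 1 = 0 + q * (- w)"
      proof -
        have "m * v $ 1 = q * w" by (subst w, subst m) (simp add: ac_simps)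
        then show ?thesis using \<open>m > 0\<close> by simp
      qed
      then have "1 - \<nu> (vector [0, 0]) = \<nu> (vector [0, 0])"
        using iter[of 0 "nat m"] per[of 0 "- w"] odd \<open>m > 0\<close> by (simp add: even_nat_iff)
      then show False by presburger
    qed
    then show ?thesis using m by blast
  qed
qed

text \<open>Reduces the construction to a family of curves: the linear form l1 x_1 + l2 x_2 is
  multiplied by \<alpha> under A, by \<open>comm\<close>, and takes multiples of q on the lattice,
  so a displacement may depend on x through it alone.\<close>

lemma free_displacement_of_profile:
  fixes A L :: "int ^ 2 ^ 2" and \<Gamma> :: "real \<times> real \<Rightarrow> real ^ 2"
  assumes A: "A = vector [vector [\<alpha>, b], vector [0, \<delta>]]"
    and L: "L = vector [vector [l1, l2], vector [0, 0]]"
    and comm: "\<alpha> * l2 = l1 * b + l2 * \<delta>"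
    and q: "q dvd l1" "q dvd l2"
    and cont: "continuous_on (UNIV \<times> {0..1}) \<Gamma>"
    and shift: "\<And>u t k. t \<in> {0..1} \<Longrightarrow> \<Gamma> (u + of_int (q * k), t) = \<Gamma> (u, t) + vector [of_int (q * k), 0]"
    and glue: "\<And>u. \<Gamma> (of_int \<alpha> * u, 0) = real_mat A *v (\<Gamma> (u, 1) - real_vec v)"
    and avoid: "\<And>u t. t \<in> {0..1} \<Longrightarrow> \<Gamma> (u, t) \<notin> range real_vec"
  shows "free_displacement A L v (\<lambda>(x, t). \<Gamma> (l1 * x $ 1 + l2 * x $ 2, t))"
  unfolding free_displacement_def
proof (intro conjI allI impI)
  show "continuous_on (UNIV \<times> {0..1}) (\<lambda>(x :: real^2, t). \<Gamma> (l1 * x $ 1 + l2 * x $ 2, t))"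
    unfolding case_prod_unfold
    by (rule continuous_on_compose2[OF cont]) (auto intro!: continuous_intros)
next
  fix x :: "real^2" and n :: "int^2" and t :: real assume t: "t \<in> {0..1}"
  obtain k where k: "l1 * n $ 1 + l2 * n $ 2 = q * k"
    using q by (metis dvdE dvd_add dvd_mult2)
  have "l1 * (x + real_vec n) $ 1 + l2 * (x + real_vec n) $ 2 =
      l1 * x $ 1 + l2 * x $ 2 + of_int (l1 * n $ 1 + l2 * n $ 2)"
    by (simp add: algebra_simps)
  moreover have "real_vec (L *v n) = vector [of_int (l1 * n $ 1 + l2 * n $ 2), 0]"
    by (simp add: L upper_triangular_mult_vec vec_eq_iff forall_2)
  ultimately show "(case (x + real_vec n, t) of (x, t) \<Rightarrow> \<Gamma> (l1 * x $ 1 + l2 * x $ 2, t)) =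
      (case (x, t) of (x, t) \<Rightarrow> \<Gamma> (l1 * x $ 1 + l2 * x $ 2, t)) + real_vec (L *v n)"
    using shift[OF t] unfolding k by simp
next
  fix x :: "real^2"
  have "real_of_int \<alpha> * real_of_int l2 = real_of_int l1 * real_of_int b + real_of_int l2 * real_of_int \<delta>"
    using comm by (metis of_int_add of_int_mult)
  then have "l1 * (\<alpha> * x $ 1 + b * x $ 2) + l2 * (\<delta> * x $ 2) = \<alpha> * (l1 * x $ 1 + l2 * x $ 2)"
    by (simp add: algebra_simps) (metis distrib_left mult.commute mult.left_commute)
  then have "l1 * (real_mat A *v x) $ 1 + l2 * (real_mat A *v x) $ 2 = \<alpha> * (l1 * x $ 1 + l2 * x $ 2)"
    by (simp add: A real_mat_vector_2 upper_triangular_mult_vec)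
  then show "(case (real_mat A *v x, 0) of (x, t) \<Rightarrow> \<Gamma> (l1 * x $ 1 + l2 * x $ 2, t)) =
      real_mat A *v ((case (x, 1) of (x, t) \<Rightarrow> \<Gamma> (l1 * x $ 1 + l2 * x $ 2, t)) - real_vec v)"
    using glue by simp
next
  fix x :: "real^2" and t :: real assume "t \<in> {0..1}"
  then show "(case (x, t) of (x, t) \<Rightarrow> \<Gamma> (l1 * x $ 1 + l2 * x $ 2, t)) \<notin> range real_vec"
    using avoid by simp
qed

text \<open>The height c must be fixed by c \<mapsto> \<delta> (c - v_2) and must miss the integers:
  c = 1/2 for \<delta> = 1 and v_2 = 0, c = v_2 / 2 for \<delta> = -1 and v_2 odd.\<close>

lemma free_displacement_horizontal:
  fixes A L :: "int ^ 2 ^ 2" and c :: real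
  assumes A: "A = vector [vector [\<alpha>, b], vector [0, \<delta>]]"
    and L: "L = vector [vector [l1, l2], vector [0, 0]]"
    and comm: "\<alpha> * l2 = l1 * b + l2 * \<delta>"
    and c: "c \<notin> \<int>" "of_int \<delta> * (c - of_int (v $ 2)) = c"
  shows "\<exists>h. free_displacement A L v h"
proof -
  \<comment> \<open>The horizontal offset interpolates between v_1 at level 1, cancelled by the
    subtraction of v, and the shear term that A creates, at level 0.\<close>
  let ?\<Gamma> = "\<lambda>(u :: real, t :: real). vector [u + (1 - t) * (b * (c - v $ 2)) + t * v $ 1, c] :: real^2"
  have "free_displacement A L v (\<lambda>(x, t). ?\<Gamma> (l1 * x $ 1 + l2 * x $ 2, t))"
  proof (rule free_displacement_of_profile[OF A L comm, of 1])
    show "continuous_on (UNIV \<times> {0..1}) ?\<Gamma>"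
      unfolding case_prod_unfold by (intro continuous_intros)
    show "?\<Gamma> (of_int \<alpha> * u, 0) = real_mat A *v (?\<Gamma> (u, 1) - real_vec v)" for u
      using c(2) by (simp add: A real_mat_vector_2 upper_triangular_mult_vec)
    show "?\<Gamma> (u, t) \<notin> range real_vec" for u t
      using c(1) by (auto simp: range_real_vec_iff forall_2)
  qed (auto simp: vec_eq_iff forall_2)
  then show ?thesis by blast
qed

text \<open>The curve is the graph of \<open>\<phi>\<close>, sheared so as to absorb \<open>b\<close>. The shear does not move its
  intersections with the axis, which are the only points where it could meet the lattice.\<close>

lemma free_displacement_wave:
  fixes A L :: "int ^ 2 ^ 2" and \<phi> :: "real \<Rightarrow> real"
  assumes A: "A = vector [vector [\<alpha>, b], vector [0, -1]]"
    and L: "L = vector [vector [l1, l2], vector [0, 0]]"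
    and comm: "\<alpha> * l2 = l1 * b + l2 * (-1)"
    and v: "v $ 2 = 0"
    and q: "q dvd l1" "q dvd l2"
    and small: "\<And>u. \<bar>\<phi> u\<bar> < 1"
    and \<phi>: "continuous_on UNIV \<phi>" "\<And>n::int. \<phi> n \<noteq> 0"
      "\<And>u k. \<phi> (u + of_int (q * k)) = \<phi> u" "\<And>u :: real. \<phi> (of_int \<alpha> * u) = - \<phi> (u + of_int (v $ 1))"
  shows "\<exists>h. free_displacement A L v h"
proof -
  \<comment> \<open>At level 1 the graph is translated by v_1, which the subtraction of v undoes; at
    level 0 the full shear matches the term b \<phi> produced by A.\<close>
  let ?\<Gamma> = "\<lambda>(u :: real, t :: real).
    vector [u + t * v $ 1 - (1 - t) * b * \<phi> (u + t * v $ 1), \<phi> (u + t * v $ 1)] :: real^2"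
  have "free_displacement A L v (\<lambda>(x, t). ?\<Gamma> (l1 * x $ 1 + l2 * x $ 2, t))"
  proof (rule free_displacement_of_profile[OF A L comm q])
    show "continuous_on (UNIV \<times> {0..1}) ?\<Gamma>"
      unfolding case_prod_unfold
      by (intro continuous_intros continuous_on_compose2[OF \<phi>(1)]) auto
    show "?\<Gamma> (of_int \<alpha> * u, 0) = real_mat A *v (?\<Gamma> (u, 1) - real_vec v)" for u
      using \<phi>(4)[of u] v by (simp add: A real_mat_vector_2 upper_triangular_mult_vec)
    show "?\<Gamma> (u + of_int (q * k), t) = ?\<Gamma> (u, t) + vector [of_int (q * k), 0]" for u t k
    proof -
      have "\<phi> (u + of_int (q * k) + t * v $ 1) = \<phi> (u + t * v $ 1)"
        using \<phi>(3)[of "u + t * v $ 1" k] by (simp add: algebra_simps)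
      then show ?thesis by (simp add: vec_eq_iff forall_2)
    qed
    show "?\<Gamma> (u, t) \<notin> range real_vec" for u t
    proof
      assume "?\<Gamma> (u, t) \<in> range real_vec"
      then have ints: "?\<Gamma> (u, t) $ 1 \<in> \<int>" "?\<Gamma> (u, t) $ 2 \<in> \<int>" 
        unfolding prod.case range_real_vec_iff by blast+
      have "\<phi> (u + t * v $ 1) \<in> \<int>" using ints(2) by simp
      then obtain m :: int where "\<phi> (u + t * v $ 1) = m" by (rule Ints_cases)
      then have zero: "\<phi> (u + t * v $ 1) = 0" using small[of "u + t * v $ 1"] by simp
      then have "u + t * v $ 1 \<in> \<int>" using ints(1) by simp
      then obtain n :: int where "u + t * v $ 1 = n" by (rule Ints_cases)
      then show False using zero \<phi>(2)[of n] by simp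
    qed
  qed
  then show ?thesis by blast
qed

text \<open>cos (pi u) is even, changes sign under odd translations, has period 2, which divides q,
  and is nonzero at the integers; the factor 1/2 keeps it below height 1.\<close>

lemma free_displacement_cos:
  fixes A L :: "int ^ 2 ^ 2"
  assumes A: "A = vector [vector [-1, b], vector [0, -1]]"
    and L: "L = vector [vector [l1, l2], vector [0, 0]]"
    and comm: "- 1 * l2 = l1 * b + l2 * (-1)"
    and v: "v $ 2 = 0" "odd (v $ 1)"
    and q: "q dvd l1" "q dvd l2" "even q"
  shows "\<exists>h. free_displacement A L v h"
proof (rule free_displacement_wave[OF A L comm v(1) q(1,2)])
  let ?\<phi> = "\<lambda>u::real. cos (pi * u) / 2"
  show "\<bar>?\<phi> u\<bar> < 1" for u
    using abs_cos_le_one[of "pi * u"] unfolding abs_divide abs_numeral by linarith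
  show "continuous_on UNIV ?\<phi>" by (intro continuous_intros) auto
  show "?\<phi> (of_int n) \<noteq> 0" for n
    using sin_cos_squared_add[of "pi * of_int n"] by (auto simp: sin_npi_int)
  show "?\<phi> (u + of_int (q * k)) = ?\<phi> u" for u k
  proof -
    obtain m where "q * k = 2 * m" using q(3) by (metis dvdE dvd_mult2)
    then have "pi * (u + of_int (q * k)) = pi * u + of_int m * (2 * pi)" by (simp add: algebra_simps)
    then show ?thesis by (simp only: cos.plus_of_int[where 'a = real, unfolded of_real_eq_id id_apply])
  qed
  show "?\<phi> (of_int (-1) * u) = - ?\<phi> (u + of_int (v $ 1))" for u
  proof -
    obtain m where "v $ 1 = 2 * m + 1" using v(2) by (metis oddE)
    then have "pi * (u + of_int (v $ 1)) = pi * u + pi + of_int m * (2 * pi)" by (simp add: algebra_simps)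
    then have "cos (pi * (u + of_int (v $ 1))) = cos (pi * u + pi)" by (simp only: cos.plus_of_int[where 'a = real, unfolded of_real_eq_id id_apply])
    then show ?thesis by simp
  qed
qed

text \<open>A sine of half-period r = gcd (q, v_1). Its period 2 r divides q, translation by the odd
  multiple v_1 of r changes its sign, and the phase 1/2 moves its zeros to half-integers.\<close>

lemma free_displacement_sin:
  fixes A L :: "int ^ 2 ^ 2"
  assumes A: "A = vector [vector [1, b], vector [0, -1]]"
    and L: "L = vector [vector [l1, l2], vector [0, 0]]"
    and comm: "1 * l2 = l1 * b + l2 * (-1)"
    and v: "v $ 2 = 0"
    and q: "q dvd l1" "q dvd l2" "q > 0" "q = k * gcd q (v $ 1)" "even k"
  shows "\<exists>h. free_displacement A L v h"
proof (rule free_displacement_wave[OF A L comm v q(1,2)])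
  define r where "r = gcd q (v $ 1)"
  have r: "r > 0" using q(3) by (simp add: r_def)
  obtain m where m: "v $ 1 = m * r" by (metis r_def gcd_dvd2 dvdE mult.commute)
  \<comment> \<open>Otherwise 2 r would divide both q, an even multiple of r, and v_1, hence their
    gcd r.\<close>
  have "odd m"
  proof
    assume "even m"
    then have "2 * r dvd q" "2 * r dvd v $ 1"
      using q(4,5) m r_def by (metis mult_dvd_mono dvd_refl)+
    then have "2 * r dvd r" by (simp add: r_def)
    then show False using r zdvd_imp_le by fastforce
  qed
  then obtain m' where m': "m = 2 * m' + 1" by (rule oddE)
  obtain k' where k': "k = 2 * k'" using q(5) by blast
  let ?\<phi> = "\<lambda>u::real. sin (pi * (u + 1 / 2) / r) / 2"
  show "\<bar>?\<phi> u\<bar> < 1" for u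
    using abs_sin_le_one[of "pi * (u + 1 / 2) / r"] unfolding abs_divide[of "sin _"] abs_numeral by linarith
  show "continuous_on UNIV ?\<phi>" using r by (intro continuous_intros) auto
  show "?\<phi> (of_int n) \<noteq> 0" for n
  proof
    assume "?\<phi> (of_int n) = 0"
    then obtain i :: int where "pi * (of_int n + 1 / 2) / r = i * pi"
      by (auto simp: sin_zero_iff_int2)
    then have "pi * (of_int n + 1 / 2) = pi * of_int (i * r)" using r by (simp add: field_simps)
    then have "of_int n + 1 / 2 = (of_int (i * r) :: real)" unfolding mult_cancel_left by simp
    then have "of_int (2 * n + 1) = (of_int (2 * i * r) :: real)" by simp
    then have "2 * n + 1 = 2 * (i * r)" unfolding of_int_eq_iff by simp
    then show False by presburger
  qed
  have shift: "pi * (u + 2 * K * R + 1 / 2) / R = pi * (u + 1 / 2) / R + K * (2 * pi)"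
    if "R \<noteq> 0" for u K R :: real
    using that by (simp add: field_simps)
  show "?\<phi> (u + of_int (q * j)) = ?\<phi> u" for u j
  proof -
    have "q * j = 2 * (k' * j) * r"
    proof -
      have "q = 2 * k' * r" using q(4) k' by (simp only: r_def)
      from arg_cong[OF this, of "\<lambda>i. i * j"] show ?thesis by (simp only: mult.assoc mult.commute[of r j])
    qed
    from arg_cong[OF this, of real_of_int]
    have qj: "real_of_int (q * j) = 2 * real_of_int (k' * j) * r"
      by (simp only: of_int_mult of_int_numeral)
    have "pi * (u + of_int (q * j) + 1 / 2) / r = pi * (u + 1 / 2) / r + real_of_int (k' * j) * (2 * pi)"
      unfolding qj by (rule shift) (use r in simp)
    then show ?thesis by (simp only: sin.plus_of_int[where 'a = real, unfolded of_real_eq_id id_apply])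
  qed
  show "?\<phi> (of_int 1 * u) = - ?\<phi> (u + of_int (v $ 1))" for u
  proof -
    have vr: "of_int (v $ 1) = 2 * real_of_int m' * real_of_int r + r"
      unfolding m m' by (simp add: algebra_simps)
    have "pi * (u + of_int (v $ 1) + 1 / 2) / r = pi * (u + r + 2 * real_of_int m' * r + 1 / 2) / r"
      unfolding vr by (simp add: algebra_simps)
    also have "\<dots> = pi * (u + r + 1 / 2) / r + real_of_int m' * (2 * pi)"
      by (rule shift) (use r in simp)
    also have "pi * (u + r + 1 / 2) / r = pi * (u + 1 / 2) / r + pi"
      using r by (simp add: field_simps)
    finally have "pi * (u + of_int (v $ 1) + 1 / 2) / r = pi * (u + 1 / 2) / r + pi + real_of_int m' * (2 * pi)" .
    then have "sin (pi * (u + of_int (v $ 1) + 1 / 2) / r) = sin (pi * (u + 1 / 2) / r + pi)"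
      by (simp only: sin.plus_of_int[where 'a = real, unfolded of_real_eq_id id_apply])
    then show ?thesis by simp
  qed
qed


section \<open>General displacements\<close>

lemma free_displacement_iff:
  fixes A L :: "int ^ 2 ^ 2"
  assumes A: "A = vector [vector [\<alpha>, b], vector [0, \<delta>]]" "\<alpha>\<^sup>2 = 1" "\<delta>\<^sup>2 = 1"
    and L: "L = vector [vector [l1, l2], vector [0, 0]]" "l1 \<noteq> 0 \<or> l2 \<noteq> 0"
    and comm: "\<alpha> * l2 = l1 * b + l2 * \<delta>"
    and q: "q = gcd l1 l2"
    and v: "\<delta> = -1 \<Longrightarrow> even (v $ 2) \<Longrightarrow> v $ 2 = 0"
  shows "(\<exists>h. free_displacement A L v h) \<longleftrightarrow>
    (\<delta> = 1 \<and> v $ 2 = 0) \<or> (\<delta> = -1 \<and> odd (v $ 2)) \<or>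
    (\<delta> = -1 \<and> v $ 2 = 0 \<and> \<alpha> = -1 \<and> even q \<and> odd (v $ 1)) \<or>
    (\<delta> = -1 \<and> v $ 2 = 0 \<and> \<alpha> = 1 \<and> (\<exists>k. even k \<and> q = k * gcd q (v $ 1)))"
    (is "_ \<longleftrightarrow> ?R")
proof
  assume "\<exists>h. free_displacement A L v h"
  then obtain h where h: "free_displacement A L v h" by blast
  note obs = free_displacement_obstruction[OF h A L comm q]
  have "\<alpha> = 1 \<or> \<alpha> = -1" "\<delta> = 1 \<or> \<delta> = -1"
    using A(2,3) by (simp_all add: power2_eq_1_iff)
  then show ?R using obs v by blast
next
  have qpos: "q > 0" using L(2) q by (metis gcd_eq_0_iff gcd_ge_0_int order_le_less)
  have qd: "q dvd l1" "q dvd l2" using q by auto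
  have half: "real_of_int k / 2 \<notin> \<int>" if "odd k" for k
  proof
    assume "real_of_int k / 2 \<in> \<int>"
    then obtain m :: int where "real_of_int k / 2 = m" by (rule Ints_cases)
    then have "real_of_int k = of_int (2 * m)" by simp
    then have "k = 2 * m" by (simp only: of_int_eq_iff)
    then show False using that by simp
  qed
  assume ?R
  then consider "\<delta> = 1" "v $ 2 = 0" | "\<delta> = -1" "odd (v $ 2)"
    | "\<delta> = -1" "v $ 2 = 0" "\<alpha> = -1" "even q" "odd (v $ 1)"
    | k where "\<delta> = -1" "v $ 2 = 0" "\<alpha> = 1" "even k" "q = k * gcd q (v $ 1)"
    by blast
  then show "\<exists>h. free_displacement A L v h"
  proof cases
    case 1
    show ?thesis
      by (rule free_displacement_horizontal[OF A(1) L(1) comm half[of 1]]) (use 1 in simp_all)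
  next
    case 2
    show ?thesis
      by (rule free_displacement_horizontal[OF A(1) L(1) comm half[of "v $ 2"]]) (use 2 in simp_all)
  next
    case 3
    have "A = vector [vector [-1, b], vector [0, -1]]" "- 1 * l2 = l1 * b + l2 * (-1)"
      using A(1) comm 3 by simp_all
    from free_displacement_cos[OF this(1) L(1) this(2) 3(2,5) qd 3(4)] show ?thesis .
  next
    case 4
    have "A = vector [vector [1, b], vector [0, -1]]" "1 * l2 = l1 * b + l2 * (-1)"
      using A(1) comm 4 by simp_all
    from free_displacement_sin[OF this(1) L(1) this(2) 4(2) qd qpos 4(5,4)] show ?thesis .
  qed
qed

section \<open>The cases where L is invertible or zero\<close>

lemma no_free_displacement_if_det:
  assumes "det (real_mat L) \<noteq> 0"
  shows "\<not> free_displacement A L v h"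
proof
  assume h: "free_displacement A L v h"
  have "surj (\<lambda>x. h (x, 0))"
  proof (rule surj_of_linear_increments[OF _ _ assms])
    have "continuous_on (UNIV \<times> {0..1}) h" using h by (simp add: free_displacement_def)
    then show "continuous_on UNIV (\<lambda>x. h (x, 0))"
      by (rule continuous_on_compose2) (auto intro!: continuous_intros)
    show "h (x + real_vec n, 0) = h (x, 0) + real_mat L *v real_vec n" for x n
      using h by (simp add: free_displacement_def)
  qed
  from surjD[OF this, of "real_vec 0"] obtain x where "h (x, 0) = real_vec 0" by metis
  then have "h (x, 0) \<in> range real_vec" by (metis rangeI)
  moreover have "h (x, 0) \<notin> range real_vec" using h by (simp add: free_displacement_def)
  ultimately show False by blast
qed

text \<open>A displacement independent of x is a path, and the gluing rule only prescribes its start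
  as A (p - v), where p is its end. The complement of a countable set in the plane is path
  connected.\<close>

lemma (in gluing) free_displacement_zero: "\<exists>h. free_displacement A 0 v h"
proof -
  have "range real_vec \<subseteq> (\<lambda>(a :: int, b :: int). vector [of_int a, of_int b] :: real^2) ` UNIV"
  proof
    fix x assume "x \<in> range real_vec"
    then obtain n where "x = real_vec n" by blast
    then have "x = (\<lambda>(a :: int, b :: int). vector [of_int a, of_int b]) (n $ 1, n $ 2)"
      by (simp add: vec_eq_iff forall_2)
    then show "x \<in> (\<lambda>(a :: int, b :: int). vector [of_int a, of_int b] :: real^2) ` UNIV" by blast
  qed
  then have "countable (range real_vec)"
    by (rule countable_subset) simp
  then have pc: "path_connected (- range real_vec)"
    by (intro path_connected_complement_countable) simp_all
  define p :: "real^2" where "p = vector [1/2, 1/2]"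
  have half: "(1/2 :: real) \<notin> \<int>"
  proof
    assume "(1/2 :: real) \<in> \<int>"
    then obtain m :: int where "(1/2 :: real) = m" by (rule Ints_cases)
    then have "real_of_int (2 * m) = of_int 1" by simp
    then have "2 * m = 1" by (simp only: of_int_eq_iff)
    then show False by presburger
  qed
  have p: "p \<notin> range real_vec"
    using half by (auto simp: range_real_vec_iff forall_2 p_def)
  have "p - real_vec v \<notin> range real_vec"
  proof
    assume "p - real_vec v \<in> range real_vec"
    then obtain n where "p - real_vec v = real_vec n" by blast
    then have "p = real_vec (n + v)" by (simp add: algebra_simps)
    then show False using p by blast
  qed
  then have Ap: "real_mat A *v (p - real_vec v) \<notin> range real_vec"
    using A_range_iff by blast
  obtain \<gamma> where \<gamma>: "path \<gamma>" "path_image \<gamma> \<subseteq> - range real_vec"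
      "pathstart \<gamma> = real_mat A *v (p - real_vec v)" "pathfinish \<gamma> = p"
    using pc p Ap unfolding path_connected_def by blast
  have "free_displacement A 0 v (\<lambda>(x, t). \<gamma> t)"
    unfolding free_displacement_def
  proof (intro conjI allI impI)
    show "continuous_on (UNIV \<times> {0..1}) (\<lambda>(x :: real^2, t). \<gamma> t)"
      unfolding case_prod_unfold
      using \<gamma>(1) unfolding path_def by (rule continuous_on_compose2) (auto intro!: continuous_intros)
    show "(case (x, t) of (x, t) \<Rightarrow> \<gamma> t) \<notin> range real_vec" if "t \<in> {0..1}" for x :: "real^2" and t
      using \<gamma>(2) that unfolding path_image_def prod.case by blast
    show "(case (real_mat A *v x, 0) of (x, t) \<Rightarrow> \<gamma> t) =
        real_mat A *v ((case (x, 1) of (x, t) \<Rightarrow> \<gamma> t) - real_vec v)" for x :: "real^2"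
      using \<gamma>(3,4) by (simp add: pathstart_def pathfinish_def)
  qed simp
  then show ?thesis by blast
qed

text \<open>Change of lattice basis: here the locale matrix is the base change and \<open>B\<close>
  is the gluing matrix.\<close>

lemma (in gluing) free_displacement_conj:
  assumes h: "free_displacement B L v h"
  shows "free_displacement (A' ** B ** A) (A' ** L ** A) (A' *v v)
    (\<lambda>(x, t). real_mat A' *v h (real_mat A *v x, t))"
proof -
  have cont: "continuous_on (UNIV \<times> {0..1}) h"
    and shift: "\<And>x n t. t \<in> {0..1} \<Longrightarrow> h (x + real_vec n, t) = h (x, t) + real_vec (L *v n)"
    and glue: "\<And>x. h (real_mat B *v x, 0) = real_mat B *v (h (x, 1) - real_vec v)"
    and avoid: "\<And>x t. t \<in> {0..1} \<Longrightarrow> h (x, t) \<notin> range real_vec"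
    using h unfolding free_displacement_def by blast+
  have conj: "real_mat (A' ** B ** A) *v x = real_mat A' *v (real_mat B *v (real_mat A *v x))" for x
    by (simp only: real_mat_mult matrix_vector_mul_assoc matrix_mul_assoc)
  show ?thesis
    unfolding free_displacement_def prod.case
  proof (intro conjI allI impI)
    show "continuous_on (UNIV \<times> {0..1}) (\<lambda>(x, t). real_mat A' *v h (real_mat A *v x, t))"
      unfolding case_prod_unfold
      by (intro continuous_on_matrix_vector_mult continuous_on_compose2[OF cont])
        (auto intro!: continuous_intros)
    show "real_mat A' *v h (real_mat A *v (x + real_vec n), t) =
        real_mat A' *v h (real_mat A *v x, t) + real_vec (A' ** L ** A *v n)" if "t \<in> {0..1}" for x n t
      by (simp add: matrix_vector_right_distrib shift[OF that] matrix_mul_assoc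
          flip: matrix_vector_mul_assoc)
    show "real_mat A' *v h (real_mat A *v (real_mat (A' ** B ** A) *v x), 0) =
        real_mat (A' ** B ** A) *v (real_mat A' *v h (real_mat A *v x, 1) - real_vec (A' *v v))" for x
      unfolding conj
      by (simp add: glue matrix_vector_mult_diff_distrib flip: real_mat_real_vec)
    have "x \<in> range real_vec" if "real_mat A' *v x \<in> range real_vec" for x
      using that A_range_iff[of "real_mat A' *v x"] by simp
    then show "real_mat A' *v h (real_mat A *v x, t) \<notin> range real_vec" if "t \<in> {0..1}" for x t
      using avoid[OF that] by blast
  qed
qed

lemma (in gluing) free_displacement_conj_iff:
  "(\<exists>h. free_displacement B L v h) \<longleftrightarrow>
   (\<exists>h. free_displacement (A' ** B ** A) (A' ** L ** A) (A' *v v) h)"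
proof
  interpret inv: gluing A' A by unfold_locales (rule A'A, rule AA')
  have undo: "A ** (A' ** M ** A) ** A' = M" for M
  proof -
    have "A ** (A' ** M ** A) ** A' = (A ** A') ** M ** (A ** A')"
      by (simp only: matrix_mul_assoc)
    then show ?thesis by (simp add: AA')
  qed
  assume "\<exists>h. free_displacement (A' ** B ** A) (A' ** L ** A) (A' *v v) h"
  then show "\<exists>h. free_displacement B L v h"
    using inv.free_displacement_conj[of "A' ** B ** A" "A' ** L ** A" "A' *v v"]
    unfolding undo matrix_vector_mul_assoc AA' matrix_vector_mul_lid by blast
qed (use free_displacement_conj in blast)


section \<open>Normal form with respect to an adapted basis\<close>

lemma basis_matrix:
  assumes "\<And>n :: int ^ 2. \<exists>!(a, b). n = a *s y1 + b *s y2"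
  obtains Y Y' where "gluing Y Y'" "\<And>n. Y *v n = n $ 1 *s y1 + n $ 2 *s y2"
proof -
  define Y :: "int^2^2" where "Y = vector [vector [y1 $ 1, y2 $ 1], vector [y1 $ 2, y2 $ 2]]"
  have Y: "Y *v n = n $ 1 *s y1 + n $ 2 *s y2" for n
    by (simp add: Y_def upper_triangular_mult_vec vec_eq_iff forall_2 mult.commute)
  have ex: "\<exists>m. Y *v m = n" for n
  proof -
    obtain a b where "n = a *s y1 + b *s y2" using assms[of n] by auto
    then have "Y *v vector [a, b] = n" by (simp add: Y)
    then show ?thesis by blast
  qed
  have inj: "m = n" if "Y *v m = Y *v n" for m n
  proof -
    let ?P = "\<lambda>p. case p of (a, b) \<Rightarrow> Y *v m = a *s y1 + b *s y2"
    have "\<exists>!p. ?P p" by (rule assms)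
    moreover have "?P (m $ 1, m $ 2)" "?P (n $ 1, n $ 2)"
      using that by (simp_all add: Y)
    ultimately have "(m $ 1, m $ 2) = (n $ 1, n $ 2)" by blast
    then show ?thesis by (simp add: vec_eq_iff forall_2)
  qed
  \<comment> \<open>Preimages of the unit vectors; they are the columns of the inverse
    matrix.\<close>
  obtain e1 e2 where e: "Y *v e1 = vector [1, 0]" "Y *v e2 = vector [0, 1]"
    using ex by metis
  define Y' :: "int^2^2" where "Y' = vector [vector [e1 $ 1, e2 $ 1], vector [e1 $ 2, e2 $ 2]]"
  have "Y' *v n = n $ 1 *s e1 + n $ 2 *s e2" for n
    by (simp add: Y'_def upper_triangular_mult_vec vec_eq_iff forall_2 mult.commute)
  then have "Y *v (Y' *v n) = n $ 1 *s (Y *v e1) + n $ 2 *s (Y *v e2)" for n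
    by (simp add: matrix_vector_right_distrib)
      (simp add: vec_eq_iff forall_2 matrix_vector_mult_def sum_2 algebra_simps)
  then have YY': "Y *v (Y' *v n) = n" for n
    by (simp add: e vec_eq_iff forall_2)
  have "Y' *v (Y *v n) = n" for n
    by (rule inj) (rule YY')
  then have "gluing Y Y'"
    by unfold_locales (simp_all add: matrix_eq YY' flip: matrix_vector_mul_assoc)
  then show thesis using Y by (rule that)
qed

text \<open>In the basis, L sends n to the multiple l1 n_1 + l2 n_2 of \<open>y1\<close>, and by
  Bezout these coefficients are exactly the multiples of gcd l1 l2.\<close>

lemma L_index_eq_gcd:
  assumes Y: "gluing Y Y'" "\<And>n. Y *v n = n $ 1 *s y1 + n $ 2 *s y2"
    and L: "Y' ** L_mat F ** Y = vector [vector [l1, l2], vector [0, 0]]"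
    and lat: "lattice_in_L_image F = range (\<lambda>k. k *s y1)"
    and nz: "l1 \<noteq> 0 \<or> l2 \<noteq> 0"
  shows "int (L_index F) = gcd l1 l2"
proof -
  interpret Y: gluing Y Y' by (fact Y(1))
  define g where "g = gcd l1 l2"
  have g: "g > 0" using nz unfolding g_def by (metis gcd_eq_0_iff gcd_ge_0_int order_le_less)
  have Yinj: "m = n" if "Y *v m = Y *v n" for m n
    using arg_cong[OF that, of "\<lambda>x. Y' *v x"] by (simp add: matrix_vector_mul_assoc Y.A'A)
  have y1: "k *s y1 = Y *v vector [k, 0]" for k
    by (simp add: Y(2))
  have LY: "L_mat F *v (Y *v n) = (l1 * n $ 1 + l2 * n $ 2) *s y1" for n
  proof -
    have "Y *v ((Y' ** L_mat F ** Y) *v n) = (Y ** Y') *v (L_mat F *v (Y *v n))"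
      by (simp only: matrix_vector_mul_assoc matrix_mul_assoc)
    then have "L_mat F *v (Y *v n) = Y *v ((Y' ** L_mat F ** Y) *v n)"
      by (simp add: Y.AA')
    then show ?thesis unfolding L y1 by (simp add: upper_triangular_mult_vec)
  qed
  have range: "k *s y1 \<in> range (\<lambda>k. L_mat F *v k) \<longleftrightarrow> g dvd k" for k
  proof
    assume "k *s y1 \<in> range (\<lambda>k. L_mat F *v k)"
    then obtain m where "k *s y1 = L_mat F *v m" by blast
    also have "m = Y *v (Y' *v m)" by (simp add: matrix_vector_mul_assoc Y.AA')
    also have "L_mat F *v \<dots> = (l1 * (Y' *v m) $ 1 + l2 * (Y' *v m) $ 2) *s y1" by (rule LY)
    finally have "k = l1 * (Y' *v m) $ 1 + l2 * (Y' *v m) $ 2"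
      unfolding y1 using Yinj by (metis vector_2(1))
    then show "g dvd k" by (simp add: g_def)
  next
    assume "g dvd k"
    then obtain c where c: "k = g * c" by blast
    obtain u w where "u * l1 + w * l2 = g" using bezout_int[of l1 l2] g_def by blast
    then have "l1 * (c * u) + l2 * (c * w) = k" using c by (simp add: algebra_simps flip: distrib_left)
    then have "k *s y1 = L_mat F *v (Y *v vector [c * u, c * w])" by (simp add: LY)
    then show "k *s y1 \<in> range (\<lambda>k. L_mat F *v k)" by blast
  qed
  \<comment> \<open>On the multiples of \<open>y1\<close> this is congruence of coefficients modulo
    \<open>g\<close>, with the residues 0, ..., g - 1 as representatives.\<close>
  define R where "R = {(m, n). m \<in> lattice_in_L_image F \<and> n \<in> lattice_in_L_image F \<and>
                n - m \<in> range (\<lambda>k. L_mat F *v k)}"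
  have R: "(k *s y1, j *s y1) \<in> R \<longleftrightarrow> g dvd j - k" for k j
  proof -
    have "j *s y1 - k *s y1 = (j - k) *s y1" by (simp add: vec_eq_iff algebra_simps)
    then show ?thesis unfolding R_def lat using range[of "j - k"] by auto
  qed
  have Rsub: "R \<subseteq> range (\<lambda>k. k *s y1) \<times> range (\<lambda>k. k *s y1)"
    unfolding R_def lat by blast
  define cl where "cl = (\<lambda>k. R `` {k *s y1})"
  have cl_eq: "cl k = cl j \<longleftrightarrow> g dvd j - k" for k j
  proof
    assume "cl k = cl j"
    moreover have "j *s y1 \<in> cl j" by (simp add: cl_def R)
    ultimately have "j *s y1 \<in> cl k" by simp
    then show "g dvd j - k" by (simp add: cl_def R)
  next
    assume d: "g dvd j - k"
    have "(k *s y1, m) \<in> R \<longleftrightarrow> (j *s y1, m) \<in> R" for m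
    proof (cases "m \<in> range (\<lambda>k. k *s y1)")
      case True
      then obtain i where m: "m = i *s y1" by blast
      have "g dvd i - k \<longleftrightarrow> g dvd i - j"
        using d by (metis diff_diff_eq2 diff_add_cancel dvd_diff dvd_add diff_eq_eq add_diff_eq add.commute)
      then show ?thesis unfolding m R .
    qed (use Rsub in blast)
    then show "cl k = cl j" unfolding cl_def by auto
  qed
  have "lattice_in_L_image F // R = cl ` UNIV"
    unfolding quotient_def lat cl_def by auto
  also have "\<dots> = cl ` {0..<g}"
  proof -
    have "cl k \<in> cl ` {0..<g}" for k
    proof
      show "cl k = cl (k mod g)"
        unfolding cl_eq by (metis dvd_diff_commute dvd_minus_mod)
    qed (use g in simp)
    then show ?thesis by blast
  qed
  finally have "lattice_in_L_image F // R = cl ` {0..<g}" .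
  moreover have "inj_on cl {0..<g}"
  proof (rule inj_onI)
    fix k j assume "k \<in> {0..<g}" "j \<in> {0..<g}" "cl k = cl j"
    then have "g dvd j - k" "\<bar>j - k\<bar> < g" using cl_eq by auto
    then have "j - k = 0" by (metis dvd_imp_le_int g linorder_not_less abs_of_pos)
    then show "k = j" by simp
  qed
  ultimately have "L_index F = card {0..<g}"
    unfolding L_index_def R_def[symmetric] by (simp add: card_image)
  then show ?thesis using g by (simp add: g_def)
qed

section \<open>Dimension of the eigenspace and normal form\<close>

lemma eigenspace_kernel: "w \<in> W1 F \<longleftrightarrow> real_mat (L_mat F) *v w = 0"
  by (simp add: W1_def real_L_mat_vec)

text \<open>\<open>W1 F\<close> is the kernel of L. Its dimension is 0 when L is invertible, 2 when
  L = 0, and 1 otherwise.\<close>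

lemma det_L_mat_eq_0_iff:
  "det (real_mat (L_mat F)) = 0 \<longleftrightarrow> F = mat 1 \<or> dim (W1 F) = 1"
proof -
  have sub: "subspace (W1 F)"
    by (simp add: subspace_def eigenspace_kernel matrix_vector_right_distrib matrix_vector_mult_scaleR)
  have d0: "dim (W1 F) = 0 \<longleftrightarrow> det (real_mat (L_mat F)) \<noteq> 0"
  proof -
    have "dim (W1 F) = 0 \<longleftrightarrow> W1 F \<subseteq> {0}" by (rule dim_eq_0)
    also have "\<dots> \<longleftrightarrow> (\<forall>w. real_mat (L_mat F) *v w = 0 \<longrightarrow> w = 0)"
      by (auto simp: eigenspace_kernel)
    also have "\<dots> \<longleftrightarrow> invertible (real_mat (L_mat F))"
      by (metis invertible_left_inverse matrix_left_invertible_ker)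
    finally show ?thesis by (simp add: invertible_det_nz)
  qed
  have d2: "dim (W1 F) = 2 \<longleftrightarrow> F = mat 1"
  proof
    assume "dim (W1 F) = 2"
    then have "span (W1 F) = UNIV"
      using dim_eq_full[of "W1 F"] by simp
    moreover have "span (W1 F) = W1 F"
      using sub by (simp only: span_eq_iff)
    ultimately have "W1 F = UNIV" by simp
    then have "real_mat (L_mat F) *v w = 0" for w using eigenspace_kernel by blast
    then have "real_mat (L_mat F) = 0" by (simp add: matrix_eq)
    then have "L_mat F = 0" by (simp add: vec_eq_iff)
    then show "F = mat 1" by (simp add: L_mat_def)
  next
    assume "F = mat 1"
    then have "W1 F = UNIV" by (simp add: W1_def)
    then show "dim (W1 F) = 2" by simp
  qed
  have "dim (W1 F) \<le> 2" using dim_subset_UNIV[of "W1 F"] by simp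
  then have "dim (W1 F) = 0 \<or> dim (W1 F) = 1 \<or> dim (W1 F) = 2" by arith
  then show ?thesis using d0 d2 by (metis zero_neq_numeral zero_neq_one)
qed

lemma (in gluing) det_squared: "(det A)\<^sup>2 = 1"
proof -
  have "det A * det A' = 1" using arg_cong[OF AA', of det] by (simp add: det_mul)
  then have "\<bar>det A\<bar> = 1" by (metis dvdI zdvd1_eq)
  then show ?thesis by (simp add: power2_eq_1_iff abs_eq_iff')
qed

text \<open>L maps the lattice into the line of \<open>y1\<close>, which kills its second row. A
  commutes with L and preserves that line, so it is upper triangular; its determinant is a unit, so
  both diagonal entries are signs.\<close>

lemma adapted_basis_normal_form:
  assumes A: "gluing A A'" and comm: "F ** A = A ** F" and F: "F \<noteq> mat 1"
    and basis: "adapted_basis F y1 y2"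
  obtains Y Y' \<alpha> b \<delta> l1 l2 where "gluing Y Y'" "\<And>n. Y *v n = n $ 1 *s y1 + n $ 2 *s y2"
    "Y' ** A ** Y = vector [vector [\<alpha>, b], vector [0, \<delta>]]" "\<alpha>\<^sup>2 = 1" "\<delta>\<^sup>2 = 1" "det A = \<alpha> * \<delta>"
    "Y' ** L_mat F ** Y = vector [vector [l1, l2], vector [0, 0]]" "l1 \<noteq> 0 \<or> l2 \<noteq> 0"
    "\<alpha> * l2 = l1 * b + l2 * \<delta>"
    "int (L_index F) = gcd l1 l2"
    "\<And>w. w \<in> W1 F \<Longrightarrow> real_mat A *v w = of_int \<delta> *\<^sub>R w" "\<exists>w\<in>W1 F. w \<noteq> 0"
proof -
  interpret A: gluing A A' by (fact A)
  have ex: "\<exists>!(a, b). n = a *s y1 + b *s y2" for n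
    using basis unfolding adapted_basis_def by blast
  obtain Y Y' where YY: "gluing Y Y'" and Y: "\<And>n. Y *v n = n $ 1 *s y1 + n $ 2 *s y2"
    by (rule basis_matrix[OF ex]) (rule that)
  interpret Y: gluing Y Y' by (fact YY)
  have lat: "lattice_in_L_image F = range (\<lambda>k. k *s y1)"
    using basis by (simp add: adapted_basis_def)
  let ?L = "L_mat F"
  have AL: "A ** ?L = ?L ** A"
  proof -
    have "(A ** ?L) *v n = (?L ** A) *v n" for n
    proof -
      have "(A ** ?L) *v n = (A ** F) *v n - A *v n"
        by (simp add: L_mat_vec matrix_vector_mult_diff_distrib flip: matrix_vector_mul_assoc)
      also have "\<dots> = F *v (A *v n) - A *v n"
        by (simp add: matrix_vector_mul_assoc flip: comm)
      finally show ?thesis by (simp add: L_mat_vec flip: matrix_vector_mul_assoc)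
    qed
    then show ?thesis by (simp add: matrix_eq)
  qed
  have conj_entry: "(Y' ** M ** Y) *v n = Y' *v (M *v (Y *v n))" for M n
    by (simp only: matrix_vector_mul_assoc matrix_mul_assoc)
  have Y'y1: "(Y' *v (k *s y1)) = vector [k, 0]" for k
  proof -
    have "k *s y1 = Y *v vector [k, 0]" by (simp add: Y)
    then show ?thesis by (simp add: matrix_vector_mul_assoc Y.A'A)
  qed
  have form: "M = vector [vector [M $ 1 $ 1, M $ 1 $ 2], vector [M $ 2 $ 1, M $ 2 $ 2]]" for M :: "int^2^2"
    by (simp add: vec_eq_iff forall_2)
  have col: "M *v vector [1, 0] = vector [M $ 1 $ 1, M $ 2 $ 1]"
    "M *v vector [0, 1] = vector [M $ 1 $ 2, M $ 2 $ 2]" for M :: "int^2^2"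
    by (simp_all add: vec_eq_iff forall_2 matrix_vector_mult_def sum_2)
  define AA where "AA = Y' ** A ** Y"
  define LL where "LL = Y' ** ?L ** Y"
  have L0: "(LL *v n) $ 2 = 0" for n
  proof -
    have "?L *v (Y *v n) \<in> lattice_in_L_image F"
      unfolding lattice_in_L_image_def L_image_def by (simp flip: real_mat_real_vec)
    then obtain k where "?L *v (Y *v n) = k *s y1" unfolding lat by blast
    then show ?thesis unfolding LL_def conj_entry using Y'y1 by simp
  qed
  have "LL $ 2 $ 1 = 0" "LL $ 2 $ 2 = 0"
    using L0[of "vector [1, 0]"] L0[of "vector [0, 1]"] by (simp_all add: col)
  then have LL: "LL = vector [vector [LL $ 1 $ 1, LL $ 1 $ 2], vector [0, 0]]"
    using form[of LL] by simp
  \<comment> \<open>A L = L A carries the image of L into itself, and A preserves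
    integrality.\<close>
  have "A *v y1 \<in> lattice_in_L_image F"
  proof -
    have "y1 \<in> lattice_in_L_image F" unfolding lat by (metis rangeI vector_smult_lid)
    then obtain x where "real_vec y1 = real_mat ?L *v x"
      unfolding lattice_in_L_image_def L_image_def by blast
    then have "real_vec (A *v y1) = real_mat (A ** ?L) *v x"
      by (simp add: real_mat_mult matrix_vector_mul_assoc flip: real_mat_real_vec)
    also have "\<dots> = real_mat ?L *v (real_mat A *v x)"
      unfolding AL by (simp add: real_mat_mult matrix_vector_mul_assoc)
    finally show ?thesis unfolding lattice_in_L_image_def L_image_def by blast
  qed
  then obtain k where "A *v y1 = k *s y1" unfolding lat by blast
  then have "AA *v vector [1, 0] = vector [k, 0]"
    unfolding AA_def conj_entry using Y'y1[of k] by (simp add: Y)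
  then have "AA $ 2 $ 1 = 0" unfolding col by (metis vector_2(2))
  then have AA: "AA = vector [vector [AA $ 1 $ 1, AA $ 1 $ 2], vector [0, AA $ 2 $ 2]]"
    using form[of AA] by simp
  let ?\<alpha> = "AA $ 1 $ 1" and ?b = "AA $ 1 $ 2" and ?\<delta> = "AA $ 2 $ 2"
  let ?l1 = "LL $ 1 $ 1" and ?l2 = "LL $ 1 $ 2"
  have "det AA = det Y' * det A * det Y" by (simp add: AA_def det_mul)
  moreover have "det Y' * det Y = 1" using arg_cong[OF Y.A'A, of det] by (simp add: det_mul)
  ultimately have "det AA = det A" by (metis mult.assoc mult.commute mult_1)
  then have det: "det A = ?\<alpha> * ?\<delta>" using \<open>AA $ 2 $ 1 = 0\<close> by (simp add: det_2)
  then have sq: "?\<alpha>\<^sup>2 = 1" "?\<delta>\<^sup>2 = 1"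
  proof -
    have "(?\<alpha> * ?\<delta>) * (?\<alpha> * ?\<delta>) = 1" using A.det_squared det by (simp add: power2_eq_square)
    then have "?\<alpha> * (?\<delta> * ?\<alpha> * ?\<delta>) = 1" "?\<delta> * (?\<alpha> * ?\<alpha> * ?\<delta>) = 1" by (simp_all add: ac_simps)
    then have "?\<alpha> dvd 1" "?\<delta> dvd 1" by (metis dvdI)+
    then show "?\<alpha>\<^sup>2 = 1" "?\<delta>\<^sup>2 = 1" by (simp_all add: power2_eq_1_iff zdvd1_eq abs_eq_iff')
  qed
  have un: "Y ** (Y' ** M ** Y) ** Y' = M" for M
  proof -
    have "Y ** (Y' ** M ** Y) ** Y' = (Y ** Y') ** M ** (Y ** Y')" by (simp only: matrix_mul_assoc)
    then show ?thesis by (simp add: Y.AA')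
  qed
  have nz: "?l1 \<noteq> 0 \<or> ?l2 \<noteq> 0"
  proof (rule ccontr)
    assume "\<not> (?l1 \<noteq> 0 \<or> ?l2 \<noteq> 0)"
    then have "LL = 0" using LL by (simp add: vec_eq_iff forall_2)
    then have "?L = 0" using un[of ?L] unfolding LL_def[symmetric] by simp
    then show False using F by (simp add: L_mat_def)
  qed
  have AALL: "AA ** LL = LL ** AA"
  proof -
    have "AA ** LL = Y' ** A ** (Y ** Y') ** ?L ** Y"
      by (simp only: AA_def LL_def matrix_mul_assoc)
    moreover have "LL ** AA = Y' ** ?L ** (Y ** Y') ** A ** Y"
      by (simp only: AA_def LL_def matrix_mul_assoc)
    moreover have "Y' ** A ** ?L = Y' ** ?L ** A"
      using AL by (metis matrix_mul_assoc)
    ultimately show ?thesis by (simp add: Y.AA')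
  qed
  have entry: "(M ** N) $ 1 $ 2 = M $ 1 $ 1 * N $ 1 $ 2 + M $ 1 $ 2 * N $ 2 $ 2" for M N :: "int^2^2"
    by (simp add: matrix_matrix_mult_def sum_2)
  \<comment> \<open>The upper right entry of the commutation relation.\<close>
  have cm: "?\<alpha> * ?l2 = ?l1 * ?b + ?l2 * ?\<delta>"
    using arg_cong[OF AALL, of "\<lambda>M. M $ 1 $ 2"]
    by (simp only: entry \<open>LL $ 2 $ 2 = 0\<close> mult_zero_right add_0_right)
  have cmr: "of_int ?\<alpha> * of_int ?l2 = (of_int ?l1 * of_int ?b + of_int ?l2 * of_int ?\<delta> :: real)"
    using arg_cong[OF cm, of real_of_int] by (simp only: of_int_add of_int_mult)
  have real_conj: "real_mat M *v (real_mat Y *v x) = real_mat Y *v (real_mat (Y' ** M ** Y) *v x)" for M x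
  proof -
    have "real_mat Y *v (real_mat (Y' ** M ** Y) *v x) = real_mat (Y ** (Y' ** M ** Y)) *v x"
      by (simp only: real_mat_mult matrix_vector_mul_assoc)
    also have "Y ** (Y' ** M ** Y) = (Y ** Y') ** M ** Y" by (simp only: matrix_mul_assoc)
    finally show ?thesis by (simp add: Y.AA' real_mat_mult matrix_vector_mul_assoc)
  qed
  have LLx: "real_mat LL *v x = vector [?l1 * x $ 1 + ?l2 * x $ 2, 0]" for x
    by (subst LL) (simp add: real_mat_vector_2 upper_triangular_mult_vec)
  have AAx: "real_mat AA *v x = vector [?\<alpha> * x $ 1 + ?b * x $ 2, ?\<delta> * x $ 2]" for x
    by (subst AA) (simp add: real_mat_vector_2 upper_triangular_mult_vec)
  have W: "real_mat Y *v x \<in> W1 F \<longleftrightarrow> ?l1 * x $ 1 + ?l2 * x $ 2 = 0" for x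
  proof -
    have "real_mat Y *v x \<in> W1 F \<longleftrightarrow> real_mat Y *v (real_mat LL *v x) = 0"
      by (simp add: eigenspace_kernel real_conj LL_def)
    also have "\<dots> \<longleftrightarrow> real_mat LL *v x = 0"
      by (metis Y.real_A'A matrix_vector_mult_0_right)
    finally show ?thesis by (simp add: LLx vec_eq_iff forall_2)
  qed
  have eig: "real_mat A *v w = of_int ?\<delta> *\<^sub>R w" if "w \<in> W1 F" for w
  proof -
    define x where "x = real_mat Y' *v w"
    have w: "w = real_mat Y *v x" by (simp add: x_def)
    have x0: "?l1 * x $ 1 + ?l2 * x $ 2 = 0" using that W w by simp
    \<comment> \<open>On the kernel l1 x_1 + l2 x_2 = 0 the relation \<open>cm\<close> turns the
      first coordinate of A x into \<delta> x_1. If l2 = 0, then x_1 = 0 and b = 0.\<close>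
    have "?\<alpha> * x $ 1 + ?b * x $ 2 = ?\<delta> * x $ 1"
    proof (cases "?l2 = 0")
      case True
      then have "?l1 \<noteq> 0" using nz by simp
      then show ?thesis using True x0 cm by simp
    next
      case False
      have "of_int ?l2 * (?\<alpha> * x $ 1 + ?b * x $ 2) = of_int ?l2 * (?\<delta> * x $ 1)"
        using cmr x0 by algebra
      then show ?thesis using False by simp
    qed
    then have "real_mat AA *v x = of_int ?\<delta> *\<^sub>R x"
      by (simp add: AAx vec_eq_iff forall_2)
    then show ?thesis
      unfolding w real_conj AA_def[symmetric] by (simp add: matrix_vector_mult_scaleR)
  qed
  \<comment> \<open>The vector (l2, -l1) spans the kernel of the linear form (l1, l2).\<close>
  have "real_mat Y *v vector [of_int ?l2, - of_int ?l1] \<in> W1 F"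
    by (simp add: W)
  moreover have "real_mat Y *v vector [of_int ?l2, - of_int ?l1] \<noteq> 0"
  proof
    assume "real_mat Y *v vector [of_int ?l2, - of_int ?l1] = 0"
    then have "(vector [of_int ?l2, - of_int ?l1] :: real^2) = 0"
      by (metis Y.real_A'A matrix_vector_mult_0_right)
    then show False using nz by (simp add: vec_eq_iff forall_2)
  qed
  ultimately have "\<exists>w\<in>W1 F. w \<noteq> 0" by blast
  moreover have "int (L_index F) = gcd ?l1 ?l2"
    by (rule L_index_eq_gcd[OF YY Y _ lat nz]) (use LL LL_def in simp)
  ultimately show thesis
    using that[OF YY Y, of ?\<alpha> ?b ?\<delta> ?l1 ?l2] AA LL sq det nz cm eig
    unfolding AA_def LL_def by blast
qed

theorem corollary1p35:
  fixes A F :: "int ^ 2 ^ 2"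
    and f :: "bundle_pt \<Rightarrow> bundle_pt"
    and v y1 y2 :: "int ^ 2"
    and v1 v2 :: int
    and q :: nat
  assumes "invertible A"
    and "fiberwise_map A f"
    and "induces_on_fiber A f F"
    and "section_homotopic A (f \<circ> std_section A 0) (std_section A v)"
    and "dim (W1 F) = 1 \<Longrightarrow> adapted_basis F y1 y2"
    and "dim (W1 F) = 1 \<Longrightarrow> v = v1 *s y1 + v2 *s y2"
    and "dim (W1 F) = 1 \<Longrightarrow> \<forall>w \<in> W1 F. real_mat A *v w = - w \<Longrightarrow> even v2 \<Longrightarrow> v2 = 0"
    and "dim (W1 F) = 1 \<Longrightarrow> q = L_index F"
  shows "(\<exists>g. fiberwise_homotopic A f g \<and> fixed_point_free A g) \<longleftrightarrow>
    F = mat 1 \<or>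
    (dim (W1 F) = 1 \<and>
      (((\<forall>w \<in> W1 F. real_mat A *v w = w) \<and> v2 = 0) \<or>
       ((\<forall>w \<in> W1 F. real_mat A *v w = - w) \<and> odd v2) \<or>
       ((\<forall>w \<in> W1 F. real_mat A *v w = - w) \<and> v2 = 0 \<and> det A = 1 \<and> even q \<and> odd v1) \<or>
       ((\<forall>w \<in> W1 F. real_mat A *v w = - w) \<and> v2 = 0 \<and> det A = -1 \<and>
          (\<exists>k. even k \<and> int q = k * gcd (int q) v1))))"
proof -
  obtain A' where "gluing A A'"
    using assms(1) by (auto simp: invertible_def gluing_def)
  then interpret gluing A A' .
  have fp: "(\<exists>g. fiberwise_homotopic A f g \<and> fixed_point_free A g) \<longleftrightarrow>
      (\<exists>h. free_displacement A (L_mat F) v h)"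
    by (rule fixed_point_free_iff[OF assms(2-4)])
  have comm: "F ** A = A ** F"
    by (rule fiber_endomorphism_commutes[OF assms(2-4)])
  \<comment> \<open>By \<open>det_L_mat_eq_0_iff\<close> these are the cases L = 0, L invertible and
    L of rank 1.\<close>
  consider "F = mat 1" | "F \<noteq> mat 1" "dim (W1 F) \<noteq> 1" | "F \<noteq> mat 1" "dim (W1 F) = 1"
    by blast
  then show ?thesis
  proof cases
    case 1
    then have "L_mat F = 0" by (simp add: L_mat_def)
    then show ?thesis using 1 free_displacement_zero[of v] unfolding fp by simp
  next
    case 2
    then have "det (real_mat (L_mat F)) \<noteq> 0" by (simp add: det_L_mat_eq_0_iff)
    then show ?thesis using 2 no_free_displacement_if_det unfolding fp by blast
  next
    case 3
    obtain Y Y' \<alpha> b \<delta> l1 l2 where YY: "gluing Y Y'" and Y: "\<And>n. Y *v n = n $ 1 *s y1 + n $ 2 *s y2"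
      and AY: "Y' ** A ** Y = vector [vector [\<alpha>, b], vector [0, \<delta>]]" "\<alpha>\<^sup>2 = 1" "\<delta>\<^sup>2 = 1"
      and detA: "det A = \<alpha> * \<delta>"
      and LY: "Y' ** L_mat F ** Y = vector [vector [l1, l2], vector [0, 0]]" "l1 \<noteq> 0 \<or> l2 \<noteq> 0"
      and cm: "\<alpha> * l2 = l1 * b + l2 * \<delta>"
      and index: "int (L_index F) = gcd l1 l2"
      and eig: "\<And>w. w \<in> W1 F \<Longrightarrow> real_mat A *v w = of_int \<delta> *\<^sub>R w" "\<exists>w\<in>W1 F. w \<noteq> 0"
      by (rule adapted_basis_normal_form[OF \<open>gluing A A'\<close> comm 3(1) assms(5)[OF 3(2)]]) (rule that)
    interpret Y: gluing Y Y' by (fact YY)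
    have "v = Y *v vector [v1, v2]" using assms(6)[OF 3(2)] by (simp add: Y)
    then have v: "Y' *v v = vector [v1, v2]" by (simp add: matrix_vector_mul_assoc Y.A'A)
    have \<alpha>\<delta>: "\<alpha> = 1 \<or> \<alpha> = -1" "\<delta> = 1 \<or> \<delta> = -1"
      using AY(2,3) by (simp_all add: power2_eq_1_iff)
    have pos: "(\<forall>w\<in>W1 F. real_mat A *v w = w) \<longleftrightarrow> \<delta> = 1"
      and neg: "(\<forall>w\<in>W1 F. real_mat A *v w = - w) \<longleftrightarrow> \<delta> = -1"
    proof -
      \<comment> \<open>A nonzero eigenvector keeps the conditions on A over \<open>W1 F\<close>
        from being vacuous, so each of them fixes the sign \<delta>.\<close>
      obtain w where w: "w \<in> W1 F" "w \<noteq> 0" using eig(2) by blast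
      then have "w \<noteq> - w" by (simp add: eq_neg_iff_add_eq_0 flip: scaleR_2)
      then show "(\<forall>w\<in>W1 F. real_mat A *v w = w) \<longleftrightarrow> \<delta> = 1"
        and "(\<forall>w\<in>W1 F. real_mat A *v w = - w) \<longleftrightarrow> \<delta> = -1"
        using \<alpha>\<delta>(2) eig(1) w by auto
    qed
    have q: "int q = gcd l1 l2" using assms(8)[OF 3(2)] index by simp
    have "\<delta> = -1 \<Longrightarrow> even ((vector [v1, v2] :: int^2) $ 2) \<Longrightarrow> (vector [v1, v2] :: int^2) $ 2 = 0"
      using assms(7)[OF 3(2)] neg by simp
    from free_displacement_iff[OF AY LY cm q this]
    have "(\<exists>h. free_displacement A (L_mat F) v h) \<longleftrightarrow>
      (\<delta> = 1 \<and> v2 = 0) \<or> (\<delta> = -1 \<and> odd v2) \<or>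
      (\<delta> = -1 \<and> v2 = 0 \<and> \<alpha> = -1 \<and> even (int q) \<and> odd v1) \<or>
      (\<delta> = -1 \<and> v2 = 0 \<and> \<alpha> = 1 \<and> (\<exists>k. even k \<and> int q = k * gcd (int q) v1))"
      unfolding Y.free_displacement_conj_iff[of A "L_mat F" v] v by simp
    \<comment> \<open>Since det A = \<alpha> \<delta>, the determinant is -\<alpha> here and selects
      between the conditions for \<alpha> = -1 and \<alpha> = 1.\<close>
    moreover have "\<delta> = -1 \<Longrightarrow> det A = 1 \<longleftrightarrow> \<alpha> = -1" "\<delta> = -1 \<Longrightarrow> det A = -1 \<longleftrightarrow> \<alpha> = 1"
      using detA by auto
    ultimately show ?thesis
      unfolding fp pos neg using 3 by auto
  qed
qed

end
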